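(* Let ${\bf P}$ be a collectively jammed packing of $n$ disks, with radii $r_1,\dots,r_n>0$, in a torus $\mathbb T^2=\mathbb R^2/\Lambda$, where $\Lambda$ is the lattice of determinant $ac=1$ generated by $\lambda_1=(a,0)$ and $\lambda_2=(b,c)$ with $a,b,c>0$. Suppose that the radius ratios $\bar{\bf r}=(r_2/r_1,\dots,r_n/r_1)$ together with the lattice $\Lambda$ are generic, i.e. the $n+1$ real numbers $r_2/r_1,\dots,r_n/r_1,a,b$ satisfy no non-zero polynomial equation with integer coefficients. Then the number of contacts in ${\bf P}$ is $2n-1$, and the packing graph of ${\bf P}$ is isostatic, i.e. its space of equilibrium stresses is one-dimensional.
   Context: A packing of $n$ disks in the torus $\mathbb T^2=\mathbb R^2/\Lambda$ is a finite collection of labeled circular disks $D_1,\dots,D_n$ with disjoint interiors. It is given by centers ${\bf p}=({\bf p}_1,\dots,{\bf p}_n)$, with ${\bf p}_i\in\mathbb R^2$ taken modulo $\Lambda$, and radii ${\bf r}=(r_1,\dots,r_n)$, $r_i>0$, such that in the universal cover the translates of the disks have disjoint interiors: $|{\bf p}_i-{\bf p}_j-\lambda|\ge r_i+r_j$ for all $i,j$ and $\lambda\in\Lambda$ (with $\lambda\ne 0$ if $i=j$). The packing (contact) graph has the disks as vertices and one edge for each contact. A contact is a pair of touching disks in the universal cover, i.e. equality above, counted modulo $\Lambda$. Loops and multiple edges may occur. Each oriented edge joining $i$ to $j$ is represented by a well-defined vector in $\mathbb R^2$ from one center to the other in the universal cover, written ${\bf p}_i-{\bf p}_j$. A packing is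 collectively jammed if the only continuous motions of the packing (preserving the radii, in the fixed torus) are translations. A stress is an assignment of a scalar $\omega_{ij}=\omega_{ji}$ to each edge of the packing graph. It is an equilibrium stress if for each vertex $i$ one has $\sum_j\omega_{ij}({\bf p}_i-{\bf p}_j)=0$, the sum being over the edges at $i$ (in the universal cover). The packing is isostatic if its space of equilibrium stresses is one-dimensional.
   Formalization: For n = 1 the packing is additionally assumed to have at least one contact: a single small disk touching nothing is trivially collectively jammed (all its motions are translations) but has 0 contacts rather than 2n−1 = 1. For n ≥ 2 nothing is added. *)

theory Defs
  imports "HOL-Analysis.Analysis" "HOL-Analysis.Finite_Function_Topology"
begin

definition planar_lattice :: "real \<Rightarrow> real \<Rightarrow> real \<Rightarrow> (real^2) set" where
  "planar_lattice a b c =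
     {of_int k *\<^sub>R vector [a, 0] + of_int l *\<^sub>R vector [b, c] | k l :: int. True}"

text \<open>
  Disks carry the labels \<open>1, \<dots>, n\<close>; values of \<open>p\<close> and \<open>r\<close> at other indices
  are irrelevant. Each \<open>p i\<close> is a representative in the plane of a centre modulo \<open>\<Lambda>\<close>;
  no notion below depends on the choice of representatives, except that contacts get
  relabelled accordingly.
\<close>

definition is_packing ::
  "(real^2) set \<Rightarrow> nat \<Rightarrow> (nat \<Rightarrow> real^2) \<Rightarrow> (nat \<Rightarrow> real) \<Rightarrow> bool" where
  "is_packing \<Lambda> n p r \<longleftrightarrow>
     (\<forall>i\<in>{1..n}. r i > 0) \<and>
     (\<forall>i\<in>{1..n}. \<forall>j\<in>{1..n}. \<forall>v\<in>\<Lambda>. (i = j \<longrightarrow> v \<noteq> 0) \<longrightarrow>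
        norm (p i - p j - v) \<ge> r i + r j)"

text \<open>
  The triple \<open>(i, j, v)\<close> is the oriented contact between the disk centred at \<open>p i\<close> and
  the disk centred at \<open>p j + v\<close>. Every pair of touching disks in the universal cover
  can be translated by \<open>\<Lambda>\<close> so that its first disk is centred at \<open>p i\<close>, hence the
  triples are exactly the ordered touching pairs modulo \<open>\<Lambda>\<close>. Exchanging the two disks
  and translating by \<open>-v\<close> turns \<open>(i, j, v)\<close> into \<open>(j, i, -v)\<close>.
\<close>

definition oriented_contacts ::
  "(real^2) set \<Rightarrow> nat \<Rightarrow> (nat \<Rightarrow> real^2) \<Rightarrow> (nat \<Rightarrow> real) \<Rightarrow> (nat \<times> nat \<times> (real^2)) set" where
  "oriented_contacts \<Lambda> n p r =
     {(i, j, v). i \<in> {1..n} \<and> j \<in> {1..n} \<and> v \<in> \<Lambda> \<and> (i = j \<longrightarrow> v \<noteq> 0) \<and>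
        norm (p i - p j - v) = r i + r j}"

definition contact_edge :: "nat \<times> nat \<times> (real^2) \<Rightarrow> (nat \<times> nat \<times> (real^2)) set" where
  "contact_edge = (\<lambda>(i, j, v). {(i, j, v), (j, i, - v)})"

definition contacts ::
  "(real^2) set \<Rightarrow> nat \<Rightarrow> (nat \<Rightarrow> real^2) \<Rightarrow> (nat \<Rightarrow> real) \<Rightarrow> (nat \<times> nat \<times> (real^2)) set set" where
  "contacts \<Lambda> n p r = contact_edge ` oriented_contacts \<Lambda> n p r"

text \<open>
  A continuous motion in the torus is represented by its lift to the universal cover
  starting at the given representatives of the centres.
\<close>

definition is_motion ::
  "(real^2) set \<Rightarrow> nat \<Rightarrow> (nat \<Rightarrow> real^2) \<Rightarrow> (nat \<Rightarrow> real) \<Rightarrow> (real \<Rightarrow> nat \<Rightarrow> real^2) \<Rightarrow> bool" where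
  "is_motion \<Lambda> n p r q \<longleftrightarrow>
     (\<forall>i\<in>{1..n}. continuous_on {0..1} (\<lambda>t. q t i)) \<and>
     (\<forall>i\<in>{1..n}. q 0 i = p i) \<and>
     (\<forall>t\<in>{0..1}. is_packing \<Lambda> n (q t) r)"

definition collectively_jammed ::
  "(real^2) set \<Rightarrow> nat \<Rightarrow> (nat \<Rightarrow> real^2) \<Rightarrow> (nat \<Rightarrow> real) \<Rightarrow> bool" where
  "collectively_jammed \<Lambda> n p r \<longleftrightarrow>
     (\<forall>q. is_motion \<Lambda> n p r q \<longrightarrow>
        (\<forall>t\<in>{0..1}. \<exists>w. \<forall>i\<in>{1..n}. q t i = p i + w))"

text \<open>
  A stress is a function on edges that is zero outside the packing graph. Finite support
  is no restriction, see \<open>finite_contacts\<close> below. At a vertex \<open>i\<close> the sum runs over the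
  oriented edges leaving \<open>i\<close>, so a loop at \<open>i\<close> occurs in both of its orientations and
  its two terms cancel.
\<close>

definition equilibrium_stresses ::
  "(real^2) set \<Rightarrow> nat \<Rightarrow> (nat \<Rightarrow> real^2) \<Rightarrow> (nat \<Rightarrow> real)
     \<Rightarrow> ((nat \<times> nat \<times> (real^2)) set \<Rightarrow>\<^sub>0 real) set" where
  "equilibrium_stresses \<Lambda> n p r =
     {\<omega>. Poly_Mapping.keys \<omega> \<subseteq> contacts \<Lambda> n p r \<and>
        (\<forall>k\<in>{1..n}.
           (\<Sum>(i, j, v) \<in> {e \<in> oriented_contacts \<Lambda> n p r. fst e = k}.
              Poly_Mapping.lookup \<omega> (contact_edge (i, j, v)) *\<^sub>R (p i - p j - v)) = 0)}"

definition isostatic ::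
  "(real^2) set \<Rightarrow> nat \<Rightarrow> (nat \<Rightarrow> real^2) \<Rightarrow> (nat \<Rightarrow> real) \<Rightarrow> bool" where
  "isostatic \<Lambda> n p r \<longleftrightarrow> real_vector.dim (equilibrium_stresses \<Lambda> n p r) = 1"

text \<open>
  Multivariate integer polynomials: the outer map sends a monomial to its coefficient,
  the inner map sends (the index of) a variable to its exponent.
\<close>

type_synonym int_mpoly = "(nat \<Rightarrow>\<^sub>0 nat) \<Rightarrow>\<^sub>0 int"

definition mpoly_vars :: "int_mpoly \<Rightarrow> nat set" where
  "mpoly_vars P = (\<Union>m\<in>Poly_Mapping.keys P. Poly_Mapping.keys m)"

definition mpoly_eval :: "(nat \<Rightarrow> real) \<Rightarrow> int_mpoly \<Rightarrow> real" where
  "mpoly_eval x P =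
     (\<Sum>m\<in>Poly_Mapping.keys P. of_int (Poly_Mapping.lookup P m) *
        (\<Prod>k\<in>Poly_Mapping.keys m. x k ^ Poly_Mapping.lookup m k))"

definition generic :: "real list \<Rightarrow> bool" where
  "generic xs \<longleftrightarrow>
     (\<forall>P. mpoly_vars P \<subseteq> {..<length xs} \<longrightarrow> P \<noteq> 0 \<longrightarrow> mpoly_eval (\<lambda>k. xs ! k) P \<noteq> 0)"

lemma finite_contacts:
  assumes "a > 0" "c > 0"
  shows "finite (oriented_contacts (planar_lattice a b c) n p r)"
    and "finite (contacts (planar_lattice a b c) n p r)"
proof -
  define L :: "int \<Rightarrow> int \<Rightarrow> real^2"
    where "L k l = of_int k *\<^sub>R vector [a, 0] + of_int l *\<^sub>R vector [b, c]" for k l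
  have fin: "finite {v \<in> planar_lattice a b c. norm v \<le> B}" for B :: real
  proof -
    define N where "N = \<lceil>B / c\<rceil>"
    define M where "M = \<lceil>(B + \<bar>of_int N\<bar> * \<bar>b\<bar>) / a\<rceil>"
    have "v \<in> (\<lambda>(k, l). L k l) ` ({-M..M} \<times> {-N..N})"
      if vL: "v \<in> planar_lattice a b c" and vB: "norm v \<le> B" for v
    proof -
      obtain k l where v: "v = L k l"
        using vL unfolding planar_lattice_def L_def by blast
      have "\<bar>v $ 1\<bar> \<le> B" "\<bar>v $ 2\<bar> \<le> B"
        using vB component_le_norm_cart[of v] order_trans by blast+
      then have 1: "\<bar>of_int k * a + of_int l * b\<bar> \<le> B" and 2: "\<bar>of_int l * c\<bar> \<le> B"
        by (simp_all add: v L_def)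
      have "\<bar>of_int l :: real\<bar> \<le> B / c"
        using 2 assms by (simp add: abs_mult pos_le_divide_eq)
      then have lN: "\<bar>l\<bar> \<le> N"
        unfolding N_def by (simp add: le_ceiling_iff)
      then have "\<bar>of_int l :: real\<bar> \<le> \<bar>of_int N\<bar>"
        by linarith
      then have "\<bar>of_int l * b\<bar> \<le> \<bar>of_int N\<bar> * \<bar>b\<bar>"
        by (simp add: abs_mult mult_right_mono)
      with 1 have "\<bar>of_int k * a\<bar> \<le> B + \<bar>of_int N\<bar> * \<bar>b\<bar>"
        by linarith
      then have "\<bar>of_int k :: real\<bar> \<le> (B + \<bar>of_int N\<bar> * \<bar>b\<bar>) / a"
        using assms by (simp add: abs_mult pos_le_divide_eq)
      then have "\<bar>k\<bar> \<le> M"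
        unfolding M_def by (simp add: le_ceiling_iff)
      with lN have "(k, l) \<in> {-M..M} \<times> {-N..N}"
        by auto
      then show ?thesis
        unfolding v by (rule rev_image_eqI) simp
    qed
    then have "{v \<in> planar_lattice a b c. norm v \<le> B}
        \<subseteq> (\<lambda>(k, l). L k l) ` ({-M..M} \<times> {-N..N})"
      by blast
    then show ?thesis
      by (rule finite_subset) simp
  qed
  have "oriented_contacts (planar_lattice a b c) n p r \<subseteq>
     (\<Union>i\<in>{1..n}. \<Union>j\<in>{1..n}. (\<lambda>v. (i, j, v)) `
        {v \<in> planar_lattice a b c. norm v \<le> norm (p i - p j) + (r i + r j)})"
  proof -
    have "norm v \<le> norm (p i - p j) + (r i + r j)"
      if "norm (p i - p j - v) = r i + r j" for i j v
      using that norm_triangle_ineq4[of "p i - p j" "p i - p j - v"] by simp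
    then show ?thesis
      by (fastforce simp: oriented_contacts_def)
  qed
  then show "finite (oriented_contacts (planar_lattice a b c) n p r)"
    by (rule finite_subset) (use fin in auto)
  then show "finite (contacts (planar_lattice a b c) n p r)"
    by (simp add: contacts_def)
qed

end

theory Submission
  imports Defs "HOL-Computational_Algebra.Polynomial"
begin

text \<open>
  Suppose a stress \<open>\<omega>\<close> satisfies \<open>\<Sum> \<omega>\<^sub>e (r\<^sub>i + r\<^sub>j)\<^sup>2 = 0\<close>. As the radius ratios and \<open>a\<close>, \<open>b\<close> are
  algebraically independent, there are derivations with arbitrary values at them, defined on a
  subring of the reals that contains all coordinates. Applied to the contact equations
  \<open>\<bar>p\<^sub>i - p\<^sub>j - v\<bar>\<^sup>2 = (r\<^sub>i + r\<^sub>j)\<^sup>2\<close>, they solve the linearized equations for arbitrary variations of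
  the radius ratios and of the lattice. Pairing with \<open>\<omega>\<close> gives \<open>\<Sum>\<^sub>j \<omega>\<^sub>i\<^sub>j (r\<^sub>i + r\<^sub>j) = 0\<close> at each vertex
  and, with \<open>d\<^sub>e\<close> the edge vectors, the vanishing of the second moment \<open>\<Sum> \<omega>\<^sub>e d\<^sub>e d\<^sub>e\<^sup>T\<close>.

  Such a stress is zero. Overlay the stressed graph with its translate by \<open>z\<close> and add up
  \<open>\<omega>\<^sub>e \<omega>\<^sub>f \<bar>d\<^sub>e \<times> d\<^sub>f\<bar>\<close> over the crossings. By equilibrium the sum does not depend on \<open>z\<close>, and its
  average over the torus is twice the determinant of the second moment, hence zero. As \<open>z\<close> tends to zero the
  crossings gather at the vertices, and the contribution of each vertex is a form that is negative
  definite on stresses whose forces and weights at this vertex add up to zero.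

  So \<open>\<omega> \<mapsto> \<Sum> \<omega>\<^sub>e (r\<^sub>i + r\<^sub>j)\<^sup>2\<close> is injective on stresses. Counting unknowns and equations bounds
  the number of contacts by \<open>2n - 1\<close> and the dimension of the stresses by one. With fewer contacts
  some non-trivial infinitesimal motion would keep all contacts but one and open that one, and a
  small multiple of it would be an actual motion of the packing.
\<close>

subsection \<open>Derivations on subrings of the reals\<close>

text \<open>Only one packing is given and nothing is known about packings with nearby parameters; a
  derivation supplies first-order variations at this very packing. It extends to any further real
  number, algebraic or transcendental over the parameters, so the centres need not be functions of
  the parameters. Two variations stay out of control. \<open>r 1\<close> is not a parameter, so a
  derivation may scale all radii by an unknown factor; and \<open>a * c = 1\<close> fixes the area
  of the torus, so only the traceless part of the second moment is reached. The one condition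
  \<open>\<Sum> \<omega>\<^sub>e (r\<^sub>i + r\<^sub>j)\<^sup>2 = 0\<close> closes both gaps: this
  sum is the trace of the second moment, and it is also the pairing of the stress with a scaling of
  the radii. A stress may have edges of both signs at every vertex, so no linear argument forces it
  to vanish. The crossing sum is quadratic in the stress and has a definite local form.\<close>

definition derivation_on :: "real set \<Rightarrow> (real \<Rightarrow> real) \<Rightarrow> bool" where
  "derivation_on K D \<longleftrightarrow> 1 \<in> K \<and>
     (\<forall>x\<in>K. \<forall>y\<in>K. x - y \<in> K \<and> x * y \<in> K \<and> D (x - y) = D x - D y \<and> D (x * y) = D x * y + x * D y)"

context
  fixes K D
  assumes KD: "derivation_on K D"
begin

lemma derivation_on_one: "1 \<in> K"
  and derivation_on_diff: "\<And>x y. x \<in> K \<Longrightarrow> y \<in> K \<Longrightarrow> x - y \<in> K \<and> D (x - y) = D x - D y"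
  and derivation_on_mult: "\<And>x y. x \<in> K \<Longrightarrow> y \<in> K \<Longrightarrow> x * y \<in> K \<and> D (x * y) = D x * y + x * D y"
  using KD by (auto simp: derivation_on_def)

lemma derivation_on_zero: "0 \<in> K \<and> D 0 = 0"
  using derivation_on_diff[OF derivation_on_one derivation_on_one] by simp

lemma derivation_on_uminus: "x \<in> K \<Longrightarrow> - x \<in> K \<and> D (- x) = - D x"
  using derivation_on_diff[of 0 x] derivation_on_zero by simp

lemma derivation_on_add: "x \<in> K \<Longrightarrow> y \<in> K \<Longrightarrow> x + y \<in> K \<and> D (x + y) = D x + D y"
  using derivation_on_diff[of x "- y"] derivation_on_uminus[of y] by simp

lemma derivation_on_D_one: "D 1 = 0"
  using derivation_on_mult[OF derivation_on_one derivation_on_one] by simp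

lemma derivation_on_of_nat: "of_nat k \<in> K \<and> D (of_nat k) = 0"
  by (induction k)
    (use derivation_on_zero derivation_on_add derivation_on_one derivation_on_D_one in \<open>auto simp: derivation_on_def\<close>)

lemma derivation_on_of_int: "of_int k \<in> K \<and> D (of_int k) = 0"
  using derivation_on_of_nat[of "nat k"] derivation_on_of_nat[of "nat (- k)"]
    derivation_on_uminus[of "of_nat (nat (- k))"]
  by (cases "k \<ge> 0") auto

lemma derivation_on_sq: "x \<in> K \<Longrightarrow> x^2 \<in> K \<and> D (x^2) = 2 * (x * D x)"
  using derivation_on_mult[of x x] by (simp add: power2_eq_square)

text \<open>\<open>K\<close> is a set and not a type, so the polynomial ring over \<open>K\<close>
  is singled out inside \<open>real poly\<close> by a condition on the coefficients.\<close>

definition over :: "real poly \<Rightarrow> bool" where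
  "over f \<longleftrightarrow> (\<forall>i. coeff f i \<in> K)"

lemma over_0: "over 0" and over_X: "over [:0, 1:]"
  using derivation_on_zero derivation_on_one
  by (auto simp: over_def coeff_pCons split: nat.splits)

lemma over_const: "a \<in> K \<Longrightarrow> over [:a:]"
  using derivation_on_zero by (auto simp: over_def coeff_pCons split: nat.splits)

lemma over_pCons: "over (pCons a f) \<longleftrightarrow> a \<in> K \<and> over f"
proof
  assume o: "over (pCons a f)"
  have "coeff (pCons a f) 0 \<in> K" "\<And>i. coeff (pCons a f) (Suc i) \<in> K"
    using o unfolding over_def by blast+
  then show "a \<in> K \<and> over f" by (auto simp: over_def)
qed (auto simp: over_def coeff_pCons split: nat.splits)

lemma over_diff: "over f \<Longrightarrow> over g \<Longrightarrow> over (f - g)"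
  using derivation_on_diff by (auto simp: over_def)

lemma over_add: "over f \<Longrightarrow> over g \<Longrightarrow> over (f + g)"
  using derivation_on_add by (auto simp: over_def)

lemma over_smult: "a \<in> K \<Longrightarrow> over f \<Longrightarrow> over (smult a f)"
  using derivation_on_mult by (auto simp: over_def)

lemma over_mult: "over f \<Longrightarrow> over g \<Longrightarrow> over (f * g)"
proof (induction f)
  case (pCons a f)
  then have "over (smult a g + pCons 0 (f * g))"
    by (intro over_add over_smult) (auto simp: over_pCons derivation_on_zero)
  then show ?case by simp
qed (simp add: over_0)

lemma over_monom: "a \<in> K \<Longrightarrow> over (monom a m)"
  using derivation_on_zero by (auto simp: over_def)

lemma over_pderiv: "over f \<Longrightarrow> over (pderiv f)"
  using derivation_on_mult derivation_on_of_nat by (auto simp: over_def coeff_pderiv simp del: of_nat_Suc)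

lemma map_poly_diff: "over f \<Longrightarrow> over g \<Longrightarrow> map_poly D (f - g) = map_poly D f - map_poly D g"
  using derivation_on_zero derivation_on_diff
  by (intro poly_eqI) (auto simp: coeff_map_poly over_def)

lemma map_poly_add: "over f \<Longrightarrow> over g \<Longrightarrow> map_poly D (f + g) = map_poly D f + map_poly D g"
  using derivation_on_zero derivation_on_add
  by (intro poly_eqI) (auto simp: coeff_map_poly over_def)

lemma map_poly_smult: "a \<in> K \<Longrightarrow> over g \<Longrightarrow> map_poly D (smult a g) = smult (D a) g + smult a (map_poly D g)"
  using derivation_on_zero derivation_on_mult
  by (intro poly_eqI) (auto simp: coeff_map_poly over_def)

lemma map_poly_derivation_mult: "over f \<Longrightarrow> over g \<Longrightarrow> map_poly D (f * g) = map_poly D f * g + f * map_poly D g"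
proof (induction f)
  case (pCons a f)
  then have f: "a \<in> K" "over f" by (auto simp: over_pCons)
  have D0: "D 0 = 0" using derivation_on_zero by simp
  have "map_poly D (pCons a f * g) = map_poly D (smult a g + pCons 0 (f * g))" by simp
  also have "\<dots> = map_poly D (smult a g) + pCons 0 (map_poly D (f * g))"
    using f pCons.prems by (subst map_poly_add)
      (auto simp: over_pCons derivation_on_zero over_smult over_mult map_poly_pCons D0)
  finally show ?case
    using f pCons D0 by (simp add: map_poly_smult map_poly_pCons algebra_simps)
qed simp

text \<open>The value of the extended derivation at \<open>f(t)\<close>, when it takes the value \<open>s\<close> at \<open>t\<close>.\<close>

definition poly_derivation :: "real \<Rightarrow> real \<Rightarrow> real poly \<Rightarrow> real" where
  "poly_derivation t s f = poly (map_poly D f) t + s * poly (pderiv f) t"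

lemma poly_derivation_diff:
  "over f \<Longrightarrow> over g \<Longrightarrow> poly_derivation t s (f - g) = poly_derivation t s f - poly_derivation t s g"
  by (simp add: poly_derivation_def map_poly_diff pderiv_diff algebra_simps)

lemma poly_derivation_mult:
  "over f \<Longrightarrow> over g \<Longrightarrow>
   poly_derivation t s (f * g) = poly_derivation t s f * poly g t + poly f t * poly_derivation t s g"
  by (simp add: poly_derivation_def map_poly_derivation_mult pderiv_mult algebra_simps)

text \<open>\<open>K\<close> is only a ring, so division with remainder becomes pseudo-division:
  each round multiplies \<open>g\<close> by the leading coefficient of \<open>f\<close>. A nonzero
  remainder of degree below that of \<open>f\<close> would vanish at \<open>t\<close> and contradict
  minimality.\<close>

lemma pseudo_multiple:
  assumes f: "over f" "f \<noteq> 0" "poly f t = 0"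
    and minimal: "\<And>g. over g \<Longrightarrow> g \<noteq> 0 \<Longrightarrow> poly g t = 0 \<Longrightarrow> degree f \<le> degree g"
  shows "over g \<Longrightarrow> poly g t = 0 \<Longrightarrow>
    \<exists>a q. a \<in> K \<and> a \<noteq> 0 \<and> over q \<and> smult a g = q * f"
proof (induction "degree g" arbitrary: g rule: less_induct)
  case less
  have lcK: "lead_coeff f \<in> K" using f(1) by (simp add: over_def)
  show ?case
  proof (cases "g = 0")
    case True
    then show ?thesis using derivation_on_one over_0 by (intro exI[of _ 1] exI[of _ 0]) auto
  next
    case g0: False
    have deg: "degree f \<le> degree g" using minimal less.prems g0 by blast
    have deg0: "degree f > 0"
    proof (rule ccontr)
      assume "\<not> degree f > 0"
      then obtain a where "f = [:a:]" by (metis degree_eq_zeroE gr0I)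
      then show False using f by simp
    qed
    define m where "m = monom (lead_coeff g) (degree g - degree f)"
    define h where "h = smult (lead_coeff f) g - m * f"
    have lcg: "lead_coeff g \<in> K" using less.prems(1) by (simp add: over_def)
    have oh: "over h" and om: "over m"
      using less.prems(1) f(1) lcK lcg unfolding h_def m_def
      by (auto intro!: over_diff over_smult over_mult over_monom)
    have ph: "poly h t = 0" using less.prems f by (simp add: h_def)
    have dm: "degree (m * f) = degree g"
      using g0 f deg by (subst degree_mult_eq) (auto simp: m_def degree_monom_eq monom_eq_0_iff)
    have "degree h \<le> degree g"
      unfolding h_def using dm by (intro degree_diff_le) auto
    moreover have "coeff h (degree g) = 0"
      using deg by (simp add: h_def m_def coeff_monom_mult)
    ultimately have "degree h < degree g \<or> h = 0"
      using deg0 deg by (metis eq_zero_or_degree_less le_neq_implies_less leading_coeff_0_iff)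
    then have dh: "degree h < degree g" using deg0 deg by auto
    obtain a q where a: "a \<in> K" "a \<noteq> 0" "over q" "smult a h = q * f"
      using less.hyps[OF dh oh ph] by blast
    have "smult (a * lead_coeff f) g = (q + smult a m) * f"
      using a(4) by (simp add: h_def smult_diff_right algebra_simps)
    moreover have "over (q + smult a m)" using a om by (intro over_add over_smult)
    moreover have "a * lead_coeff f \<in> K" using a lcK derivation_on_mult by blast
    ultimately show ?thesis using a f by (metis leading_coeff_0_iff mult_eq_0_iff)
  qed
qed

text \<open>An extension to K[t] is fixed by its value \<open>s\<close> at \<open>t\<close>, and is
  consistent if every polynomial vanishing at \<open>t\<close> gets the value zero. For
  transcendental \<open>t\<close> any \<open>s\<close> will do. For algebraic \<open>t\<close> a
  vanishing polynomial \<open>f\<close> of least degree dictates \<open>s\<close>; in characteristic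
  zero its derivative is nonzero of smaller degree, hence does not vanish at
  \<open>t\<close>.\<close>

lemma poly_derivation_well_defined:
  "\<exists>s. \<forall>g. over g \<longrightarrow> poly g t = 0 \<longrightarrow> poly_derivation t s g = 0"
proof (cases "\<exists>f. over f \<and> f \<noteq> 0 \<and> poly f t = 0")
  case False
  then have "poly_derivation t 0 g = 0" if "over g" "poly g t = 0" for g
    using that by (auto simp: poly_derivation_def)
  then show ?thesis by blast
next
  case True
  define P where "P f \<longleftrightarrow> over f \<and> f \<noteq> 0 \<and> poly f t = 0" for f
  obtain f where f: "P f" and minimal: "\<And>g. P g \<Longrightarrow> degree f \<le> degree g"
    using True ex_has_least_nat[of P _ degree] unfolding P_def by blast
  have "degree f > 0"
  proof (rule ccontr)
    assume "\<not> degree f > 0"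
    then obtain a where "f = [:a:]" by (metis degree_eq_zeroE gr0I)
    then show False using f by (simp add: P_def)
  qed
  then have "pderiv f \<noteq> 0" "degree (pderiv f) < degree f"
    by (auto simp: pderiv_eq_0_iff degree_pderiv)
  then have f': "poly (pderiv f) t \<noteq> 0"
    using minimal[of "pderiv f"] f over_pderiv by (auto simp: P_def)
  define s where "s = - poly (map_poly D f) t / poly (pderiv f) t"
  have sf: "poly_derivation t s f = 0" using f' by (simp add: poly_derivation_def s_def)
  show ?thesis
  proof (intro exI[of _ s] allI impI)
    fix g assume g: "over g" "poly g t = 0"
    obtain a q where a: "a \<in> K" "a \<noteq> 0" "over q" "smult a g = q * f"
      using pseudo_multiple[of f t g] f minimal g unfolding P_def by blast
    \<comment> \<open>In the product rule for \<open>[:a:] * g\<close> the term with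
      \<open>D a\<close> carries the factor \<open>poly g t = 0\<close>.\<close>
    have "poly_derivation t s ([:a:] * g) = poly_derivation t s (q * f)" using a(4) by simp
    then have "a * poly_derivation t s g = 0"
      using g a f sf by (subst (asm) (1 2) poly_derivation_mult) (auto simp: over_const P_def)
    then show "poly_derivation t s g = 0" using a by simp
  qed
qed

text \<open>The ring K[t] is enough, without fractions, because the contact equations are polynomial
  in the coordinates, the radii and the lattice parameters.\<close>

lemma derivation_on_extend:
  "\<exists>K' D'. derivation_on K' D' \<and> insert t K \<subseteq> K' \<and> (\<forall>x\<in>K. D' x = D x)"
proof -
  obtain s where s: "\<And>g. over g \<Longrightarrow> poly g t = 0 \<Longrightarrow> poly_derivation t s g = 0"
    using poly_derivation_well_defined by blast
  define K' where "K' = {poly f t | f. over f}"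
  define D' where "D' y = poly_derivation t s (SOME f. over f \<and> poly f t = y)" for y
  have D': "D' (poly f t) = poly_derivation t s f" if f: "over f" for f
  proof -
    define g where "g = (SOME g. over g \<and> poly g t = poly f t)"
    have g: "over g" "poly g t = poly f t"
      using someI[of "\<lambda>g. over g \<and> poly g t = poly f t" f] f unfolding g_def by auto
    have "poly_derivation t s (g - f) = 0" using g f by (intro s over_diff) auto
    then show ?thesis using g f by (simp add: poly_derivation_diff D'_def flip: g_def)
  qed
  have K: "x \<in> K' \<and> D' x = D x" if "x \<in> K" for x
    using that D'[of "[:x:]"] over_const[of x] derivation_on_zero unfolding K'_def
    by (auto simp: poly_derivation_def map_poly_pCons intro!: exI[of _ "[:x:]"])
  have "derivation_on K' D'"
    unfolding derivation_on_def
  proof (intro conjI ballI)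
    show "1 \<in> K'" using K derivation_on_one by blast
    fix x y assume "x \<in> K'" "y \<in> K'"
    then obtain f g where fg: "over f" "over g" "x = poly f t" "y = poly g t"
      unfolding K'_def by blast
    have 1: "x - y = poly (f - g) t" "x * y = poly (f * g) t" using fg by auto
    show "x - y \<in> K'" "x * y \<in> K'"
      unfolding 1 K'_def using fg over_diff over_mult by blast+
    show "D' (x - y) = D' x - D' y"
      unfolding 1 using fg by (simp add: D' over_diff poly_derivation_diff del: poly_diff)
    show "D' (x * y) = D' x * y + x * D' y"
      unfolding 1 using fg by (simp add: D' over_mult poly_derivation_mult del: poly_mult)
  qed
  moreover have "t \<in> K'" unfolding K'_def using over_X by (auto intro!: exI[of _ "[:0, 1:]"])
  ultimately show ?thesis using K by blast
qed

end

lemma derivation_on_extend_finite: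
  assumes "finite S" "derivation_on K D"
  shows "\<exists>K' D'. derivation_on K' D' \<and> S \<union> K \<subseteq> K' \<and> (\<forall>x\<in>K. D' x = D x)"
  using assms(1)
proof (induction S)
  case empty
  then show ?case using assms(2) by auto
next
  case (insert t S)
  then obtain K1 D1 where 1: "derivation_on K1 D1" "S \<union> K \<subseteq> K1" "\<forall>x\<in>K. D1 x = D x"
    by blast
  obtain K2 D2 where "derivation_on K2 D2" "insert t K1 \<subseteq> K2" "\<forall>x\<in>K1. D2 x = D1 x"
    using derivation_on_extend[OF 1(1)] by blast
  with 1 show ?case by (intro exI[of _ K2] exI[of _ D2]) auto
qed

section \<open>Integer polynomials at a generic point\<close>

definition monom_eval :: "(nat \<Rightarrow> real) \<Rightarrow> (nat \<Rightarrow>\<^sub>0 nat) \<Rightarrow> real" where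
  "monom_eval x m = (\<Prod>k\<in>Poly_Mapping.keys m. x k ^ Poly_Mapping.lookup m k)"

lemma monom_eval_superset:
  assumes "finite S" "Poly_Mapping.keys m \<subseteq> S"
  shows "monom_eval x m = (\<Prod>k\<in>S. x k ^ Poly_Mapping.lookup m k)"
  unfolding monom_eval_def by (rule prod.mono_neutral_left) (use assms in \<open>auto simp: in_keys_iff\<close>)

lemma monom_eval_add: "monom_eval x (m + m') = monom_eval x m * monom_eval x m'"
proof -
  let ?S = "Poly_Mapping.keys m \<union> Poly_Mapping.keys m'"
  have "Poly_Mapping.keys (m + m') \<subseteq> ?S" by (rule Poly_Mapping.keys_add)
  then show ?thesis
    by (simp add: monom_eval_superset[of ?S] lookup_add power_add prod.distrib)
qed

lemma mpoly_eval_superset: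
  assumes "finite S" "Poly_Mapping.keys P \<subseteq> S"
  shows "mpoly_eval x P = (\<Sum>m\<in>S. of_int (Poly_Mapping.lookup P m) * monom_eval x m)"
  unfolding mpoly_eval_def monom_eval_def[symmetric]
  by (rule sum.mono_neutral_left) (use assms in \<open>auto simp: in_keys_iff\<close>)

lemma mpoly_eval_add: "mpoly_eval x (P + Q) = mpoly_eval x P + mpoly_eval x Q"
proof -
  let ?S = "Poly_Mapping.keys P \<union> Poly_Mapping.keys Q"
  have "Poly_Mapping.keys (P + Q) \<subseteq> ?S" by (rule Poly_Mapping.keys_add)
  then show ?thesis
    by (simp add: mpoly_eval_superset[of ?S] lookup_add ring_distribs sum.distrib)
qed

lemma mpoly_eval_single: "mpoly_eval x (Poly_Mapping.single m k) = of_int k * monom_eval x m"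
  by (subst mpoly_eval_superset[of "{m}"]) auto

lemma mpoly_eval_0: "mpoly_eval x 0 = 0"
  by (simp add: mpoly_eval_def)

lemma mpoly_eval_uminus: "mpoly_eval x (- P) = - mpoly_eval x P"
  using mpoly_eval_add[of x P "- P"] by (simp add: mpoly_eval_0)

lemma mpoly_eval_diff: "mpoly_eval x (P - Q) = mpoly_eval x P - mpoly_eval x Q"
  using mpoly_eval_add[of x P "- Q"] by (simp add: mpoly_eval_uminus)

lemma mpoly_eval_sum: "mpoly_eval x (sum f S) = (\<Sum>s\<in>S. mpoly_eval x (f s))"
  by (induction S rule: infinite_finite_induct) (auto simp: mpoly_eval_0 mpoly_eval_add)

lemma poly_mapping_eq_sum_single:
  "P = (\<Sum>m\<in>Poly_Mapping.keys P. Poly_Mapping.single m (Poly_Mapping.lookup P m))"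
  by (intro poly_mapping_eqI) (auto simp: lookup_sum lookup_single when_def in_keys_iff)

lemma mpoly_eval_mult: "mpoly_eval x (P * Q) = mpoly_eval x P * mpoly_eval x Q"
proof -
  have "P * Q = (\<Sum>m\<in>Poly_Mapping.keys P. \<Sum>m'\<in>Poly_Mapping.keys Q.
      Poly_Mapping.single (m + m') (Poly_Mapping.lookup P m * Poly_Mapping.lookup Q m'))"
    by (subst poly_mapping_eq_sum_single[of P], subst poly_mapping_eq_sum_single[of Q])
      (simp add: sum_product mult_single)
  then have "mpoly_eval x (P * Q) = (\<Sum>m\<in>Poly_Mapping.keys P. \<Sum>m'\<in>Poly_Mapping.keys Q.
      (of_int (Poly_Mapping.lookup P m) * monom_eval x m) *
      (of_int (Poly_Mapping.lookup Q m') * monom_eval x m'))"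
    by (simp add: mpoly_eval_sum mpoly_eval_single monom_eval_add mult_ac)
  then show ?thesis
    unfolding mpoly_eval_def monom_eval_def[symmetric] by (simp add: sum_product)
qed

lemma mpoly_vars_diff: "mpoly_vars (P - Q) \<subseteq> mpoly_vars P \<union> mpoly_vars Q"
  unfolding mpoly_vars_def using Poly_Mapping.keys_diff[of P Q] by blast

lemma mpoly_vars_mult: "mpoly_vars (P * Q) \<subseteq> mpoly_vars P \<union> mpoly_vars Q"
proof
  fix k assume "k \<in> mpoly_vars (P * Q)"
  then obtain m where m: "m \<in> Poly_Mapping.keys (P * Q)" "k \<in> Poly_Mapping.keys m"
    by (auto simp: mpoly_vars_def)
  then obtain m1 m2 where "m = m1 + m2" "m1 \<in> Poly_Mapping.keys P" "m2 \<in> Poly_Mapping.keys Q"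
    using Poly_Mapping.keys_mult[of P Q] by blast
  then show "k \<in> mpoly_vars P \<union> mpoly_vars Q"
    using m Poly_Mapping.keys_add[of m1 m2] unfolding mpoly_vars_def by blast
qed

lemma mpoly_eval_differentiable: "(\<lambda>t. mpoly_eval (\<lambda>k. x k + t * v k) P) differentiable at t"
proof -
  have *: "(\<lambda>t. \<Prod>k\<in>S. f t k) differentiable at t"
    if "finite S" "\<And>k. (\<lambda>t. f t k) differentiable at t" for S and f :: "real \<Rightarrow> nat \<Rightarrow> real"
    using that by (induction S) auto
  show ?thesis unfolding mpoly_eval_def
    by (intro differentiable_sum ballI differentiable_mult * finite_keys) auto
qed

text \<open>At a generic point evaluation is injective on integer polynomials, so a number in the
  ring generated by the point determines the polynomial it comes from. The directional derivative of
  that polynomial along \<open>w\<close> is thus a function of the number, and calculus makes it a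
  derivation.\<close>

lemma generic_derivation:
  assumes "generic xs"
  shows "\<exists>K D. derivation_on K D \<and> (\<forall>k<length xs. xs ! k \<in> K \<and> D (xs ! k) = w k)"
proof -
  define x where "x = (\<lambda>k. xs ! k)"
  define V where "V P \<longleftrightarrow> mpoly_vars P \<subseteq> {..<length xs}" for P
  define E where "E P t = mpoly_eval (\<lambda>k. x k + t * w k) P" for P t
  define K where "K = {mpoly_eval x P | P. V P}"
  define D where "D y = deriv (E (SOME P. V P \<and> mpoly_eval x P = y)) 0" for y
  have E0: "E P 0 = mpoly_eval x P" for P by (simp add: E_def)
  have inj: "P = Q" if "V P" "V Q" "mpoly_eval x P = mpoly_eval x Q" for P Q
  proof -
    have "V (P - Q)" using that mpoly_vars_diff unfolding V_def by blast
    moreover have "mpoly_eval x (P - Q) = 0" using that by (simp add: mpoly_eval_diff)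
    ultimately show ?thesis using assms unfolding generic_def V_def x_def by force
  qed
  have D: "D (mpoly_eval x P) = deriv (E P) 0" if "V P" for P
  proof -
    have "(SOME Q. V Q \<and> mpoly_eval x Q = mpoly_eval x P) = P"
      using that inj by (intro some_equality) auto
    then show ?thesis by (simp add: D_def)
  qed
  have dE: "E P field_differentiable at 0" for P
    using mpoly_eval_differentiable[of x w P 0] unfolding E_def[abs_def]
    by (simp add: real_differentiable_def field_differentiable_def)
  have "derivation_on K D"
    unfolding derivation_on_def
  proof (intro conjI ballI)
    have "V 1" by (auto simp: V_def mpoly_vars_def)
    moreover have "mpoly_eval x 1 = 1"
      by (simp add: mpoly_eval_single monom_eval_def flip: single_one)
    ultimately show "1 \<in> K" unfolding K_def by force
    fix y z assume "y \<in> K" "z \<in> K"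
    then obtain P Q where PQ: "V P" "V Q" "y = mpoly_eval x P" "z = mpoly_eval x Q"
      unfolding K_def by blast
    have VPQ: "V (P - Q)" "V (P * Q)"
      using PQ mpoly_vars_diff mpoly_vars_mult unfolding V_def by blast+
    have 1: "y - z = mpoly_eval x (P - Q)" "y * z = mpoly_eval x (P * Q)"
      using PQ by (auto simp: mpoly_eval_diff mpoly_eval_mult)
    show "y - z \<in> K" "y * z \<in> K" unfolding 1 K_def using VPQ by blast+
    have E: "E (P - Q) = (\<lambda>t. E P t - E Q t)" "E (P * Q) = (\<lambda>t. E P t * E Q t)"
      by (auto simp: E_def mpoly_eval_diff mpoly_eval_mult)
    show "D (y - z) = D y - D z"
      unfolding 1 using PQ VPQ dE by (simp add: D E)
    show "D (y * z) = D y * z + y * D z"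
      unfolding 1 using PQ VPQ dE by (simp add: D E deriv_mult E0)
  qed
  moreover have "xs ! k \<in> K \<and> D (xs ! k) = w k" if k: "k < length xs" for k
  proof -
    define P :: int_mpoly where "P = Poly_Mapping.single (Poly_Mapping.single k 1) 1"
    have ev: "mpoly_eval y P = y k" for y
      by (simp add: P_def mpoly_eval_single monom_eval_def)
    have VP: "V P" using k by (auto simp: V_def mpoly_vars_def P_def)
    have "E P = (\<lambda>t. x k + t * w k)" by (auto simp: E_def ev)
    then have "deriv (E P) 0 = w k"
      by (auto intro!: DERIV_imp_deriv derivative_eq_intros)
    then show ?thesis using D[OF VP] VP ev[of x] unfolding K_def x_def
      by (auto intro!: exI[of _ P])
  qed
  ultimately show ?thesis by blast
qed

lemma generic_derivation_finite:
  assumes "generic xs" "finite S"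
  shows "\<exists>K D. derivation_on K D \<and> S \<subseteq> K \<and> (\<forall>k<length xs. xs ! k \<in> K \<and> D (xs ! k) = w k)"
proof -
  obtain K D where KD: "derivation_on K D" "\<And>k. k < length xs \<Longrightarrow> xs ! k \<in> K \<and> D (xs ! k) = w k"
    using generic_derivation[OF assms(1)] by blast
  obtain K' D' where "derivation_on K' D'" "S \<union> K \<subseteq> K'" "\<And>x. x \<in> K \<Longrightarrow> D' x = D x"
    using derivation_on_extend_finite[OF assms(2) KD(1)] by blast
  then show ?thesis using KD by (intro exI[of _ K'] exI[of _ D']) auto
qed

subsection \<open>Linear algebra and negative definite kernels\<close>

text \<open>Gaussian elimination with a pivot unknown \<open>i0\<close>. The index sets are
  arbitrary because the unknowns will be contacts in one application and coordinates of disks in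
  another.\<close>

lemma homogeneous_system:
  fixes a :: "'j \<Rightarrow> 'i \<Rightarrow> real"
  assumes "finite J" "finite I" "card J < card I"
  shows "\<exists>x. (\<exists>i\<in>I. x i \<noteq> 0) \<and> (\<forall>j\<in>J. (\<Sum>i\<in>I. a j i * x i) = 0)"
  using assms
proof (induction J arbitrary: I a)
  case empty
  then obtain i where "i \<in> I" by (metis card.empty equals0I less_irrefl)
  then show ?case by (auto intro!: exI[of _ "\<lambda>_. 1"])
next
  case (insert j J)
  show ?case
  proof (cases "\<forall>i\<in>I. a j i = 0")
    case True
    then show ?thesis using insert.IH[of I a] insert.prems insert.hyps by auto
  next
    case False
    then obtain i0 where i0: "i0 \<in> I" "a j i0 \<noteq> 0" by blast
    define I' where "I' = I - {i0}"
    have I': "finite I'" "card J < card I'" "i0 \<notin> I'" "I = insert i0 I'"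
      using insert.prems insert.hyps i0 by (auto simp: I'_def)
    define a' where "a' j' i = a j' i - a j' i0 * a j i / a j i0" for j' i
    obtain y where y: "\<exists>i\<in>I'. y i \<noteq> 0" "\<And>j'. j' \<in> J \<Longrightarrow> (\<Sum>i\<in>I'. a' j' i * y i) = 0"
      using insert.IH[OF I'(1,2), of a'] by blast
    define S where "S = (\<Sum>i\<in>I'. a j i * y i)"
    define x where "x = y(i0 := - S / a j i0)"
    have sx: "(\<Sum>i\<in>I. a j' i * x i) = a j' i0 * (- S / a j i0) + (\<Sum>i\<in>I'. a j' i * y i)" for j'
    proof -
      have "(\<Sum>i\<in>I'. a j' i * x i) = (\<Sum>i\<in>I'. a j' i * y i)"
        using I'(3) by (intro sum.cong) (auto simp: x_def)
      then show ?thesis using I' by (simp add: x_def)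
    qed
    have "(\<Sum>i\<in>I. a j' i * x i) = 0" if "j' \<in> J" for j'
    proof -
      have "(\<Sum>i\<in>I'. a' j' i * y i) = (\<Sum>i\<in>I'. a j' i * y i) - a j' i0 / a j i0 * S"
        by (simp add: a'_def S_def sum_subtractf sum_distrib_left algebra_simps)
      then show ?thesis using y(2)[OF that] i0 by (simp add: sx)
    qed
    moreover have "(\<Sum>i\<in>I. a j i * x i) = 0" using i0 by (simp add: sx flip: S_def)
    moreover have "\<exists>i\<in>I. x i \<noteq> 0" using y(1) I' by (auto simp: x_def)
    ultimately show ?thesis by blast
  qed
qed

lemma finite_pos_lower_bound:
  fixes S :: "real set"
  assumes "finite S" "\<And>s. s \<in> S \<Longrightarrow> 0 < s"
  shows "\<exists>\<eta>>0. \<forall>s\<in>S. \<eta> < s"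
proof -
  \<comment> \<open>The element 1 covers the empty set; halving the minimum makes the bound
    strict.\<close>
  have "Min (insert 1 S) > 0" using assms by (subst Min_gr_iff) auto
  moreover have "Min (insert 1 S) \<le> s" if "s \<in> S" for s using that assms by (intro Min_le) auto
  ultimately show ?thesis by (intro exI[of _ "Min (insert 1 S) / 2"]) force
qed

text \<open>With \<open>F(x) = \<Sum> m e\<close> over \<open>c e \<le> x\<close>, the double sum is \<open>-2 \<integral> F\<^sup>2\<close>.\<close>

lemma abs_diff_kernel_negative_definite:
  fixes m c :: "'e \<Rightarrow> real"
  assumes fin: "finite E" and m0: "(\<Sum>e\<in>E. m e) = 0"
  defines "S \<equiv> (\<Sum>e\<in>E. \<Sum>f\<in>E. m e * m f * \<bar>c e - c f\<bar>)"
  shows "S \<le> 0" and "S = 0 \<Longrightarrow> (\<Sum>e\<in>{e\<in>E. c e = y}. m e) = 0"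
proof -
  define F where "F x = (\<Sum>e\<in>E. if c e \<le> x then m e else 0)" for x
  define L where "L = (\<Sum>e\<in>E. \<bar>c e\<bar>)"
  have L: "\<bar>c e\<bar> \<le> L" if "e \<in> E" for e
    unfolding L_def using fin that by (intro member_le_sum) auto
  define A B where "A = - L - 1" and "B = L + 1"
  have AB: "A < c e" "c e < B" if "e \<in> E" for e
    using L[OF that] by (auto simp: A_def B_def)
  have F_far: "F x = 0" if "x \<le> A \<or> B \<le> x" for x
  proof -
    have "(\<forall>e\<in>E. \<not> c e \<le> x) \<or> (\<forall>e\<in>E. c e \<le> x)" using that AB by force
    then show ?thesis
    proof
      assume "\<forall>e\<in>E. c e \<le> x"
      then have "F x = (\<Sum>e\<in>E. m e)" unfolding F_def by (intro sum.cong) auto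
      then show ?thesis using m0 by simp
    qed (simp add: F_def)
  qed
  have step: "((\<lambda>x. if k \<le> x then 1 else 0 :: real) has_integral (B - k)) {A..B}"
    if "A \<le> k" "k \<le> B" for k
  proof -
    have "((\<lambda>x. if x \<in> {k..B} then 1 else 0 :: real) has_integral (B - k)) {A..B}"
      using has_integral_const_real[of "1::real" k B] that by (subst has_integral_restrict) auto
    then show ?thesis by (rule has_integral_eq[rotated]) auto
  qed
  have sq: "(F x)\<^sup>2 = (\<Sum>e\<in>E. \<Sum>f\<in>E. m e * m f * (if max (c e) (c f) \<le> x then 1 else 0))" for x
    unfolding F_def power2_eq_square sum_product by (intro sum.cong) auto
  define T where "T = (\<Sum>e\<in>E. \<Sum>f\<in>E. m e * m f * (B - max (c e) (c f)))"
  have int: "((\<lambda>x. (F x)\<^sup>2) has_integral T) {A..B}"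
    unfolding sq T_def
    by (intro has_integral_sum fin has_integral_mult_right step) (use AB in \<open>fastforce simp: max_def\<close>)+
  have zero: "(\<Sum>e\<in>E. \<Sum>f\<in>E. m e * m f * g e) = 0" "(\<Sum>e\<in>E. \<Sum>f\<in>E. m e * m f * g f) = 0" for g
  proof -
    have "(\<Sum>e\<in>E. \<Sum>f\<in>E. m e * m f * g e) = (\<Sum>e\<in>E. m e * g e) * (\<Sum>f\<in>E. m f)"
      "(\<Sum>e\<in>E. \<Sum>f\<in>E. m e * m f * g f) = (\<Sum>e\<in>E. m e) * (\<Sum>f\<in>E. m f * g f)"
      unfolding sum_product by (intro sum.cong; simp)+
    then show "(\<Sum>e\<in>E. \<Sum>f\<in>E. m e * m f * g e) = 0" "(\<Sum>e\<in>E. \<Sum>f\<in>E. m e * m f * g f) = 0"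
      using m0 by simp_all
  qed
  \<comment> \<open>The maximum is half the sum plus half the distance. Terms depending on
    \<open>e\<close> or \<open>f\<close> alone, apart from the weights, cancel because the weights
    add up to zero.\<close>
  have "m e * m f * (B - max (c e) (c f)) =
      m e * m f * (B - c e / 2) + m e * m f * (- c f / 2) - m e * m f * \<bar>c e - c f\<bar> / 2" for e f
    by (simp add: max_def abs_if field_simps)
  then have "T = - S / 2"
    unfolding T_def S_def
    by (simp add: sum.distrib sum_subtractf zero flip: sum_divide_distrib)
  then have ST: "S = - 2 * T" by simp
  have "T \<ge> 0" using int by (rule has_integral_nonneg) simp
  then show "S \<le> 0" using ST by simp
  assume "S = 0"
  then have T: "T = 0" using ST by simp
  \<comment> \<open>A value of the step function \<open>F\<close> persists on an interval to the
    right, so a nonzero one would make the integral \<open>T\<close> of the square positive.\<close>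
  have F0: "F x = 0" for x
  proof (cases "x \<le> A \<or> B \<le> x")
    case False
    have "\<exists>\<eta>>0. \<forall>s\<in>insert (B - x) ((\<lambda>e. c e - x) ` {e\<in>E. c e > x}). \<eta> < s"
      using fin False by (intro finite_pos_lower_bound) auto
    then obtain \<eta> where \<eta>: "\<eta> > 0" "\<eta> < B - x" "\<And>e. e \<in> E \<Longrightarrow> c e > x \<Longrightarrow> \<eta> < c e - x"
      by auto
    have const: "F x = F y" if "y \<in> {x..x + \<eta>}" for y
      unfolding F_def using that \<eta>(3) by (intro sum.cong) force+
    have "((\<lambda>_. (F x)\<^sup>2) has_integral (\<eta> * (F x)\<^sup>2)) {x..x + \<eta>}"
      using has_integral_const_real[of "(F x)\<^sup>2" x "x + \<eta>"] \<eta>(1) by simp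
    then have "((\<lambda>x. (F x)\<^sup>2) has_integral (\<eta> * (F x)\<^sup>2)) {x..x + \<eta>}"
      by (rule has_integral_eq[rotated]) (use const in metis)
    then have "\<eta> * (F x)\<^sup>2 \<le> T"
      using int False \<eta> by (intro has_integral_subset_le[of "{x..x + \<eta>}" "{A..B}"]) auto
    then show ?thesis using T \<eta>(1) by (simp add: mult_le_0_iff)
  qed (rule F_far)
  have "\<exists>\<eta>>0. \<forall>s\<in>(\<lambda>e. y - c e) ` {e\<in>E. c e < y}. \<eta> < s"
    using fin by (intro finite_pos_lower_bound) auto
  then obtain \<eta> where \<eta>: "\<eta> > 0" "\<And>e. e \<in> E \<Longrightarrow> c e < y \<Longrightarrow> \<eta> < y - c e" by auto
  have "F y - F (y - \<eta>) = (\<Sum>e\<in>E. if c e = y then m e else 0)"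
    unfolding F_def sum_subtractf[symmetric] using \<eta> by (intro sum.cong) force+
  then show "(\<Sum>e\<in>{e\<in>E. c e = y}. m e) = 0"
    using fin F0 by (simp add: sum.inter_filter)
qed

text \<open>With \<open>\<sigma> = sgn x\<close>, the indicator of \<open>a = b = \<sigma>\<close>
  is \<open>(1 + a * \<sigma>) * (1 + b * \<sigma>) / 4\<close>; expand and use
  \<open>\<sigma> * \<bar>x\<bar> = x\<close>.\<close>

lemma same_sign_indicator:
  fixes a b x k :: real
  assumes "a = 1 \<or> a = -1" "b = 1 \<or> b = -1"
  shows "4 * (if x \<noteq> 0 \<and> a = sgn x \<and> b = sgn x then k * \<bar>x\<bar> else 0)
    = k * \<bar>x\<bar> + a * b * k * \<bar>x\<bar> + k * x * a + k * x * b"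
  using assms by (elim disjE) (auto simp: sgn_if abs_if)

lemma continuous_antiderivative:
  fixes f :: "real \<Rightarrow> real"
  assumes "\<And>x. isCont f x"
  shows "\<exists>F. \<forall>x. (F has_real_derivative f x) (at x)"
proof -
  have "\<exists>F. \<forall>x::real. - \<infinity> < ereal x \<longrightarrow> ereal x < \<infinity> \<longrightarrow> (F has_vector_derivative f x) (at x)"
    using assms by (intro einterval_antiderivative) auto
  then show ?thesis by (auto simp: has_real_derivative_iff_has_vector_derivative)
qed

locale planar_vectors =
  fixes E :: "'e set" and hx hy :: "'e \<Rightarrow> real"
  assumes fin: "finite E"
begin

definition cr :: "'e \<Rightarrow> 'e \<Rightarrow> real" where
  "cr e f = hx e * hy f - hy e * hx f"

text \<open>After division by the components \<open>zc\<close> transversal to \<open>z\<close>, the cross product of two vectors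
  is the difference of their slopes, so that the one-dimensional kernel applies.\<close>

lemma abs_cross_kernel_negative_definite:
  fixes z1 z2 :: real
  defines "zc \<equiv> \<lambda>e. z1 * hy e - z2 * hx e"
  assumes E': "E' \<subseteq> E" and nz: "\<And>e. e \<in> E' \<Longrightarrow> zc e \<noteq> 0"
    and w0: "(\<Sum>e\<in>E'. w e * \<bar>zc e\<bar>) = 0"
  defines "S \<equiv> (\<Sum>e\<in>E'. \<Sum>f\<in>E'. w e * w f * \<bar>cr e f\<bar>)"
  shows "S \<le> 0" and "S = 0 \<Longrightarrow> e0 \<in> E' \<Longrightarrow> (\<Sum>e\<in>{e\<in>E'. cr e0 e = 0}. w e * \<bar>zc e\<bar>) = 0"
proof -
  have finE': "finite E'" using E' fin finite_subset by blast
  define N where "N = z1\<^sup>2 + z2\<^sup>2"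
  \<comment> \<open>The cotangent of the angle from z to the vector of \<open>e\<close>.\<close>
  define k where "k e = (z1 * hx e + z2 * hy e) / zc e" for e
  have id: "N * cr e f = zc e * zc f * (k e - k f)" if "e \<in> E'" "f \<in> E'" for e f
  proof -
    have "zc e * zc f * (k e - k f) = zc f * (z1 * hx e + z2 * hy e) - zc e * (z1 * hx f + z2 * hy f)"
      using nz[OF that(1)] nz[OF that(2)] by (simp add: k_def field_simps)
    also have "\<dots> = N * cr e f"
      by (simp add: N_def cr_def zc_def algebra_simps power2_eq_square)
    finally show ?thesis by simp
  qed
  have "N * S = (\<Sum>e\<in>E'. \<Sum>f\<in>E'. (w e * \<bar>zc e\<bar>) * (w f * \<bar>zc f\<bar>) * \<bar>k e - k f\<bar>)"
    unfolding S_def sum_distrib_left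
  proof (intro sum.cong refl)
    fix e f assume "e \<in> E'" "f \<in> E'"
    from id[OF this] have "\<bar>N * cr e f\<bar> = \<bar>zc e\<bar> * \<bar>zc f\<bar> * \<bar>k e - k f\<bar>" by (simp add: abs_mult)
    moreover have "N \<ge> 0" by (simp add: N_def)
    ultimately show "N * (w e * w f * \<bar>cr e f\<bar>) = w e * \<bar>zc e\<bar> * (w f * \<bar>zc f\<bar>) * \<bar>k e - k f\<bar>"
      by (simp add: abs_mult algebra_simps)
  qed
  note NS = this abs_diff_kernel_negative_definite[OF finE' w0, of k]
  have N: "N > 0" if "e \<in> E'" for e
  proof -
    have "z1 \<noteq> 0 \<or> z2 \<noteq> 0" using nz[OF that] by (auto simp: zc_def)
    then show ?thesis unfolding N_def by (rule sum_power2_gt_zero_iff[THEN iffD2])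
  qed
  show "S \<le> 0"
  proof (cases "E' = {}")
    case True
    then show ?thesis by (simp add: S_def)
  next
    case False
    then have "N > 0" using N by auto
    moreover have "N * S \<le> 0" using NS(1,2) by simp
    ultimately show ?thesis by (simp add: mult_le_0_iff)
  qed
  assume "S = 0" and e0: "e0 \<in> E'"
  then have "(\<Sum>e\<in>{e\<in>E'. k e = k e0}. w e * \<bar>zc e\<bar>) = 0" using NS by simp
  moreover have "{e\<in>E'. k e = k e0} = {e\<in>E'. cr e0 e = 0}"
  proof -
    have "cr e0 e = 0 \<longleftrightarrow> k e = k e0" if "e \<in> E'" for e
      using id[OF e0 that] nz[OF e0] nz[OF that] N[OF e0] by (auto simp: mult_eq_0_iff)
    then show ?thesis by blast
  qed
  ultimately show "(\<Sum>e\<in>{e\<in>E'. cr e0 e = 0}. w e * \<bar>zc e\<bar>) = 0" by simp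
qed

text \<open>All vectors have the same length, so the average of the cross product's absolute value
  over all directions z is the same for each of them, and the average of the weighted sum is a
  multiple of \<open>\<Sum> c = 0\<close>. Up to a factor the sum is the derivative of a function
  \<open>W\<close> of the angle with \<open>W 0 = W pi\<close>, so Rolle's theorem gives a
  zero.\<close>

lemma exists_balanced_direction:
  assumes norm: "\<And>e. e \<in> E \<Longrightarrow> (hx e)\<^sup>2 + (hy e)\<^sup>2 = \<rho>\<^sup>2" and c0: "(\<Sum>e\<in>E. c e) = 0"
  shows "\<exists>z1 z2. z1\<^sup>2 + z2\<^sup>2 = 1 \<and> (\<Sum>e\<in>E. c e * \<bar>z1 * hy e - z2 * hx e\<bar>) = (0::real)"
proof -
  obtain \<Phi> :: "real \<Rightarrow> real" where \<Phi>: "\<And>x. (\<Phi> has_real_derivative \<bar>sin x\<bar>) (at x)"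
    using continuous_antiderivative[of "\<lambda>x. \<bar>sin x\<bar>"] by (auto intro!: continuous_intros)
  define M where "M = \<Phi> pi - \<Phi> 0"
  have M: "\<Phi> x - \<Phi> (x - pi) = M" for x
  proof -
    have "((\<lambda>x. \<Phi> x - \<Phi> (x - pi)) has_real_derivative 0) (at x)" for x
      by (auto intro!: derivative_eq_intros DERIV_chain'[OF _ \<Phi>] \<Phi>)
    then have "\<Phi> x - \<Phi> (x - pi) = \<Phi> pi - \<Phi> (pi - pi)"
      using DERIV_isconst_all[of "\<lambda>x. \<Phi> x - \<Phi> (x - pi)"] by blast
    then show ?thesis by (simp add: M_def)
  qed
  have "\<exists>\<alpha>. hx e = \<bar>\<rho>\<bar> * cos \<alpha> \<and> hy e = \<bar>\<rho>\<bar> * sin \<alpha>" if e: "e \<in> E" for e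
  proof -
    obtain r a where ra: "hx e = r * cos a" "hy e = r * sin a" using polar_Ex by blast
    have "r\<^sup>2 * ((cos a)\<^sup>2 + (sin a)\<^sup>2) = \<rho>\<^sup>2"
      using norm[OF e] unfolding ra by (simp only: power_mult_distrib distrib_left)
    then have "\<bar>r\<bar> = \<bar>\<rho>\<bar>" by (auto simp: power2_eq_iff)
    then show ?thesis
      using ra by (intro exI[of _ "if r \<ge> 0 then a else a + pi"]) (auto simp flip: \<open>\<bar>r\<bar> = \<bar>\<rho>\<bar>\<close>)
  qed
  then obtain \<alpha> where \<alpha>: "\<And>e. e \<in> E \<Longrightarrow> hx e = \<bar>\<rho>\<bar> * cos (\<alpha> e) \<and> hy e = \<bar>\<rho>\<bar> * sin (\<alpha> e)"
    by metis
  define W where "W \<theta> = (\<Sum>e\<in>E. c e * \<Phi> (\<alpha> e - \<theta>))" for \<theta>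
  have dW: "(W has_real_derivative (\<Sum>e\<in>E. - (c e * \<bar>sin (\<alpha> e - \<theta>)\<bar>))) (at \<theta>)" for \<theta>
    unfolding W_def
    by (auto intro!: derivative_eq_intros DERIV_chain'[OF _ \<Phi>] sum.cong)
  have "W 0 - W pi = (\<Sum>e\<in>E. c e * M)"
    unfolding W_def sum_subtractf[symmetric] by (intro sum.cong) (simp_all add: M flip: right_diff_distrib)
  also have "\<dots> = 0" using c0 by (simp flip: sum_distrib_right)
  finally have "W 0 = W pi" by simp
  then obtain \<theta> where "DERIV W \<theta> :> 0"
    using Rolle[of 0 pi W] dW by (meson DERIV_isCont continuous_at_imp_continuous_on pi_gt_zero real_differentiable_def)
  then have "(\<Sum>e\<in>E. - (c e * \<bar>sin (\<alpha> e - \<theta>)\<bar>)) = 0" using DERIV_unique dW by blast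
  then have s0: "(\<Sum>e\<in>E. c e * \<bar>sin (\<alpha> e - \<theta>)\<bar>) = 0" by (simp add: sum_negf)
  have "(\<Sum>e\<in>E. c e * \<bar>cos \<theta> * hy e - sin \<theta> * hx e\<bar>) = (\<Sum>e\<in>E. \<bar>\<rho>\<bar> * (c e * \<bar>sin (\<alpha> e - \<theta>)\<bar>))"
  proof (intro sum.cong refl)
    fix e assume "e \<in> E"
    then have "cos \<theta> * hy e - sin \<theta> * hx e = \<bar>\<rho>\<bar> * sin (\<alpha> e - \<theta>)"
      using \<alpha> by (simp add: sin_diff algebra_simps)
    then show "c e * \<bar>cos \<theta> * hy e - sin \<theta> * hx e\<bar> = \<bar>\<rho>\<bar> * (c e * \<bar>sin (\<alpha> e - \<theta>)\<bar>)"
      by (simp add: abs_mult)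
  qed
  also have "\<dots> = 0" using s0 by (simp flip: sum_distrib_left)
  finally show ?thesis by (intro exI[of _ "cos \<theta>"] exI[of _ "sin \<theta>"]) simp
qed

text \<open>By equilibrium \<open>4 q = P + R\<close>, where \<open>P\<close> and \<open>R\<close> are the sums of \<open>c e * c f * \<bar>cr e f\<bar>\<close>
  without and with the signs of \<open>zc e\<close>, \<open>zc f\<close>. Both are instances of the kernel above: \<open>R\<close> for the
  direction \<open>z\<close>, because the forces balance, and \<open>P\<close> for a direction in which the weights balance.\<close>

lemma vertex_crossing_sum_nonpos:
  fixes z1 z2 :: real
  defines "zc \<equiv> \<lambda>e. z1 * hy e - z2 * hx e"
  assumes norm: "\<And>e. e \<in> E \<Longrightarrow> (hx e)\<^sup>2 + (hy e)\<^sup>2 = \<rho>\<^sup>2"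
    and distinct: "\<And>e f. e \<in> E \<Longrightarrow> f \<in> E \<Longrightarrow> hx e = hx f \<Longrightarrow> hy e = hy f \<Longrightarrow> e = f"
    and nz: "\<And>e. e \<in> E \<Longrightarrow> zc e \<noteq> 0"
    and c0: "(\<Sum>e\<in>E. c e) = 0"
    and eqx: "(\<Sum>e\<in>E. c e * hx e) = 0" and eqy: "(\<Sum>e\<in>E. c e * hy e) = 0"
  defines "q \<equiv> (\<Sum>e\<in>E. \<Sum>f\<in>E. if cr e f \<noteq> 0 \<and> sgn (zc e) = sgn (cr e f) \<and> sgn (zc f) = sgn (cr e f)
      then c e * c f * \<bar>cr e f\<bar> else 0)"
  shows "q \<le> 0" and "q = 0 \<Longrightarrow> e \<in> E \<Longrightarrow> c e = 0"
proof -
  define P where "P = (\<Sum>e\<in>E. \<Sum>f\<in>E. c e * c f * \<bar>cr e f\<bar>)"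
  define R where "R = (\<Sum>e\<in>E. \<Sum>f\<in>E. (c e * sgn (zc e)) * (c f * sgn (zc f)) * \<bar>cr e f\<bar>)"
  \<comment> \<open>These identities remove the terms of the expansion in which a single sign
    occurs.\<close>
  have crl: "(\<Sum>e\<in>E. c e * cr e f) = 0" "(\<Sum>e\<in>E. c e * cr f e) = 0" for f
  proof -
    have "(\<Sum>e\<in>E. c e * cr e f) = (\<Sum>e\<in>E. c e * hx e) * hy f - (\<Sum>e\<in>E. c e * hy e) * hx f"
      "(\<Sum>e\<in>E. c e * cr f e) = hx f * (\<Sum>e\<in>E. c e * hy e) - hy f * (\<Sum>e\<in>E. c e * hx e)"
      by (simp_all add: cr_def sum_subtractf sum_distrib_left sum_distrib_right algebra_simps)
    then show "(\<Sum>e\<in>E. c e * cr e f) = 0" "(\<Sum>e\<in>E. c e * cr f e) = 0" using eqx eqy by simp_all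
  qed
  have q4: "4 * q = P + R"
  proof -
    have z1: "(\<Sum>e\<in>E. \<Sum>f\<in>E. c e * c f * cr e f * sgn (zc e)) = 0"
    proof (rule sum.neutral, rule ballI)
      fix e
      have "(\<Sum>f\<in>E. c e * c f * cr e f * sgn (zc e)) = c e * sgn (zc e) * (\<Sum>f\<in>E. c f * cr e f)"
        unfolding sum_distrib_left by (intro sum.cong) auto
      then show "(\<Sum>f\<in>E. c e * c f * cr e f * sgn (zc e)) = 0" using crl by simp
    qed
    have "(\<Sum>f\<in>E. \<Sum>e\<in>E. c e * c f * cr e f * sgn (zc f)) = 0"
    proof (rule sum.neutral, rule ballI)
      fix f
      have "(\<Sum>e\<in>E. c e * c f * cr e f * sgn (zc f)) = c f * sgn (zc f) * (\<Sum>e\<in>E. c e * cr e f)"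
        unfolding sum_distrib_left by (intro sum.cong) auto
      then show "(\<Sum>e\<in>E. c e * c f * cr e f * sgn (zc f)) = 0" using crl by simp
    qed
    then have z2: "(\<Sum>e\<in>E. \<Sum>f\<in>E. c e * c f * cr e f * sgn (zc f)) = 0"
      by (subst sum.swap)
    have pt: "4 * (if cr e f \<noteq> 0 \<and> sgn (zc e) = sgn (cr e f) \<and> sgn (zc f) = sgn (cr e f)
        then c e * c f * \<bar>cr e f\<bar> else 0)
      = c e * c f * \<bar>cr e f\<bar> + (c e * sgn (zc e)) * (c f * sgn (zc f)) * \<bar>cr e f\<bar>
        + c e * c f * cr e f * sgn (zc e) + c e * c f * cr e f * sgn (zc f)"
      if "e \<in> E" "f \<in> E" for e f
    proof -
      have "sgn (zc e) = 1 \<or> sgn (zc e) = -1" "sgn (zc f) = 1 \<or> sgn (zc f) = -1"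
        using nz[OF that(1)] nz[OF that(2)] by (auto simp: sgn_if)
      from same_sign_indicator[OF this, of "cr e f" "c e * c f"] show ?thesis
        by (simp only: mult_ac)
    qed
    have "4 * q = (\<Sum>e\<in>E. \<Sum>f\<in>E. c e * c f * \<bar>cr e f\<bar> + (c e * sgn (zc e)) * (c f * sgn (zc f)) * \<bar>cr e f\<bar>
        + c e * c f * cr e f * sgn (zc e) + c e * c f * cr e f * sgn (zc f))"
      unfolding q_def sum_distrib_left using pt by (intro sum.cong) auto
    also have "\<dots> = P + R" by (simp add: sum.distrib z1 z2 P_def R_def)
    finally show ?thesis .
  qed
  have sgnabs: "sgn (zc e) * \<bar>zc e\<bar> = zc e" for e by (simp add: sgn_mult_abs)
  have "(\<Sum>e\<in>E. c e * zc e) = z1 * (\<Sum>e\<in>E. c e * hy e) - z2 * (\<Sum>e\<in>E. c e * hx e)"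
    by (simp add: zc_def sum_subtractf sum_distrib_left algebra_simps)
  then have "(\<Sum>e\<in>E. c e * sgn (zc e) * \<bar>zc e\<bar>) = 0"
    using eqx eqy by (simp add: sgnabs mult.assoc)
  moreover have zc: "z1 * hy e - z2 * hx e = zc e" for e by (simp add: zc_def)
  ultimately have R: "R \<le> 0"
    "\<And>e. R = 0 \<Longrightarrow> e \<in> E \<Longrightarrow> (\<Sum>f\<in>{f\<in>E. cr e f = 0}. c f * sgn (zc f) * \<bar>zc f\<bar>) = 0"
    using abs_cross_kernel_negative_definite[of E z1 z2 "\<lambda>e. c e * sgn (zc e)"] nz
    unfolding zc R_def by auto
  obtain y1 y2 where y: "y1\<^sup>2 + y2\<^sup>2 = 1" "(\<Sum>e\<in>E. c e * \<bar>y1 * hy e - y2 * hx e\<bar>) = 0"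
    using exists_balanced_direction[of \<rho> c] norm c0 by blast
  define yc where "yc e = y1 * hy e - y2 * hx e" for e
  \<comment> \<open>Vectors parallel to the balanced direction have no finite slope and must be left
    out of the kernel. They contribute nothing to \<open>P\<close>: for such a vector
    \<open>crE0\<close> factors the cross products, and the sum over its partners is a multiple of
    the balance condition.\<close>
  define E1 where "E1 = {e\<in>E. yc e \<noteq> 0}"
  have crE0: "cr e f = (y1 * hx e + y2 * hy e) * yc f" if "yc e = 0" for e f
  proof -
    have "cr e f = (y1\<^sup>2 + y2\<^sup>2) * cr e f" using y by simp
    also have "\<dots> = (y1 * hx e + y2 * hy e) * yc f - (y1 * hx f + y2 * hy f) * yc e"
      by (simp add: cr_def yc_def algebra_simps power2_eq_square)
    finally show ?thesis using that by simp
  qed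
  have cr_sym: "\<bar>cr e f\<bar> = \<bar>cr f e\<bar>" for e f by (simp add: cr_def abs_minus_commute mult.commute)
  have E0: "(\<Sum>f\<in>E. c e * c f * \<bar>cr e f\<bar>) = 0" if "yc e = 0" for e
  proof -
    have "(\<Sum>f\<in>E. c e * c f * \<bar>cr e f\<bar>) = c e * \<bar>y1 * hx e + y2 * hy e\<bar> * (\<Sum>f\<in>E. c f * \<bar>yc f\<bar>)"
      unfolding sum_distrib_left using crE0[OF that] by (intro sum.cong) (auto simp: abs_mult)
    then show ?thesis using y by (simp add: yc_def)
  qed
  have "P = (\<Sum>e\<in>E1. \<Sum>f\<in>E. c e * c f * \<bar>cr e f\<bar>)"
    unfolding P_def by (rule sum.mono_neutral_right) (use fin E0 in \<open>auto simp: E1_def\<close>)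
  also have "\<dots> = (\<Sum>f\<in>E. \<Sum>e\<in>E1. c e * c f * \<bar>cr e f\<bar>)" by (rule sum.swap)
  also have "\<dots> = (\<Sum>f\<in>E1. \<Sum>e\<in>E1. c e * c f * \<bar>cr e f\<bar>)"
  proof (rule sum.mono_neutral_right)
    show "\<forall>f\<in>E - E1. (\<Sum>e\<in>E1. c e * c f * \<bar>cr e f\<bar>) = 0"
    proof
      fix f assume "f \<in> E - E1"
      then have f: "yc f = 0" by (simp add: E1_def)
      have "(\<Sum>e\<in>E1. c e * c f * \<bar>cr e f\<bar>) = (\<Sum>e\<in>E. c e * c f * \<bar>cr e f\<bar>)"
        by (rule sum.mono_neutral_left) (use fin crE0 f in \<open>auto simp: E1_def\<close>)
      also have "\<dots> = (\<Sum>e\<in>E. c f * c e * \<bar>cr f e\<bar>)"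
        by (intro sum.cong) (auto simp: cr_sym)
      finally show "(\<Sum>e\<in>E1. c e * c f * \<bar>cr e f\<bar>) = 0" using E0[OF f] by simp
    qed
  qed (use fin in \<open>auto simp: E1_def\<close>)
  also have "\<dots> = (\<Sum>e\<in>E1. \<Sum>f\<in>E1. c e * c f * \<bar>cr e f\<bar>)"
    by (rule sum.swap)
  finally have P_E1: "P = (\<Sum>e\<in>E1. \<Sum>f\<in>E1. c e * c f * \<bar>cr e f\<bar>)" .
  have "(\<Sum>e\<in>E1. c e * \<bar>yc e\<bar>) = (\<Sum>e\<in>E. c e * \<bar>yc e\<bar>)"
    by (rule sum.mono_neutral_left) (use fin in \<open>auto simp: E1_def\<close>)
  then have yE1: "(\<Sum>e\<in>E1. c e * \<bar>yc e\<bar>) = 0" using y by (simp add: yc_def)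
  have E1: "E1 \<subseteq> E" "\<And>e. e \<in> E1 \<Longrightarrow> yc e \<noteq> 0" by (auto simp: E1_def)
  have yc: "y1 * hy e - y2 * hx e = yc e" for e by (simp add: yc_def)
  note P = abs_cross_kernel_negative_definite[of E1 y1 y2 c, unfolded yc, OF E1 yE1, folded P_E1]
  show "q \<le> 0" using q4 P(1) R(1) by simp
  assume q: "q = 0" and e: "e \<in> E"
  have PR: "P = 0" "R = 0" using q q4 P(1) R(1) by auto
  \<comment> \<open>In vector notation \<open>\<bar>f - e\<bar>\<^sup>2 \<bar>f + e\<bar>\<^sup>2 =
    (\<bar>e\<bar>\<^sup>2 - \<bar>f\<bar>\<^sup>2)\<^sup>2 + 4 (e \<times> f)\<^sup>2\<close>, and
    the lengths agree.\<close>
  have par: "(hx f = hx e \<and> hy f = hy e) \<or> (hx f = - hx e \<and> hy f = - hy e)"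
    if "e \<in> E" "f \<in> E" "cr e f = 0" for e f
  proof -
    have "((hx f - hx e)\<^sup>2 + (hy f - hy e)\<^sup>2) * ((hx f + hx e)\<^sup>2 + (hy f + hy e)\<^sup>2)
       = (((hx e)\<^sup>2 + (hy e)\<^sup>2) - ((hx f)\<^sup>2 + (hy f)\<^sup>2))\<^sup>2 + 4 * (cr e f)\<^sup>2"
      by (simp add: cr_def algebra_simps power2_eq_square)
    also have "\<dots> = 0" using norm that by simp
    finally consider "(hx f - hx e)\<^sup>2 + (hy f - hy e)\<^sup>2 = 0" | "(hx f + hx e)\<^sup>2 + (hy f + hy e)\<^sup>2 = 0"
      by (auto simp only: mult_eq_0_iff)
    then show ?thesis by cases (simp_all only: sum_power2_eq_zero_iff, linarith+)
  qed
  \<comment> \<open>A line carries at most \<open>e\<close> and one opposite vector.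
    \<open>R = 0\<close> makes their weights equal, and then a vanishing sum makes them
    zero.\<close>
  have key: "c e = 0" if e: "e \<in> E" and K: "(\<Sum>f\<in>{f\<in>E. cr e f = 0}. c f) = 0" for e
  proof -
    let ?K = "{f\<in>E. cr e f = 0}"
    have "(\<Sum>f\<in>?K. c f * zc f) = 0"
      using R(2)[OF PR(2) e] by (simp add: mult.assoc sgnabs)
    then have "0 = (\<Sum>f\<in>?K. c f * zc f) + zc e * (\<Sum>f\<in>?K. c f)" using K by simp
    also have "\<dots> = (\<Sum>f\<in>?K. c f * (zc f + zc e))"
      by (simp add: sum_distrib_left algebra_simps sum.distrib)
    also have "\<dots> = (\<Sum>f\<in>{e}. c f * (zc f + zc e))"
    proof (rule sum.mono_neutral_right)
      show "\<forall>f\<in>?K - {e}. c f * (zc f + zc e) = 0"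
        using par[OF e] distinct e by (fastforce simp: zc_def)
    qed (use fin e in \<open>auto simp: cr_def\<close>)
    finally show ?thesis using nz[OF e] by simp
  qed
  have E1_0: "c e = 0" if e: "e \<in> E1" for e
  proof (rule key)
    show eE: "e \<in> E" using e by (simp add: E1_def)
    have K: "{f\<in>E1. cr e f = 0} = {f\<in>E. cr e f = 0}"
      using par[OF eE] e by (fastforce simp: E1_def yc_def)
    have "\<bar>yc f\<bar> = \<bar>yc e\<bar>" if "f \<in> E" "cr e f = 0" for f
      using par[OF eE that] by (auto simp: yc_def)
    then have "(\<Sum>f\<in>{f\<in>E. cr e f = 0}. c f * \<bar>yc f\<bar>) = (\<Sum>f\<in>{f\<in>E. cr e f = 0}. c f) * \<bar>yc e\<bar>"
      unfolding sum_distrib_right by (intro sum.cong) auto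
    moreover have "(\<Sum>f\<in>{f\<in>E1. cr e f = 0}. c f * \<bar>yc f\<bar>) = 0"
      by (rule P(2)[OF _ PR(1) e])
    ultimately show "(\<Sum>f\<in>{f\<in>E. cr e f = 0}. c f) = 0"
      using E1(2)[OF e] by (simp add: K)
  qed
  show "c e = 0"
  proof (cases "e \<in> E1")
    case False
    then have ye: "yc e = 0" using e by (simp add: E1_def)
    \<comment> \<open>The vectors outside \<open>E1\<close> all lie on the line of the balanced
      direction. The weights in \<open>E1\<close> are zero by now, so this one line carries the
      total weight \<open>c0\<close>.\<close>
    have "(\<Sum>f\<in>{f\<in>E. cr e f = 0}. c f) = (\<Sum>f\<in>E. c f)"
    proof (rule sum.mono_neutral_left)
      show "\<forall>f\<in>E - {f\<in>E. cr e f = 0}. c f = 0"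
        using crE0[OF ye] E1_0 by (auto simp: E1_def)
    qed (use fin in auto)
    then show ?thesis using key[OF e] c0 by simp
  qed (rule E1_0)
qed

end

subsection \<open>Crossings of a stressed graph with its translates\<close>

text \<open>The period is 1 because the torus is used in lattice coordinates, where the lattice
  becomes Z^2.\<close>

definition periodic :: "(real \<Rightarrow> real) \<Rightarrow> bool" where
  "periodic f \<longleftrightarrow> (\<forall>x. f (x + 1) = f x)"

text \<open>On \<open>F (x + s u\<^sub>1 - t v\<^sub>1, y + s u\<^sub>2 - t v\<^sub>2)\<close> the operator \<open>v\<^sub>2 \<partial>\<^sub>s + u\<^sub>2 \<partial>\<^sub>t\<close> acts as
  \<open>(u \<times> v) \<partial>\<^sub>x\<close>.\<close>

lemma double_integral_cross:
  fixes A a B b :: "real \<Rightarrow> real" and x y u1 u2 v1 v2 :: real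
  assumes dA: "\<And>x. (A has_real_derivative a x) (at x)" and ca: "continuous_on UNIV a"
    and dB: "\<And>x. (B has_real_derivative b x) (at x)" and cb: "continuous_on UNIV b"
  defines "G \<equiv> \<lambda>s t. A (x + s * u1 - t * v1) * B (y + s * u2 - t * v2)"
  shows "(u1 * v2 - u2 * v1) *
      integral {0..1} (\<lambda>s. integral {0..1} (\<lambda>t. a (x + s * u1 - t * v1) * B (y + s * u2 - t * v2)))
    = v2 * integral {0..1} (\<lambda>t. G 1 t - G 0 t) + u2 * integral {0..1} (\<lambda>s. G s 1 - G s 0)"
proof -
  define X Y where "X s t = x + s * u1 - t * v1" and "Y s t = y + s * u2 - t * v2" for s t
  define Gs where "Gs s t = a (X s t) * u1 * B (Y s t) + A (X s t) * (b (Y s t) * u2)" for s t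
  define Gt where "Gt s t = a (X s t) * (- v1) * B (Y s t) + A (X s t) * (b (Y s t) * (- v2))" for s t
  have cA: "continuous_on UNIV A" and cB: "continuous_on UNIV B"
    using dA dB DERIV_isCont continuous_at_imp_continuous_on by blast+
  note conts = continuous_on_compose2[OF ca] continuous_on_compose2[OF cb]
    continuous_on_compose2[OF cA] continuous_on_compose2[OF cB]
  have cGs: "continuous_on S (\<lambda>(s, t). Gs s t)" and cGt: "continuous_on S (\<lambda>(s, t). Gt s t)" for S
    unfolding Gs_def Gt_def X_def Y_def case_prod_beta by (intro continuous_intros conts; simp)+
  have c1: "continuous_on {0..1} (\<lambda>s. integral {0..1} (Gs s))"
    "continuous_on {0..1} (\<lambda>s. integral {0..1} (Gt s))"
    using integral_continuous_on_param[of "{0..1}" 0 1 Gs] integral_continuous_on_param[of "{0..1}" 0 1 Gt]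
      cGs cGt by auto
  have c2: "continuous_on {0..1} (Gs s)" "continuous_on {0..1} (Gt s)"
    "continuous_on {0..1} (\<lambda>s. Gs s t)" for s t
    unfolding Gs_def Gt_def X_def Y_def by (intro continuous_intros conts; simp)+
  have int_s: "integral {0..1} (\<lambda>s. Gs s t) = G 1 t - G 0 t" for t
  proof -
    have "((\<lambda>s. G s t) has_real_derivative Gs s t) (at s)" for s
      unfolding G_def Gs_def X_def Y_def
      by (auto intro!: derivative_eq_intros DERIV_chain'[OF _ dA] DERIV_chain'[OF _ dB])
    then have "((\<lambda>s. Gs s t) has_integral (G 1 t - G 0 t)) {0..1}"
      by (intro fundamental_theorem_of_calculus)
        (auto simp: has_real_derivative_iff_has_vector_derivative intro: has_vector_derivative_at_within)
    then show ?thesis by (rule integral_unique)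
  qed
  have int_t: "integral {0..1} (Gt s) = G s 1 - G s 0" for s
  proof -
    have "((\<lambda>t. G s t) has_real_derivative Gt s t) (at t)" for t
      unfolding G_def Gt_def X_def Y_def
      by (auto intro!: derivative_eq_intros DERIV_chain'[OF _ dA] DERIV_chain'[OF _ dB])
    then have "(Gt s has_integral (G s 1 - G s 0)) {0..1}"
      by (intro fundamental_theorem_of_calculus)
        (auto simp: has_real_derivative_iff_has_vector_derivative intro: has_vector_derivative_at_within)
    then show ?thesis by (rule integral_unique)
  qed
  have "(u1 * v2 - u2 * v1) * integral {0..1} (\<lambda>t. a (X s t) * B (Y s t))
      = v2 * integral {0..1} (Gs s) + u2 * integral {0..1} (Gt s)" for s
  proof -
    have "(u1 * v2 - u2 * v1) * integral {0..1} (\<lambda>t. a (X s t) * B (Y s t))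
       = integral {0..1} (\<lambda>t. v2 * Gs s t + u2 * Gt s t)"
      unfolding integral_mult_right[symmetric] Gs_def Gt_def
      by (intro arg_cong2[where f = integral] ext refl) (simp add: algebra_simps)
    also have "\<dots> = v2 * integral {0..1} (Gs s) + u2 * integral {0..1} (Gt s)"
      using c2[of s] by (subst integral_add) (auto intro!: integrable_continuous_interval continuous_intros)
    finally show ?thesis .
  qed
  then have "(u1 * v2 - u2 * v1) * integral {0..1} (\<lambda>s. integral {0..1} (\<lambda>t. a (X s t) * B (Y s t)))
    = integral {0..1} (\<lambda>s. v2 * integral {0..1} (Gs s) + u2 * integral {0..1} (Gt s))"
    by (simp flip: integral_mult_right)
  also have "\<dots> = v2 * integral {0..1} (\<lambda>s. integral {0..1} (Gs s)) + u2 * integral {0..1} (\<lambda>s. integral {0..1} (Gt s))"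
    using c1 by (subst integral_add) (auto intro!: integrable_continuous_interval continuous_intros)
  \<comment> \<open>The inner integral runs over \<open>t\<close>, so the
    \<open>s\<close>-derivative becomes a boundary term only after exchanging the order.\<close>
  also have "integral {0..1} (\<lambda>s. integral {0..1} (Gs s)) = integral {0..1} (\<lambda>t. integral {0..1} (\<lambda>s. Gs s t))"
    using integral_swap_continuous[of 0 0 1 1 Gs] cGs by auto
  finally show ?thesis by (simp add: int_s int_t X_def Y_def)
qed

text \<open>Equilibrium in weak form. The segment \<open>e\<close> exerts opposite forces along
  itself at its two ends; testing with all periodic \<open>H\<close> says that at each point of the
  torus the forces of the segments ending there add up to zero, without any list of
  vertices.\<close>

locale torus_segments = planar_vectors E hx hy
  for E :: "'e set" and hx hy :: "'e \<Rightarrow> real" +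
  fixes x y c :: "'e \<Rightarrow> real"
  assumes equilibrium: "\<And>H :: real \<Rightarrow> real \<Rightarrow> real. (\<And>X Y. H (X + 1) Y = H X Y) \<Longrightarrow> (\<And>X Y. H X (Y + 1) = H X Y) \<Longrightarrow>
      (\<Sum>e\<in>E. c e * hx e * (H (x e + hx e) (y e + hy e) - H (x e) (y e))) = 0 \<and>
      (\<Sum>e\<in>E. c e * hy e * (H (x e + hx e) (y e + hy e) - H (x e) (y e))) = 0"
begin

text \<open>Substituting z for the difference of a point of \<open>e\<close> and a point of
  \<open>f\<close>, one sees that \<open>\<bar>cr e f\<bar> * I A B e f\<close> integrates
  \<open>A(z\<^sub>1) B(z\<^sub>2)\<close> over the torus against the number of crossings of
  \<open>e\<close> with the translate of \<open>f\<close> by z.\<close>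

definition I :: "(real \<Rightarrow> real) \<Rightarrow> (real \<Rightarrow> real) \<Rightarrow> 'e \<Rightarrow> 'e \<Rightarrow> real" where
  "I A B e f = integral {0..1} (\<lambda>s. integral {0..1} (\<lambda>t.
     A (x e - x f + s * hx e - t * hx f) * B (y e - y f + s * hy e - t * hy f)))"

text \<open>The crossing sum as a function of the translation has zero derivative in the weak sense.
  One factor \<open>cr e f\<close> turns the integral of a derivative into boundary terms at the
  ends of \<open>e\<close> and of \<open>f\<close>; the other factor is linear in each vector, so
  weak equilibrium cancels these terms.\<close>

lemma crossing_sum_derivative:
  assumes dA: "\<And>x. (A has_real_derivative a x) (at x)" and ca: "continuous_on UNIV a" and pA: "periodic A"
    and dB: "\<And>x. (B has_real_derivative b x) (at x)" and cb: "continuous_on UNIV b" and pB: "periodic B"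
  shows "(\<Sum>e\<in>E. \<Sum>f\<in>E. c e * c f * (cr e f)\<^sup>2 * I a B e f) = 0"
proof -
  define G where "G e f s t = A (x e - x f + s * hx e - t * hx f) * B (y e - y f + s * hy e - t * hy f)" for e f s t
  have cA: "continuous_on UNIV A" and cB: "continuous_on UNIV B"
    using dA dB DERIV_isCont continuous_at_imp_continuous_on by blast+
  have cG: "continuous_on {0..1} (G e f s)" "continuous_on {0..1} (\<lambda>s. G e f s t)" for e f s t
    unfolding G_def by (intro continuous_intros continuous_on_compose2[OF cA] continuous_on_compose2[OF cB]; simp)+
  have pA': "A (X + 1 - u - v) = A (X - u - v)" "A (u - (X + 1)) = A (u - X)" for X u v
    using pA[unfolded periodic_def, rule_format, of "X - u - v"]
      pA[unfolded periodic_def, rule_format, of "u - (X + 1)"] by (simp_all add: algebra_simps)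
  have pB': "B (X + 1 - u - v) = B (X - u - v)" "B (u - (X + 1)) = B (u - X)" for X u v
    using pB[unfolded periodic_def, rule_format, of "X - u - v"]
      pB[unfolded periodic_def, rule_format, of "u - (X + 1)"] by (simp_all add: algebra_simps)
  have crH: "(\<Sum>e\<in>E. c e * cr e f * (H (x e + hx e) (y e + hy e) - H (x e) (y e))) = 0"
    if "\<And>X Y. H (X + 1) Y = H X Y" "\<And>X Y. H X (Y + 1) = H X Y" for H :: "real \<Rightarrow> real \<Rightarrow> real" and f
  proof -
    have "(\<Sum>e\<in>E. c e * cr e f * (H (x e + hx e) (y e + hy e) - H (x e) (y e)))
      = hy f * (\<Sum>e\<in>E. c e * hx e * (H (x e + hx e) (y e + hy e) - H (x e) (y e)))
      - hx f * (\<Sum>e\<in>E. c e * hy e * (H (x e + hx e) (y e + hy e) - H (x e) (y e)))"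
      unfolding cr_def sum_distrib_left sum_subtractf[symmetric] by (intro sum.cong) (auto simp: algebra_simps)
    then show ?thesis using equilibrium[of H] that by simp
  qed
  have 1: "(\<Sum>e\<in>E. c e * cr e f * (G e f 1 t - G e f 0 t)) = 0" for f t
  proof -
    let ?H = "\<lambda>X Y. A (X - x f - t * hx f) * B (Y - y f - t * hy f)"
    have G: "G e f 1 t - G e f 0 t = ?H (x e + hx e) (y e + hy e) - ?H (x e) (y e)" for e
      by (simp add: G_def algebra_simps)
    show ?thesis unfolding G
by (rule crH) (simp_all only: pA' pB')
  qed
  have 2: "(\<Sum>f\<in>E. c f * cr e f * (G e f s 1 - G e f s 0)) = 0" for e s
  proof -
    let ?H = "\<lambda>X Y. A (x e + s * hx e - X) * B (y e + s * hy e - Y)"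
    have G1: "G e f s 1 = ?H (x f + hx f) (y f + hy f)" and G0: "G e f s 0 = ?H (x f) (y f)" for f
      by (simp_all add: G_def algebra_simps)
    have G: "c f * cr e f * (G e f s 1 - G e f s 0) = - (c f * cr f e * (G e f s 1 - G e f s 0))" for f
      by (simp add: cr_def algebra_simps)
    have "(\<Sum>f\<in>E. c f * cr f e * (?H (x f + hx f) (y f + hy f) - ?H (x f) (y f))) = 0"
      by (rule crH) (simp_all only: pA' pB')
    then show ?thesis unfolding G sum_negf by (simp add: G1 G0)
  qed
  have "(\<Sum>e\<in>E. \<Sum>f\<in>E. c e * c f * (cr e f)\<^sup>2 * I a B e f)
     = (\<Sum>e\<in>E. \<Sum>f\<in>E. c f * hy f * integral {0..1} (\<lambda>t. c e * cr e f * (G e f 1 t - G e f 0 t)))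
     + (\<Sum>e\<in>E. \<Sum>f\<in>E. c e * hy e * integral {0..1} (\<lambda>s. c f * cr e f * (G e f s 1 - G e f s 0)))"
    unfolding sum.distrib[symmetric]
  proof (intro sum.cong refl)
    fix e f
    have "cr e f * I a B e f = hy f * integral {0..1} (\<lambda>t. G e f 1 t - G e f 0 t)
        + hy e * integral {0..1} (\<lambda>s. G e f s 1 - G e f s 0)"
      unfolding I_def cr_def G_def by (rule double_integral_cross[OF dA ca dB cb])
    then show "c e * c f * (cr e f)\<^sup>2 * I a B e f
      = c f * hy f * integral {0..1} (\<lambda>t. c e * cr e f * (G e f 1 t - G e f 0 t))
      + c e * hy e * integral {0..1} (\<lambda>s. c f * cr e f * (G e f s 1 - G e f s 0))"
      unfolding power2_eq_square by (simp add: mult.assoc) (simp add: algebra_simps)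
  qed
  also have "(\<Sum>e\<in>E. \<Sum>f\<in>E. c f * hy f * integral {0..1} (\<lambda>t. c e * cr e f * (G e f 1 t - G e f 0 t)))
    = (\<Sum>f\<in>E. c f * hy f * integral {0..1} (\<lambda>t. \<Sum>e\<in>E. c e * cr e f * (G e f 1 t - G e f 0 t)))"
  proof (subst sum.swap, intro sum.cong refl)
    fix f
    have "integral {0..1} (\<lambda>t. \<Sum>e\<in>E. c e * cr e f * (G e f 1 t - G e f 0 t))
      = (\<Sum>e\<in>E. integral {0..1} (\<lambda>t. c e * cr e f * (G e f 1 t - G e f 0 t)))"
      by (intro integral_sum fin integrable_continuous_interval continuous_intros cG)
    then show "(\<Sum>e\<in>E. c f * hy f * integral {0..1} (\<lambda>t. c e * cr e f * (G e f 1 t - G e f 0 t)))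
      = c f * hy f * integral {0..1} (\<lambda>t. \<Sum>e\<in>E. c e * cr e f * (G e f 1 t - G e f 0 t))"
      by (simp only: sum_distrib_left)
  qed
  also have "\<dots> = 0" by (simp add: 1)
  also have "(\<Sum>e\<in>E. \<Sum>f\<in>E. c e * hy e * integral {0..1} (\<lambda>s. c f * cr e f * (G e f s 1 - G e f s 0)))
    = (\<Sum>e\<in>E. c e * hy e * integral {0..1} (\<lambda>s. \<Sum>f\<in>E. c f * cr e f * (G e f s 1 - G e f s 0)))"
  proof (intro sum.cong refl)
    fix e
    have "integral {0..1} (\<lambda>s. \<Sum>f\<in>E. c f * cr e f * (G e f s 1 - G e f s 0))
      = (\<Sum>f\<in>E. integral {0..1} (\<lambda>s. c f * cr e f * (G e f s 1 - G e f s 0)))"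
      by (intro integral_sum fin integrable_continuous_interval continuous_intros cG)
    then show "(\<Sum>f\<in>E. c e * hy e * integral {0..1} (\<lambda>s. c f * cr e f * (G e f s 1 - G e f s 0)))
      = c e * hy e * integral {0..1} (\<lambda>s. \<Sum>f\<in>E. c f * cr e f * (G e f s 1 - G e f s 0))"
      by (simp only: sum_distrib_left)
  qed
  also have "\<dots> = 0" by (simp add: 2)
  finally show ?thesis by simp
qed

lemma I_diff_const:
  assumes cA: "continuous_on UNIV A" and cB: "continuous_on UNIV B"
  shows "I (\<lambda>x. A x - k) B e f = I A B e f - k * I (\<lambda>_. 1) B e f"
proof -
  let ?X = "\<lambda>s t. x e - x f + s * hx e - t * hx f" and ?Y = "\<lambda>s t. y e - y f + s * hy e - t * hy f"
  note conts = continuous_on_compose2[OF cA] continuous_on_compose2[OF cB]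
  have c: "continuous_on S (\<lambda>(s, t). A (?X s t) * B (?Y s t))" "continuous_on S (\<lambda>(s, t). B (?Y s t))" for S
    unfolding case_prod_beta by (intro continuous_intros conts; simp)+
  have c1: "continuous_on {0..1} (\<lambda>t. A (?X s t) * B (?Y s t))" "continuous_on {0..1} (\<lambda>t. B (?Y s t))" for s
    by (intro continuous_intros conts; simp)+
  have c2: "continuous_on {0..1} (\<lambda>s. integral {0..1} (\<lambda>t. A (?X s t) * B (?Y s t)))"
    "continuous_on {0..1} (\<lambda>s. integral {0..1} (\<lambda>t. B (?Y s t)))"
    using integral_continuous_on_param[OF c(1)[of "{0..1} \<times> cbox 0 1"]]
      integral_continuous_on_param[OF c(2)[of "{0..1} \<times> cbox 0 1"]] by auto
  have "integral {0..1} (\<lambda>t. (A (?X s t) - k) * B (?Y s t))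
    = integral {0..1} (\<lambda>t. A (?X s t) * B (?Y s t)) - k * integral {0..1} (\<lambda>t. B (?Y s t))" for s
    unfolding left_diff_distrib
    by (subst integral_diff) (auto intro!: integrable_continuous_interval continuous_intros c1)
  then show ?thesis unfolding I_def
    by (simp, subst integral_diff) (auto intro!: integrable_continuous_interval continuous_intros c2)
qed

end

text \<open>The mean value \<open>k\<close> over a period is the only obstruction to a periodic
  primitive.\<close>

lemma periodic_primitive:
  assumes "continuous_on UNIV A" "periodic A"
  shows "\<exists>k F. periodic F \<and> (\<forall>x. (F has_real_derivative A x - k) (at x))"
proof -
  obtain \<Phi> where \<Phi>: "\<And>x. (\<Phi> has_real_derivative A x) (at x)"
    using continuous_antiderivative[of A] assms(1) by (auto simp: continuous_on_eq_continuous_at)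
  define k where "k = \<Phi> 1 - \<Phi> 0"
  have "\<Phi> (x + 1) - \<Phi> x = k" for x
  proof -
    have "((\<lambda>x. \<Phi> (x + 1) - \<Phi> x) has_real_derivative 0) (at x)" for x
      using assms(2) by (auto intro!: derivative_eq_intros DERIV_chain'[OF _ \<Phi>] \<Phi> simp: periodic_def)
    then have "\<Phi> (x + 1) - \<Phi> x = \<Phi> (0 + 1) - \<Phi> 0"
      using DERIV_isconst_all[of "\<lambda>x. \<Phi> (x + 1) - \<Phi> x"] by blast
    then show ?thesis by (simp add: k_def)
  qed
  then show ?thesis
    by (intro exI[of _ k] exI[of _ "\<lambda>x. \<Phi> x - k * x"])
      (auto simp: periodic_def algebra_simps intro!: derivative_eq_intros \<Phi>)
qed

context torus_segments
begin

text \<open>Decompose \<open>A(x) B(y)\<close> as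
  \<open>(A(x) - k) B(y) + k (B(y) - l) + k l\<close> with mean values \<open>k\<close> and
  \<open>l\<close>. The first two summands are derivatives of periodic functions in \<open>x\<close>
  and in \<open>y\<close>, and the constant meets the vanishing moment.\<close>

lemma crossing_sum_zero:
  assumes cA: "continuous_on UNIV A" and pA: "periodic A"
    and dB: "\<And>x. (B has_real_derivative b x) (at x)" and cb: "continuous_on UNIV b" and pB: "periodic B"
    and moment: "(\<Sum>e\<in>E. \<Sum>f\<in>E. c e * c f * (cr e f)\<^sup>2) = 0"
  shows "(\<Sum>e\<in>E. \<Sum>f\<in>E. c e * c f * (cr e f)\<^sup>2 * I A B e f) = 0"
proof -
  have cB: "continuous_on UNIV B" using dB DERIV_isCont continuous_at_imp_continuous_on by blast
  obtain k A0 where A0: "periodic A0" "\<And>x. (A0 has_real_derivative A x - k) (at x)"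
    using periodic_primitive[OF cA pA] by blast
  obtain l B0 where B0: "periodic B0" "\<And>x. (B0 has_real_derivative B x - l) (at x)"
    using periodic_primitive[OF cB pB] by blast
  have 1: "(\<Sum>e\<in>E. \<Sum>f\<in>E. c e * c f * (cr e f)\<^sup>2 * I (\<lambda>x. A x - k) B e f) = 0"
    by (rule crossing_sum_derivative[OF A0(2) _ A0(1) dB cb pB]) (intro continuous_intros cA)
  \<comment> \<open>Exchanging the coordinates reduces derivatives in \<open>y\<close> to
    derivatives in \<open>x\<close>.\<close>
  interpret swap: torus_segments E hy hx y x c
  proof
    fix H :: "real \<Rightarrow> real \<Rightarrow> real"
    assume "\<And>X Y. H (X + 1) Y = H X Y" "\<And>X Y. H X (Y + 1) = H X Y"
    then show "(\<Sum>e\<in>E. c e * hy e * (H (y e + hy e) (x e + hx e) - H (y e) (x e))) = 0 \<and>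
        (\<Sum>e\<in>E. c e * hx e * (H (y e + hy e) (x e + hx e) - H (y e) (x e))) = 0"
      using equilibrium[of "\<lambda>X Y. H Y X"] by blast
  qed
  have swap_cr: "(swap.cr e f)\<^sup>2 = (cr e f)\<^sup>2" for e f
    by (simp add: cr_def swap.cr_def power2_commute mult.commute)
  have swap_I: "swap.I A B e f = I B A e f" for A B e f
    by (simp add: I_def swap.I_def mult.commute)
  have "(\<Sum>e\<in>E. \<Sum>f\<in>E. c e * c f * (swap.cr e f)\<^sup>2 * swap.I (\<lambda>x. B x - l) (\<lambda>_. 1) e f) = 0"
    by (rule swap.crossing_sum_derivative[OF B0(2) _ B0(1), of "\<lambda>_. 1" "\<lambda>_. 0"])
      (auto intro!: continuous_intros cB simp: periodic_def)
  then have 2: "(\<Sum>e\<in>E. \<Sum>f\<in>E. c e * c f * (cr e f)\<^sup>2 * (I (\<lambda>_. 1) B e f - l)) = 0"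
    using swap.I_diff_const[OF cB, of "\<lambda>_. 1"] unfolding swap_cr by (simp add: swap_I) (simp add: I_def)
  have "c e * c f * (cr e f)\<^sup>2 * I A B e f = c e * c f * (cr e f)\<^sup>2 * I (\<lambda>x. A x - k) B e f
      + k * (c e * c f * (cr e f)\<^sup>2 * (I (\<lambda>_. 1) B e f - l)) + k * l * (c e * c f * (cr e f)\<^sup>2)" for e f
    by (simp add: I_diff_const[OF cA cB] algebra_simps)
  then show ?thesis
    by (simp add: sum.distrib 1 2 moment flip: sum_distrib_left)
qed

end

section \<open>Linear substitutions in integrals, and bump functions\<close>

lemma nn_integral_affine_image:
  fixes f :: "real \<Rightarrow> ennreal"
  assumes [measurable]: "f \<in> borel_measurable borel" and c: "c \<noteq> 0"
  shows "(\<integral>\<^sup>+x. f (t + c * x) \<partial>lborel) = ennreal (1 / \<bar>c\<bar>) * (\<integral>\<^sup>+x. f x \<partial>lborel)"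
proof -
  have "ennreal (1 / \<bar>c\<bar>) * (\<integral>\<^sup>+x. f x \<partial>lborel)
      = ennreal (1 / \<bar>c\<bar>) * ennreal \<bar>c\<bar> * (\<integral>\<^sup>+x. f (t + c * x) \<partial>lborel)"
    by (subst nn_integral_real_affine[OF assms, of t]) (simp add: mult.assoc)
  also have "ennreal (1 / \<bar>c\<bar>) * ennreal \<bar>c\<bar> = 1"
    using c by (simp flip: ennreal_mult)
  finally show ?thesis by simp
qed

text \<open>A planar linear substitution, done as two affine substitutions on the line joined by
  Tonelli's theorem. The general case divides by \<open>v2\<close>, hence the case
  distinction.\<close>

lemma nn_integral_linear_image:
  fixes a b :: "real \<Rightarrow> ennreal" and u1 u2 v1 v2 :: real
  assumes [measurable]: "a \<in> borel_measurable borel" "b \<in> borel_measurable borel"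
    and \<kappa>: "u1 * v2 - u2 * v1 \<noteq> 0"
  shows "(\<integral>\<^sup>+s. \<integral>\<^sup>+t. a (s * u1 - t * v1) * b (s * u2 - t * v2) \<partial>lborel \<partial>lborel)
    = ennreal (1 / \<bar>u1 * v2 - u2 * v1\<bar>) * ((\<integral>\<^sup>+x. a x \<partial>lborel) * (\<integral>\<^sup>+x. b x \<partial>lborel))"
proof (cases "v2 = 0")
  case True
  then have nz: "v1 \<noteq> 0" "u2 \<noteq> 0" using \<kappa> by auto
  have "(\<integral>\<^sup>+t. a (s * u1 - t * v1) * b (s * u2 - t * v2) \<partial>lborel)
     = ennreal (1 / \<bar>v1\<bar>) * (\<integral>\<^sup>+x. a x \<partial>lborel) * b (0 + u2 * s)" for s
  proof -
    have "(\<integral>\<^sup>+t. a (s * u1 - t * v1) * b (s * u2 - t * v2) \<partial>lborel)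
       = (\<integral>\<^sup>+t. a (s * u1 + (- v1) * t) * b (0 + u2 * s) \<partial>lborel)"
      using True by (simp add: mult.commute)
    also have "\<dots> = (\<integral>\<^sup>+t. a (s * u1 + (- v1) * t) \<partial>lborel) * b (0 + u2 * s)"
      by (rule nn_integral_multc) measurable
    finally show ?thesis using nn_integral_affine_image[of a "- v1" "s * u1"] nz by simp
  qed
  then have "(\<integral>\<^sup>+s. \<integral>\<^sup>+t. a (s * u1 - t * v1) * b (s * u2 - t * v2) \<partial>lborel \<partial>lborel)
     = ennreal (1 / \<bar>v1\<bar>) * (\<integral>\<^sup>+x. a x \<partial>lborel) * (\<integral>\<^sup>+s. b (0 + u2 * s) \<partial>lborel)"
    by (simp add: nn_integral_cmult)
  also have "(\<integral>\<^sup>+s. b (0 + u2 * s) \<partial>lborel) = ennreal (1 / \<bar>u2\<bar>) * (\<integral>\<^sup>+x. b x \<partial>lborel)"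
    using nz by (intro nn_integral_affine_image) auto
  also have "ennreal (1 / \<bar>v1\<bar>) * (\<integral>\<^sup>+x. a x \<partial>lborel) * (ennreal (1 / \<bar>u2\<bar>) * (\<integral>\<^sup>+x. b x \<partial>lborel))
     = (ennreal (1 / \<bar>v1\<bar>) * ennreal (1 / \<bar>u2\<bar>)) * ((\<integral>\<^sup>+x. a x \<partial>lborel) * (\<integral>\<^sup>+x. b x \<partial>lborel))"
    by (simp only: mult_ac)
  also have "ennreal (1 / \<bar>v1\<bar>) * ennreal (1 / \<bar>u2\<bar>) = ennreal (1 / \<bar>u1 * v2 - u2 * v1\<bar>)"
    using True by (simp add: abs_mult mult.commute flip: ennreal_mult)
  finally show ?thesis .
next
  case False
  \<comment> \<open>The coefficient of \<open>s\<close> in \<open>s * u1 - t * v1\<close> once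
    \<open>t\<close> is expressed by \<open>\<tau> = s * u2 - t * v2\<close>.\<close>
  define \<kappa>' where "\<kappa>' = (u1 * v2 - u2 * v1) / v2"
  have \<kappa>': "\<kappa>' \<noteq> 0" using \<kappa> False by (simp add: \<kappa>'_def)
  have inner: "(\<integral>\<^sup>+t. a (s * u1 - t * v1) * b (s * u2 - t * v2) \<partial>lborel)
     = ennreal (1 / \<bar>v2\<bar>) * (\<integral>\<^sup>+\<tau>. a (\<tau> * v1 / v2 + \<kappa>' * s) * b \<tau> \<partial>lborel)" for s
  proof -
    have "a (s * u1 - t * v1) * b (s * u2 - t * v2)
       = (\<lambda>\<tau>. a (\<tau> * v1 / v2 + \<kappa>' * s) * b \<tau>) (s * u2 + (- v2) * t)" for t
    proof -
      have "(s * u2 + (- v2) * t) * v1 / v2 + \<kappa>' * s = s * u1 - t * v1"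
        using False by (simp add: \<kappa>'_def field_simps)
      then show ?thesis by (simp add: mult.commute)
    qed
    then show ?thesis
      using nn_integral_affine_image[of "\<lambda>\<tau>. a (\<tau> * v1 / v2 + \<kappa>' * s) * b \<tau>" "- v2" "s * u2"] False
      by simp
  qed
  have "(\<integral>\<^sup>+s. \<integral>\<^sup>+t. a (s * u1 - t * v1) * b (s * u2 - t * v2) \<partial>lborel \<partial>lborel)
    = ennreal (1 / \<bar>v2\<bar>) * (\<integral>\<^sup>+s. \<integral>\<^sup>+\<tau>. a (\<tau> * v1 / v2 + \<kappa>' * s) * b \<tau> \<partial>lborel \<partial>lborel)"
    unfolding inner by (rule nn_integral_cmult) measurable
  also have "(\<integral>\<^sup>+s. \<integral>\<^sup>+\<tau>. a (\<tau> * v1 / v2 + \<kappa>' * s) * b \<tau> \<partial>lborel \<partial>lborel)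
    = (\<integral>\<^sup>+\<tau>. \<integral>\<^sup>+s. a (\<tau> * v1 / v2 + \<kappa>' * s) * b \<tau> \<partial>lborel \<partial>lborel)"
    by (rule lborel_pair.Fubini') measurable
  also have "\<dots> = (\<integral>\<^sup>+\<tau>. ennreal (1 / \<bar>\<kappa>'\<bar>) * (\<integral>\<^sup>+x. a x \<partial>lborel) * b \<tau> \<partial>lborel)"
    using nn_integral_affine_image[of a \<kappa>'] \<kappa>' by (simp add: nn_integral_multc)
  also have "\<dots> = ennreal (1 / \<bar>\<kappa>'\<bar>) * (\<integral>\<^sup>+x. a x \<partial>lborel) * (\<integral>\<^sup>+x. b x \<partial>lborel)"
    by (rule nn_integral_cmult) measurable
  also have "ennreal (1 / \<bar>v2\<bar>) * (ennreal (1 / \<bar>\<kappa>'\<bar>) * (\<integral>\<^sup>+x. a x \<partial>lborel) * (\<integral>\<^sup>+x. b x \<partial>lborel))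
    = (ennreal (1 / \<bar>v2\<bar>) * ennreal (1 / \<bar>\<kappa>'\<bar>)) * ((\<integral>\<^sup>+x. a x \<partial>lborel) * (\<integral>\<^sup>+x. b x \<partial>lborel))"
    by (simp only: mult_ac)
  also have "ennreal (1 / \<bar>v2\<bar>) * ennreal (1 / \<bar>\<kappa>'\<bar>) = ennreal (1 / \<bar>u1 * v2 - u2 * v1\<bar>)"
    using False by (simp add: \<kappa>'_def flip: ennreal_mult)
  finally show ?thesis .
qed

lemma DERIV_max_0_power2: "((\<lambda>y::real. (max 0 y)\<^sup>2) has_real_derivative 2 * max 0 y) (at y)"
proof (cases y "0::real" rule: linorder_cases)
  case less
  have "((\<lambda>_. 0 :: real) has_real_derivative 0) (at y)" by simp
  then have "((\<lambda>y::real. (max 0 y)\<^sup>2) has_real_derivative 0) (at y)"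
    by (rule has_field_derivative_transform_within_open[of _ _ _ "{..<0}"]) (use less in auto)
  then show ?thesis using less by simp
next
  case equal
  have "(\<lambda>h::real. (max 0 h)\<^sup>2 / h) \<midarrow>0\<rightarrow> 0"
  proof (rule Lim_null_comparison)
    show "\<forall>\<^sub>F h::real in at 0. norm ((max 0 h)\<^sup>2 / h) \<le> \<bar>h\<bar>"
      by (intro always_eventually) (auto simp: max_def power2_eq_square)
    show "((\<lambda>h::real. \<bar>h\<bar>) \<longlongrightarrow> 0) (at 0)" by (rule tendsto_rabs_zero, rule tendsto_ident_at)
  qed
  then show ?thesis using equal by (simp add: DERIV_def)
next
  case greater
  have "((\<lambda>y::real. y\<^sup>2) has_real_derivative 2 * y) (at y)" by (auto intro!: derivative_eq_intros)
  then have "((\<lambda>y::real. (max 0 y)\<^sup>2) has_real_derivative 2 * y) (at y)"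
    by (rule has_field_derivative_transform_within_open[of _ _ _ "{0<..}"]) (use greater in auto)
  then show ?thesis using greater by simp
qed

text \<open>A cosine cut off at the level it takes at distance \<open>\<delta>\<close> from its
  peak. Squaring the positive part makes it continuously differentiable, as the crossing sum
  demands.\<close>

lemma periodic_bump:
  fixes x0 \<delta> :: real
  assumes \<delta>: "0 < \<delta>" "\<delta> < 1/2"
  shows "\<exists>A a. periodic A \<and> (\<forall>x. (A has_real_derivative a x) (at x)) \<and> continuous_on UNIV a \<and>
    (\<forall>x. 0 \<le> A x) \<and> 0 < A x0 \<and> (\<forall>x. A x \<noteq> 0 \<longrightarrow> (\<exists>k::int. \<bar>x - of_int k - x0\<bar> < \<delta>))"
proof -
  define g where "g x = cos (2 * pi * (x - x0)) - cos (2 * pi * \<delta>)" for x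
  define A where "A x = (max 0 (g x))\<^sup>2" for x
  define a where "a x = 2 * max 0 (g x) * (- (2 * pi) * sin (2 * pi * (x - x0)))" for x
  have cos_int: "cos (2 * pi * (x - x0)) = cos (2 * pi * \<bar>x - x0 - of_int k\<bar>)" for x and k :: int
  proof -
    have "cos (2 * pi * \<bar>x - x0 - of_int k\<bar>) = cos (2 * pi * (x - x0 - of_int k))"
      using cos_abs_real[of "2 * pi * (x - x0 - of_int k)"] by (simp add: abs_mult)
    also have "2 * pi * (x - x0 - of_int k) = 2 * pi * (x - x0) - 2 * pi * of_int k"
      by (simp add: algebra_simps)
    also have "cos \<dots> = cos (2 * pi * (x - x0))"
      unfolding cos_diff cos_int_2pin sin_int_2pin by simp
    finally show ?thesis by simp
  qed
  have "periodic A"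
  proof -
    have "2 * pi * (x + 1 - x0) = 2 * pi * (x - x0) + 2 * pi" for x by (simp add: algebra_simps)
    then show ?thesis by (simp add: periodic_def A_def g_def)
  qed
  moreover have "(A has_real_derivative a x) (at x)" for x
  proof -
    have "(g has_real_derivative - (2 * pi) * sin (2 * pi * (x - x0))) (at x)"
      unfolding g_def by (auto intro!: derivative_eq_intros)
    then show ?thesis unfolding A_def a_def by (rule DERIV_chain'[OF _ DERIV_max_0_power2, THEN DERIV_cong]) simp
  qed
  moreover have "continuous_on UNIV a"
    unfolding a_def g_def by (intro continuous_intros)
  moreover have "0 \<le> A x" for x by (simp add: A_def)
  moreover have "0 < A x0"
  proof -
    have "cos (2 * pi * \<delta>) < cos 0"
      using \<delta> by (intro cos_monotone_0_pi) auto
    then show ?thesis by (simp add: A_def g_def)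
  qed
  moreover have "\<exists>k::int. \<bar>x - of_int k - x0\<bar> < \<delta>" if "A x \<noteq> 0" for x
  proof -
    define k where "k = round (x - x0)"
    have k: "\<bar>x - x0 - of_int k\<bar> \<le> 1/2"
      using of_int_round_abs_le[of "x - x0"] by (simp add: k_def abs_minus_commute)
    have "cos (2 * pi * \<delta>) < cos (2 * pi * \<bar>x - x0 - of_int k\<bar>)"
      using that by (auto simp: A_def g_def max_def cos_int[of _ k] split: if_splits)
    moreover have "cos (2 * pi * \<bar>x - x0 - of_int k\<bar>) \<le> cos (2 * pi * \<delta>)" if "\<delta> \<le> \<bar>x - x0 - of_int k\<bar>"
      using that k \<delta> by (intro cos_monotone_0_pi_le) auto
    ultimately have "\<bar>x - x0 - of_int k\<bar> < \<delta>" by force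
    then show ?thesis by (intro exI[of _ k]) (simp add: algebra_simps)
  qed
  ultimately show ?thesis by blast
qed

context torus_segments
begin

text \<open>For nonnegative functions the unit square can be encoded by indicators, and substitution
  and exchange of integrals need no integrability.\<close>

lemma I_eq_nn_integral:
  assumes cA: "continuous_on UNIV A" and cB: "continuous_on UNIV B"
    and A0: "\<And>x. 0 \<le> A x" and B0: "\<And>x. 0 \<le> B x"
  shows "ennreal (I A B e f) = (\<integral>\<^sup>+s. \<integral>\<^sup>+t.
     ennreal (A (x e - x f + s * hx e - t * hx f) * B (y e - y f + s * hy e - t * hy f))
       * indicator {0..1} t * indicator {0..1} s \<partial>lborel \<partial>lborel)"
    and I_nonneg: "0 \<le> I A B e f"
proof -
  let ?F = "\<lambda>s t. A (x e - x f + s * hx e - t * hx f) * B (y e - y f + s * hy e - t * hy f)"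
  note conts = continuous_on_compose2[OF cA] continuous_on_compose2[OF cB]
  have c: "continuous_on S (\<lambda>(s, t). ?F s t)" for S
    unfolding case_prod_beta by (intro continuous_intros conts; simp)
  have c1: "continuous_on {0..1} (?F s)" for s by (intro continuous_intros conts; simp)
  have c2: "continuous_on {0..1} (\<lambda>s. integral {0..1} (?F s))"
    using integral_continuous_on_param[OF c[of "{0..1} \<times> cbox 0 1"]] by auto
  have 1: "(\<integral>\<^sup>+t. ennreal (?F s t) * indicator {0..1} t \<partial>lborel) = ennreal (integral {0..1} (?F s))" for s
    using A0 B0 by (intro nn_integral_has_integral_lebesgue')
      (auto intro!: integrable_integral integrable_continuous_interval c1)
  have "(\<integral>\<^sup>+s. ennreal (integral {0..1} (?F s)) * indicator {0..1} s \<partial>lborel) = ennreal (I A B e f)"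
    unfolding I_def using A0 B0 by (intro nn_integral_has_integral_lebesgue')
      (auto intro!: integrable_integral integrable_continuous_interval c2 integral_nonneg c1)
  moreover have "(\<integral>\<^sup>+t. ennreal (?F s t) * indicator {0..1} t * indicator {0..1} s \<partial>lborel)
      = ennreal (integral {0..1} (?F s)) * indicator {0..1} s" for s
    unfolding 1[symmetric]
  proof (rule nn_integral_multc)
    have "?F s \<in> borel_measurable borel"
      by (intro borel_measurable_continuous_onI continuous_intros conts; simp)
    then show "(\<lambda>t. ennreal (?F s t) * indicator {0..1} t) \<in> borel_measurable lborel" by measurable
  qed
  ultimately show "ennreal (I A B e f) = (\<integral>\<^sup>+s. \<integral>\<^sup>+t. ennreal (?F s t)
       * indicator {0..1} t * indicator {0..1} s \<partial>lborel \<partial>lborel)" by simp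
  show "0 \<le> I A B e f"
    unfolding I_def using A0 B0
    by (intro integral_nonneg ballI integrable_continuous_interval c1 c2) auto
qed

text \<open>The periodic function is a bump near \<open>\<eta> z\<close> for a small \<open>\<eta>\<close>. Then only pairs of segments at
  a common vertex contribute, and each contributes the total mass of the bump or nothing, depending
  on whether \<open>z\<close> lies in the cone spanned by \<open>h e\<close> and \<open>- h f\<close>.\<close>

lemma vertex_crossing_sums_cancel:
  fixes vt :: "'e \<Rightarrow> 'v" and z1 z2 :: real
  defines "zc \<equiv> \<lambda>e. z1 * hy e - z2 * hx e"
  assumes moment: "(\<Sum>e\<in>E. \<Sum>f\<in>E. c e * c f * (cr e f)\<^sup>2) = 0"
    and same: "\<And>e f. e \<in> E \<Longrightarrow> f \<in> E \<Longrightarrow> vt e = vt f \<Longrightarrow> x e = x f \<and> y e = y f"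
    and \<epsilon>: "\<epsilon> > 0"
    and sep: "\<And>e f s t k l. e \<in> E \<Longrightarrow> f \<in> E \<Longrightarrow> cr e f \<noteq> 0 \<Longrightarrow> s \<in> {0..1} \<Longrightarrow> t \<in> {0..1} \<Longrightarrow>
      \<bar>x e - x f + s * hx e - t * hx f - of_int k\<bar> < \<epsilon> \<Longrightarrow>
      \<bar>y e - y f + s * hy e - t * hy f - of_int l\<bar> < \<epsilon> \<Longrightarrow> vt e = vt f \<and> k = 0 \<and> l = 0"
    and nz: "\<And>e. e \<in> E \<Longrightarrow> zc e \<noteq> 0"
  shows "(\<Sum>e\<in>E. \<Sum>f\<in>E. if vt e = vt f \<and> cr e f \<noteq> 0 \<and> sgn (zc e) = sgn (cr e f) \<and> sgn (zc f) = sgn (cr e f)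
      then c e * c f * \<bar>cr e f\<bar> else 0) = 0"
proof -
  define N where "N = 1 + \<bar>z1\<bar> + \<bar>z2\<bar>"
  define L where "L e = 1 + \<bar>hx e\<bar> + \<bar>hy e\<bar>" for e
  have L: "L e > 0" for e by (simp add: L_def)
  \<comment> \<open>The relative tolerance: changing the coordinates of z by less than
    \<open>d\<close> moves it across no line spanned by a segment.\<close>
  have "\<exists>d>0. \<forall>s\<in>insert 1 ((\<lambda>e. \<bar>zc e\<bar> / L e) ` E). d < s"
    using fin L nz by (intro finite_pos_lower_bound) auto
  then obtain d where d: "d > 0" "d < 1" "\<And>e. e \<in> E \<Longrightarrow> d * L e < \<bar>zc e\<bar>"
    using L by (auto simp: pos_less_divide_eq)
  \<comment> \<open>The bound by cross products keeps the crossing parameters of points near the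
    origin below 1, \<open>\<epsilon>\<close> excludes segments at different vertices, and 1/2
    allows the bump to be isolated in one period.\<close>
  have "\<exists>d>0. \<forall>s\<in>insert \<epsilon> (insert (1/2) ((\<lambda>(e, f). \<bar>cr e f\<bar> / L e) ` {(e, f) \<in> E \<times> E. cr e f \<noteq> 0})). d < s"
    using fin L \<epsilon> by (intro finite_pos_lower_bound) (auto intro: finite_subset[OF _ finite_cartesian_product[OF fin fin]])
  then obtain \<epsilon>1 where \<epsilon>1: "\<epsilon>1 > 0" "\<epsilon>1 < \<epsilon>" "\<epsilon>1 < 1/2"
      "\<And>e f. e \<in> E \<Longrightarrow> f \<in> E \<Longrightarrow> cr e f \<noteq> 0 \<Longrightarrow> \<epsilon>1 * L e < \<bar>cr e f\<bar>"
    using L by (fastforce simp: pos_less_divide_eq)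
  define \<eta> where "\<eta> = \<epsilon>1 / N"
  have N1: "N \<ge> 1" by (simp add: N_def)
  have \<eta>: "\<eta> > 0" "\<eta> * N = \<epsilon>1" "\<eta> \<le> \<epsilon>1"
    using \<epsilon>1(1) N1 by (auto simp: \<eta>_def divide_le_eq mult_le_cancel_left1)
  define \<delta> where "\<delta> = \<eta> * d"
  have \<delta>: "0 < \<delta>" "\<delta> < \<eta>" using \<eta> d by (auto simp: \<delta>_def)
  then have \<delta>2: "\<delta> < 1/2" using \<eta> \<epsilon>1 by simp
  define near where "near X Y \<longleftrightarrow> \<bar>X - \<eta> * z1\<bar> < \<delta> \<and> \<bar>Y - \<eta> * z2\<bar> < \<delta>" for X Y
  have small: "\<bar>X\<bar> < \<epsilon>1" if "\<bar>X - \<eta> * z\<bar> < \<delta>" "z = z1 \<or> z = z2" for X z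
  proof -
    have "\<bar>X\<bar> < \<delta> + \<eta> * \<bar>z\<bar>"
      using that(1) \<eta> abs_triangle_ineq[of "X - \<eta> * z" "\<eta> * z"] by (simp add: abs_mult)
    also have "\<dots> \<le> \<eta> * (1 + \<bar>z\<bar>)" using \<delta> by (simp add: distrib_left)
    also have "\<dots> \<le> \<eta> * N" using that(2) \<eta> by (intro mult_left_mono) (auto simp: N_def)
    finally show ?thesis using \<eta> by simp
  qed
  have lin: "\<bar>X * hy e - Y * hx e\<bar> \<le> B * L e" if "\<bar>X\<bar> \<le> B" "\<bar>Y\<bar> \<le> B" for X Y B e
  proof -
    have "\<bar>X * hy e - Y * hx e\<bar> \<le> \<bar>X\<bar> * \<bar>hy e\<bar> + \<bar>Y\<bar> * \<bar>hx e\<bar>"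
      by (simp add: abs_triangle_ineq4 flip: abs_mult)
    also have "\<dots> \<le> B * \<bar>hy e\<bar> + B * \<bar>hx e\<bar>"
      using that by (intro add_mono mult_right_mono) auto
    also have "\<dots> \<le> B * L e" using that by (simp add: L_def algebra_simps)
    finally show ?thesis .
  qed
  have near_sgn: "sgn (X * hy e - Y * hx e) = sgn (zc e)" if "near X Y" "e \<in> E" for X Y e
  proof -
    have "\<bar>(X - \<eta> * z1) * hy e - (Y - \<eta> * z2) * hx e\<bar> \<le> \<delta> * L e"
      using that(1) by (intro lin) (auto simp: near_def)
    also have "\<dots> < \<eta> * \<bar>zc e\<bar>" using d(3)[OF that(2)] \<eta> by (simp add: \<delta>_def)
    also have "\<dots> = \<bar>\<eta> * zc e\<bar>" using \<eta> by (simp add: abs_mult)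
    finally have "\<bar>(X * hy e - Y * hx e) - \<eta> * zc e\<bar> < \<bar>\<eta> * zc e\<bar>"
      by (simp add: zc_def algebra_simps)
    then have "sgn (X * hy e - Y * hx e) = sgn (\<eta> * zc e)"
      by (auto simp: sgn_if abs_if split: if_splits)
    then show ?thesis using \<eta> by (simp add: sgn_mult)
  qed
  have near_bound: "\<bar>X * hy e - Y * hx e\<bar> < \<bar>cr e f\<bar>" if "near X Y" "e \<in> E" "f \<in> E" "cr e f \<noteq> 0" for X Y e f
  proof -
    have "\<bar>X * hy e - Y * hx e\<bar> \<le> \<epsilon>1 * L e"
      using that(1) small by (intro lin) (auto simp: near_def less_imp_le)
    then show ?thesis using \<epsilon>1(4)[OF that(2-4)] by simp
  qed
  obtain A a where A: "periodic A" "\<And>x. (A has_real_derivative a x) (at x)" "\<And>x. 0 \<le> A x" "0 < A (\<eta> * z1)"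
      "\<And>x. A x \<noteq> 0 \<Longrightarrow> \<exists>k::int. \<bar>x - of_int k - \<eta> * z1\<bar> < \<delta>"
    using periodic_bump[OF \<delta>(1) \<delta>2, of "\<eta> * z1"] by blast
  obtain B b where B: "periodic B" "\<And>x. (B has_real_derivative b x) (at x)" "continuous_on UNIV b"
      "\<And>x. 0 \<le> B x" "0 < B (\<eta> * z2)"
      "\<And>x. B x \<noteq> 0 \<Longrightarrow> \<exists>k::int. \<bar>x - of_int k - \<eta> * z2\<bar> < \<delta>"
    using periodic_bump[OF \<delta>(1) \<delta>2, of "\<eta> * z2"] by blast
  have cA: "continuous_on UNIV A" and cB: "continuous_on UNIV B"
    using A(2) B(2) DERIV_isCont continuous_at_imp_continuous_on by blast+
  have [measurable]: "A \<in> borel_measurable borel" "B \<in> borel_measurable borel"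
    using cA cB borel_measurable_continuous_onI by blast+
  define A0 where "A0 X = (if \<bar>X - \<eta> * z1\<bar> < \<delta> then ennreal (A X) else 0)" for X
  define B0 where "B0 Y = (if \<bar>Y - \<eta> * z2\<bar> < \<delta> then ennreal (B Y) else 0)" for Y
  have [measurable]: "A0 \<in> borel_measurable borel" "B0 \<in> borel_measurable borel"
    unfolding A0_def[abs_def] B0_def[abs_def] by measurable
  \<comment> \<open>The mass of one copy of the bump, as an extended real. Its finiteness is read
    off below from a finite value of \<open>I\<close>.\<close>
  define M where "M = (\<integral>\<^sup>+x. A0 x \<partial>lborel) * (\<integral>\<^sup>+x. B0 x \<partial>lborel)"
  have pos: "(\<integral>\<^sup>+x. g0 x \<partial>lborel) \<noteq> 0"
    if g0: "\<And>x. g0 x = (if \<bar>x - x0\<bar> < \<delta> then ennreal (g x) else 0)" and g: "continuous_on UNIV g" "0 < g x0"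
    for g0 g and x0 :: real
  proof
    have [measurable]: "g \<in> borel_measurable borel" using g(1) by (rule borel_measurable_continuous_onI)
    have "g0 = (\<lambda>x. if \<bar>x - x0\<bar> < \<delta> then ennreal (g x) else 0)" using g0 by auto
    then have [measurable]: "g0 \<in> borel_measurable borel" by simp
    assume "(\<integral>\<^sup>+x. g0 x \<partial>lborel) = 0"
    then have "AE x in lborel. g0 x = 0" by (subst (asm) nn_integral_0_iff_AE) auto
    then have "{x. g0 x \<noteq> 0} \<in> null_sets lborel" by (subst (asm) AE_iff_null) auto
    then have "negligible {x. g0 x \<noteq> 0}"
      by (simp add: negligible_iff_null_sets null_sets_completionI)
    moreover have "{x. g0 x \<noteq> 0} = {x. \<bar>x - x0\<bar> < \<delta>} \<inter> {x. 0 < g x}"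
      by (auto simp: g0 ennreal_eq_0_iff not_le)
    moreover have "open ({x. \<bar>x - x0\<bar> < \<delta>} \<inter> {x. 0 < g x})"
      using g(1) by (intro open_Int open_Collect_less continuous_intros)
    moreover have "x0 \<in> {x. \<bar>x - x0\<bar> < \<delta>} \<inter> {x. 0 < g x}" using g \<delta> by auto
    ultimately show False using open_not_negligible by (metis empty_iff)
  qed
  have M0: "M \<noteq> 0"
    using pos[OF A0_def cA A(4)] pos[OF B0_def cB B(5)] by (simp add: M_def)
  define cond where "cond e f \<longleftrightarrow> vt e = vt f \<and> cr e f \<noteq> 0 \<and> sgn (zc e) = sgn (cr e f) \<and> sgn (zc f) = sgn (cr e f)" for e f
  have supp: "vt e = vt f \<and> near X Y"
    if H: "e \<in> E" "f \<in> E" "cr e f \<noteq> 0" "s \<in> {0..1}" "t \<in> {0..1}" "A X * B Y \<noteq> 0"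
      "X = x e - x f + s * hx e - t * hx f" "Y = y e - y f + s * hy e - t * hy f" for e f s t X Y
  proof -
    obtain k l :: int where kl: "\<bar>X - of_int k - \<eta> * z1\<bar> < \<delta>" "\<bar>Y - of_int l - \<eta> * z2\<bar> < \<delta>"
      using A(5) B(6) H(6) by fastforce
    then have "\<bar>X - of_int k\<bar> < \<epsilon>" "\<bar>Y - of_int l\<bar> < \<epsilon>"
      using small[of "X - of_int k" z1] small[of "Y - of_int l" z2] \<epsilon>1 by auto
    then have "vt e = vt f \<and> k = 0 \<and> l = 0"
      using sep[OF H(1-5)] unfolding H(7,8) by blast
    then show ?thesis using kl by (simp add: near_def)
  qed
  have main: "ennreal (I A B e f) = (if cond e f then ennreal (1 / \<bar>cr e f\<bar>) * M else 0)"
    if e: "e \<in> E" and f: "f \<in> E" and cr: "cr e f \<noteq> 0" for e f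
  proof -
    let ?X = "\<lambda>s t. x e - x f + s * hx e - t * hx f" and ?Y = "\<lambda>s t. y e - y f + s * hy e - t * hy f"
    have pt: "ennreal (A (?X s t) * B (?Y s t)) * indicator {0..1} t * indicator {0..1} s
        = (if cond e f then A0 (s * hx e - t * hx f) * B0 (s * hy e - t * hy f) else 0)" for s t
    proof (cases "vt e = vt f")
      case False
      then have "A (?X s t) * B (?Y s t) = 0" if "s \<in> {0..1}" "t \<in> {0..1}"
        using supp[OF e f cr that] by blast
      then show ?thesis using False by (auto simp: cond_def indicator_def)
    next
      case True
      then have XY: "?X s t = s * hx e - t * hx f" "?Y s t = s * hy e - t * hy f"
        using same[OF e f] by auto
      define X Y where "X = s * hx e - t * hx f" and "Y = s * hy e - t * hy f"
      \<comment> \<open>Cramer's rule. The signs of \<open>s\<close> and \<open>t\<close> are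
        decided by the side of z on which the segments lie, so the cone condition becomes
        \<open>0 \<le> s\<close> and \<open>0 \<le> t\<close>.\<close>
      have s: "s * cr e f = X * hy f - Y * hx f" and t: "t * cr e f = X * hy e - Y * hx e"
        by (simp_all add: X_def Y_def cr_def algebra_simps)
      have near01: "sgn s * sgn (cr e f) = sgn (zc f)" "sgn t * sgn (cr e f) = sgn (zc e)" "\<bar>s\<bar> < 1" "\<bar>t\<bar> < 1"
        if n: "near X Y"
      proof -
        show "sgn s * sgn (cr e f) = sgn (zc f)" "sgn t * sgn (cr e f) = sgn (zc e)"
          using near_sgn[OF n f] near_sgn[OF n e] by (simp_all flip: s t sgn_mult)
        have "cr f e = - cr e f" by (simp add: cr_def)
        then have "cr f e \<noteq> 0" "\<bar>cr f e\<bar> = \<bar>cr e f\<bar>" using cr by simp_all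
        then have "\<bar>s * cr e f\<bar> < 1 * \<bar>cr e f\<bar>" "\<bar>t * cr e f\<bar> < 1 * \<bar>cr e f\<bar>"
          using near_bound[OF n e f cr] near_bound[OF n f e] by (simp_all add: s t)
        then show "\<bar>s\<bar> < 1" "\<bar>t\<bar> < 1" using cr by (simp_all add: abs_mult)
      qed
      have near_pos: "cond e f \<longleftrightarrow> 0 \<le> s \<and> 0 \<le> t" if n: "near X Y"
        using near01[OF n] cr nz[OF e] nz[OF f] True
        by (auto simp: cond_def sgn_if split: if_splits)
      have A0B0: "A0 X * B0 Y = (if near X Y then ennreal (A X * B Y) else 0)"
        using A(3) B(4) by (auto simp: A0_def B0_def near_def ennreal_mult)
      show ?thesis
      proof (cases "near X Y")
        case n: True
        then show ?thesis
          using near_pos[OF n] near01(3,4)[OF n] unfolding XY X_def[symmetric] Y_def[symmetric] A0B0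
          by (auto simp: indicator_def)
      next
        case n: False
        have "A X * B Y = 0" if "s \<in> {0..1}" "t \<in> {0..1}"
          using supp[OF e f cr that _ XY[folded X_def Y_def, symmetric]] n by blast
        then show ?thesis
          using n unfolding XY X_def[symmetric] Y_def[symmetric] A0B0
          by (auto simp: indicator_def)
      qed
    qed
    show ?thesis
      using nn_integral_linear_image[of A0 B0 "hx e" "hy f" "hy e" "hx f"] cr
      unfolding I_eq_nn_integral[OF cA cB A(3) B(4)] pt M_def by (auto simp: cr_def)
  qed
  have zero: "(\<Sum>e\<in>E. \<Sum>f\<in>E. c e * c f * (cr e f)\<^sup>2 * I A B e f) = 0"
    by (rule crossing_sum_zero[OF cA A(1) B(2,3,1) moment])
  show ?thesis
  proof (cases "\<exists>e\<in>E. \<exists>f\<in>E. cond e f")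
    case False
    then show ?thesis by (intro sum.neutral ballI) (auto simp: cond_def)
  next
    case True
    then obtain e0 f0 where 0: "e0 \<in> E" "f0 \<in> E" "cond e0 f0" by blast
    then have "cr e0 f0 \<noteq> 0" by (simp add: cond_def)
    with main[OF 0(1,2) this] 0 have "ennreal (1 / \<bar>cr e0 f0\<bar>) * M < \<infinity>"
      by (metis ennreal_less_top infinity_ennreal_def)
    then have "M < \<infinity>" using \<open>cr e0 f0 \<noteq> 0\<close> by (auto simp: ennreal_mult_less_top less_top ennreal_mult_eq_top_iff)
    then obtain m where m: "M = ennreal m" "m \<ge> 0" by (cases M) auto
    have m0: "m \<noteq> 0" using M0 m by auto
    have "I A B e f = (if cond e f then m / \<bar>cr e f\<bar> else 0)" if "e \<in> E" "f \<in> E" "cr e f \<noteq> 0" for e f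
    proof -
      have "0 \<le> I A B e f"
        by (rule I_nonneg[OF cA cB A(3) B(4)])
      moreover have "ennreal (I A B e f) = ennreal (if cond e f then m / \<bar>cr e f\<bar> else 0)"
        using main[OF that] m by (simp flip: ennreal_mult)
      ultimately show ?thesis using m by (subst (asm) ennreal_inj) auto
    qed
    then have "(\<Sum>e\<in>E. \<Sum>f\<in>E. m * (if cond e f then c e * c f * \<bar>cr e f\<bar> else 0))
      = (\<Sum>e\<in>E. \<Sum>f\<in>E. c e * c f * (cr e f)\<^sup>2 * I A B e f)"
    proof (intro sum.cong refl)
      fix e f assume *: "e \<in> E" "f \<in> E" and I: "\<And>e f. e \<in> E \<Longrightarrow> f \<in> E \<Longrightarrow> cr e f \<noteq> 0 \<Longrightarrow> I A B e f = (if cond e f then m / \<bar>cr e f\<bar> else 0)"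
      have "(cr e f)\<^sup>2 / \<bar>cr e f\<bar> = \<bar>cr e f\<bar>"
        by (cases "cr e f > 0") (auto simp: power2_eq_square)
      then have "c e * c f * (cr e f)\<^sup>2 * (m / \<bar>cr e f\<bar>) = m * (c e * c f * \<bar>cr e f\<bar>)"
        by (metis mult.commute mult.left_commute times_divide_eq_right)
      then show "m * (if cond e f then c e * c f * \<bar>cr e f\<bar> else 0) = c e * c f * (cr e f)\<^sup>2 * I A B e f"
        using I[OF *] by (cases "cr e f = 0") (auto simp: cond_def)
    qed
    then have "m * (\<Sum>e\<in>E. \<Sum>f\<in>E. if cond e f then c e * c f * \<bar>cr e f\<bar> else 0) = 0"
      using zero by (simp add: sum_distrib_left)
    then show ?thesis using m0 by (simp add: cond_def)
  qed
qed

end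

subsection \<open>Stresses of torus packings\<close>

lemma norm_power2_2: "(norm z)\<^sup>2 = (z $ 1)\<^sup>2 + (z $ 2)\<^sup>2" for z :: "real^2"
  by (simp add: norm_vec_def L2_set_def sum_2)

lemma periodic_of_int:
  assumes "\<And>X :: real. H (X + 1) = H X"
  shows "H (X + of_int k) = H X"
proof (induction k rule: int_induct[where k = 0])
  case (step1 i)
  then show ?case using assms[of "X + of_int i"] by (simp add: add.assoc)
next
  case (step2 i)
  then show ?case using assms[of "X + of_int i - 1"] by (simp add: algebra_simps)
qed simp

definition opp :: "nat \<times> nat \<times> (real^2) \<Rightarrow> nat \<times> nat \<times> (real^2)" where
  "opp = (\<lambda>(i, j, v). (j, i, - v))"

abbreviation src :: "nat \<times> nat \<times> (real^2) \<Rightarrow> nat" where "src e \<equiv> fst e"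
abbreviation tgt :: "nat \<times> nat \<times> (real^2) \<Rightarrow> nat" where "tgt e \<equiv> fst (snd e)"
abbreviation shift :: "nat \<times> nat \<times> (real^2) \<Rightarrow> real^2" where "shift e \<equiv> snd (snd e)"

lemma opp_simps [simp]: "src (opp e) = tgt e" "tgt (opp e) = src e" "shift (opp e) = - shift e" "opp (opp e) = e"
  by (auto simp: opp_def split: prod.splits)

locale torus_packing =
  fixes n :: nat and p :: "nat \<Rightarrow> real^2" and r :: "nat \<Rightarrow> real" and a b c :: real
  assumes a: "a > 0" and c: "c > 0" and ac: "a * c = 1"
    and packing: "is_packing (planar_lattice a b c) n p r"
begin

abbreviation \<Lambda> where "\<Lambda> \<equiv> planar_lattice a b c"

definition E where "E = oriented_contacts \<Lambda> n p r"

definition d :: "nat \<times> nat \<times> (real^2) \<Rightarrow> real^2" where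
  "d e = p (src e) - p (tgt e) - shift e"

lemma lattice_iff: "v \<in> \<Lambda> \<longleftrightarrow> (\<exists>k l::int. v $ 1 = of_int k * a + of_int l * b \<and> v $ 2 = of_int l * c)"
  unfolding planar_lattice_def
  by (simp add: vec_eq_iff forall_2)

lemma lattice_uminus: "v \<in> \<Lambda> \<Longrightarrow> - v \<in> \<Lambda>"
proof -
  assume "v \<in> \<Lambda>"
  then obtain k l :: int where "v $ 1 = of_int k * a + of_int l * b \<and> v $ 2 = of_int l * c"
    by (auto simp: lattice_iff)
  then show "- v \<in> \<Lambda>" unfolding lattice_iff
    by (intro exI[of _ "- k"] exI[of _ "- l"]) auto
qed

lemma lattice_diff: "v \<in> \<Lambda> \<Longrightarrow> w \<in> \<Lambda> \<Longrightarrow> v - w \<in> \<Lambda>"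
proof -
  assume "v \<in> \<Lambda>" "w \<in> \<Lambda>"
  then obtain k l k' l' :: int where "v $ 1 = of_int k * a + of_int l * b \<and> v $ 2 = of_int l * c"
    "w $ 1 = of_int k' * a + of_int l' * b \<and> w $ 2 = of_int l' * c"
    by (auto simp: lattice_iff)
  then show "v - w \<in> \<Lambda>" unfolding lattice_iff
    by (intro exI[of _ "k - k'"] exI[of _ "l - l'"]) (auto simp: algebra_simps)
qed

lemma r_pos: "i \<in> {1..n} \<Longrightarrow> r i > 0"
  using packing by (auto simp: is_packing_def)

lemma packing_dist:
  "i \<in> {1..n} \<Longrightarrow> j \<in> {1..n} \<Longrightarrow> v \<in> \<Lambda> \<Longrightarrow> (i = j \<Longrightarrow> v \<noteq> 0) \<Longrightarrow> norm (p i - p j - v) \<ge> r i + r j"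
  using packing by (auto simp: is_packing_def)

lemma finE: "finite E"
  unfolding E_def by (rule finite_contacts(1)[OF a c])

lemma E_iff: "e \<in> E \<longleftrightarrow> src e \<in> {1..n} \<and> tgt e \<in> {1..n} \<and> shift e \<in> \<Lambda> \<and> (src e = tgt e \<longrightarrow> shift e \<noteq> 0) \<and>
    norm (d e) = r (src e) + r (tgt e)"
  by (cases e) (auto simp: E_def oriented_contacts_def d_def)

lemma d_opp: "d (opp e) = - d e"
  by (simp add: d_def)

lemma opp_E: "e \<in> E \<Longrightarrow> opp e \<in> E"
  using lattice_uminus by (auto simp: E_iff d_opp)

lemma sum_opp: "(\<Sum>e\<in>E. f (opp e)) = (\<Sum>e\<in>E. f e)"
  by (rule sum.reindex_bij_witness[of _ opp opp]) (auto simp: opp_E)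

lemma sum_antisymmetric: "(\<And>e. e \<in> E \<Longrightarrow> f (opp e) = - f e) \<Longrightarrow> (\<Sum>e\<in>E. f e) = (0::real)"
  using sum_opp[of f] by (simp add: sum_negf)

lemma sum_by_src: "(\<Sum>e\<in>E. f e) = (\<Sum>k\<in>{1..n}. \<Sum>e\<in>{e\<in>E. src e = k}. f e)"
  by (rule sum.group[symmetric]) (use finE in \<open>auto simp: E_iff\<close>)

text \<open>Coordinates with respect to the lattice basis: as \<open>a * c = 1\<close>,
  \<open>X\<close> and \<open>Y\<close> are the rows of the inverse matrix. They map the lattice to
  Z^2 and preserve cross products, but not lengths.\<close>

definition X :: "real^2 \<Rightarrow> real" where "X z = c * z $ 1 - b * z $ 2"
definition Y :: "real^2 \<Rightarrow> real" where "Y z = a * z $ 2"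

lemma XY_linear: "X (u + v) = X u + X v" "X (u - v) = X u - X v" "X (s *\<^sub>R v) = s * X v"
  "Y (u + v) = Y u + Y v" "Y (u - v) = Y u - Y v" "Y (s *\<^sub>R v) = s * Y v"
  by (simp_all add: X_def Y_def algebra_simps)

lemma inverse_XY: "z $ 1 = a * X z + b * Y z" "z $ 2 = c * Y z"
proof -
  have "(a * c) * z $ 1 = z $ 1" "(a * c) * z $ 2 = z $ 2" using ac by simp_all
  then show "z $ 1 = a * X z + b * Y z" "z $ 2 = c * Y z"
    by (simp_all add: X_def Y_def algebra_simps)
qed

lemma lattice_XY: "v \<in> \<Lambda> \<longleftrightarrow> (\<exists>k l::int. X v = of_int k \<and> Y v = of_int l)"
proof
  assume "v \<in> \<Lambda>"
  then obtain k l :: int where "v $ 1 = of_int k * a + of_int l * b \<and> v $ 2 = of_int l * c"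
    by (auto simp: lattice_iff)
  then have "X v = of_int k * (a * c) \<and> Y v = of_int l * (a * c)"
    by (simp add: X_def Y_def algebra_simps)
  then show "\<exists>k l::int. X v = of_int k \<and> Y v = of_int l" using ac by auto
next
  assume "\<exists>k l::int. X v = of_int k \<and> Y v = of_int l"
  then obtain k l :: int where kl: "X v = of_int k" "Y v = of_int l" by blast
  have "v $ 1 = a * of_int k + b * of_int l" "v $ 2 = c * of_int l"
    using inverse_XY[of v] kl by simp_all
  then show "v \<in> \<Lambda>" unfolding lattice_iff
    by (intro exI[of _ k] exI[of _ l]) (auto simp: mult.commute)
qed

lemma cross_XY: "X u * Y v - Y u * X v = u $ 1 * v $ 2 - u $ 2 * v $ 1"
proof -
  have "X u * Y v - Y u * X v = (a * c) * (u $ 1 * v $ 2 - u $ 2 * v $ 1)"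
    by (simp add: X_def Y_def algebra_simps)
  then show ?thesis using ac by simp
qed

end

text \<open>\<open>moment11\<close> and \<open>moment12\<close> form the first row of the second
  moment, which makes its determinant vanish.\<close>

locale torus_stress = torus_packing +
  fixes \<omega> :: "nat \<times> nat \<times> (real^2) \<Rightarrow> real"
  assumes sym: "\<And>e. e \<in> E \<Longrightarrow> \<omega> (opp e) = \<omega> e"
    and vertex: "\<And>k. k \<in> {1..n} \<Longrightarrow> (\<Sum>e\<in>{e\<in>E. src e = k}. \<omega> e *\<^sub>R d e) = 0"
    and radii: "\<And>k. k \<in> {1..n} \<Longrightarrow> (\<Sum>e\<in>{e\<in>E. src e = k}. \<omega> e * (r (src e) + r (tgt e))) = 0"
    and moment11: "(\<Sum>e\<in>E. \<omega> e * (d e $ 1)\<^sup>2) = 0"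
    and moment12: "(\<Sum>e\<in>E. \<omega> e * (d e $ 1 * d e $ 2)) = 0"
begin

text \<open>Each contact is split at the point of tangency into two radii. The radius belonging to
  \<open>e\<close> is the vector \<open>h e\<close>; it carries the coefficient \<open>C e\<close>, so that \<open>C e * h e\<close> is
  the force \<open>- \<omega> e * d e\<close>.\<close>

definition h :: "nat \<times> nat \<times> (real^2) \<Rightarrow> real^2" where
  "h e = (- r (src e) / (r (src e) + r (tgt e))) *\<^sub>R d e"

definition C :: "nat \<times> nat \<times> (real^2) \<Rightarrow> real" where
  "C e = \<omega> e * (r (src e) + r (tgt e)) / r (src e)"

lemma pos: "e \<in> E \<Longrightarrow> r (src e) > 0 \<and> r (tgt e) > 0"
  using r_pos by (auto simp: E_iff)

lemma C_h: "e \<in> E \<Longrightarrow> C e * h e $ m = - \<omega> e * d e $ m"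
  using pos[of e] by (simp add: C_def h_def)

lemma norm_h: "e \<in> E \<Longrightarrow> norm (h e) = r (src e)"
  using pos[of e] by (simp add: h_def E_iff)

lemma norm2_h: "e \<in> E \<Longrightarrow> (h e $ 1)\<^sup>2 + (h e $ 2)\<^sup>2 = (r (src e))\<^sup>2"
  by (simp add: norm_h flip: norm_power2_2)

text \<open>Two neighbours touching a disk in the same point would have their centres on one ray, at
  a distance given by the difference of their radii. That is less than the sum, so the neighbours
  coincide.\<close>

lemma h_distinct:
  assumes e: "e \<in> E" and f: "f \<in> E" and src: "src e = src f" and h: "h e = h f"
  shows "e = f"
proof -
  define \<rho> where "\<rho> = r (src e)"
  have \<rho>: "\<rho> > 0" using pos[OF e] by (simp add: \<rho>_def)
  have d: "d g = (- (r (src g) + r (tgt g)) / r (src g)) *\<^sub>R h g" if "g \<in> E" for g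
  proof -
    have "(- x / y) * (- y / x) = 1" if "x \<noteq> 0" "y \<noteq> 0" for x y :: real using that by simp
    from this[of "r (src g) + r (tgt g)" "r (src g)"]
    have "(- (r (src g) + r (tgt g)) / r (src g)) * (- r (src g) / (r (src g) + r (tgt g))) = 1"
      using pos[OF that] by simp
    then show ?thesis unfolding h_def scaleR_scaleR by (simp only: scaleR_one)
  qed
  have "p (tgt f) - p (tgt e) - (shift e - shift f) = d e - d f"
    using src by (simp add: d_def)
  also have "\<dots> = ((r (tgt f) - r (tgt e)) / \<rho>) *\<^sub>R h e"
    unfolding d[OF e] d[OF f] h[symmetric] using src
    by (simp add: \<rho>_def diff_divide_distrib add_divide_distrib algebra_simps flip: scaleR_diff_left)
  finally have "norm (p (tgt f) - p (tgt e) - (shift e - shift f)) = \<bar>r (tgt f) - r (tgt e)\<bar>"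
    using norm_h[OF e] \<rho> by (simp add: \<rho>_def)
  also have "\<dots> < r (tgt f) + r (tgt e)" using pos[OF e] pos[OF f] by auto
  finally have "\<not> (tgt f = tgt e \<longrightarrow> shift e - shift f \<noteq> 0)"
    using packing_dist[of "tgt f" "tgt e" "shift e - shift f"] e f lattice_diff by (fastforce simp: E_iff)
  then show ?thesis using src by (simp add: prod_eq_iff)
qed

text \<open>Segments start at centres, where the stress is in equilibrium, and end at points of
  tangency, where \<open>e\<close> and \<open>opp e\<close> meet modulo the lattice with opposite
  forces.\<close>

lemma sum_force_zero:
  fixes H :: "real \<Rightarrow> real \<Rightarrow> real" and \<phi> :: "real^2 \<Rightarrow> real"
  assumes H: "\<And>X Y. H (X + 1) Y = H X Y" "\<And>X Y. H X (Y + 1) = H X Y"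
    and lin: "\<phi> = X \<or> \<phi> = Y"
  shows "(\<Sum>e\<in>E. C e * \<phi> (h e) * (H (X (p (src e)) + X (h e)) (Y (p (src e)) + Y (h e)) - H (X (p (src e))) (Y (p (src e))))) = 0"
proof -
  have Ch: "C e * \<phi> (h e) = - (\<omega> e * \<phi> (d e))" if "e \<in> E" for e
    using C_h[OF that, of 1] C_h[OF that, of 2] lin by (auto simp: X_def Y_def algebra_simps)
  have \<phi>0: "(\<Sum>e\<in>{e\<in>E. src e = k}. \<omega> e * \<phi> (d e)) = 0" if "k \<in> {1..n}" for k
  proof -
    have "linear \<phi>" using lin by (auto intro!: linearI simp: XY_linear)
    then have "(\<Sum>e\<in>{e\<in>E. src e = k}. \<omega> e * \<phi> (d e)) = \<phi> (\<Sum>e\<in>{e\<in>E. src e = k}. \<omega> e *\<^sub>R d e)"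
      by (simp add: linear_sum linear_scale)
    then show ?thesis using vertex[OF that] linear_0[OF \<open>linear \<phi>\<close>] by simp
  qed
  have start: "(\<Sum>e\<in>E. \<omega> e * \<phi> (d e) * H (X (p (src e))) (Y (p (src e)))) = 0"
    unfolding sum_by_src
  proof (rule sum.neutral, rule ballI)
    fix k assume k: "k \<in> {1..n}"
    have "(\<Sum>e\<in>{e\<in>E. src e = k}. \<omega> e * \<phi> (d e) * H (X (p (src e))) (Y (p (src e))))
      = (\<Sum>e\<in>{e\<in>E. src e = k}. \<omega> e * \<phi> (d e)) * H (X (p k)) (Y (p k))"
      unfolding sum_distrib_right by (intro sum.cong) auto
    then show "(\<Sum>e\<in>{e\<in>E. src e = k}. \<omega> e * \<phi> (d e) * H (X (p (src e))) (Y (p (src e)))) = 0"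
      using \<phi>0[OF k] by simp
  qed
  have finish: "(\<Sum>e\<in>E. \<omega> e * \<phi> (d e) * H (X (p (src e)) + X (h e)) (Y (p (src e)) + Y (h e))) = 0"
  proof (rule sum_antisymmetric)
    fix e assume e: "e \<in> E"
    have hd: "h (opp e) = h e + d e"
    proof -
      have "r (tgt e) / (r (src e) + r (tgt e)) = 1 - r (src e) / (r (src e) + r (tgt e))"
        using pos[OF e] by (simp add: field_simps)
      then have "(r (tgt e) / (r (src e) + r (tgt e))) *\<^sub>R d e = d e - (r (src e) / (r (src e) + r (tgt e))) *\<^sub>R d e"
        by (simp only: scaleR_diff_left scaleR_one)
      then show ?thesis by (simp add: h_def d_opp add.commute)
    qed
    then have pt: "p (tgt e) + h (opp e) = p (src e) + h e - shift e" by (simp add: d_def)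
    obtain k l :: int where kl: "X (shift e) = of_int k" "Y (shift e) = of_int l"
      using e lattice_XY by (auto simp: E_iff)
    have "X (p (src (opp e))) + X (h (opp e)) = X (p (src e)) + X (h e) + of_int (- k)"
      "Y (p (src (opp e))) + Y (h (opp e)) = Y (p (src e)) + Y (h e) + of_int (- l)"
      using arg_cong[OF pt, of X] arg_cong[OF pt, of Y] kl by (simp_all add: XY_linear)
    then have "H (X (p (src (opp e))) + X (h (opp e))) (Y (p (src (opp e))) + Y (h (opp e)))
      = H (X (p (src e)) + X (h e)) (Y (p (src e)) + Y (h e))"
      using periodic_of_int[of "\<lambda>x. H x _", OF H(1)] periodic_of_int[of "\<lambda>y. H _ y", OF H(2)]
      by (simp only:)
    moreover have "\<phi> (d (opp e)) = - \<phi> (d e)" using lin by (auto simp: d_opp X_def Y_def)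
    ultimately show "\<omega> (opp e) * \<phi> (d (opp e)) * H (X (p (src (opp e))) + X (h (opp e))) (Y (p (src (opp e))) + Y (h (opp e)))
      = - (\<omega> e * \<phi> (d e) * H (X (p (src e)) + X (h e)) (Y (p (src e)) + Y (h e)))"
      using sym[OF e] by simp
  qed
  have "(\<Sum>e\<in>E. C e * \<phi> (h e) * (H (X (p (src e)) + X (h e)) (Y (p (src e)) + Y (h e)) - H (X (p (src e))) (Y (p (src e)))))
    = (\<Sum>e\<in>E. \<omega> e * \<phi> (d e) * H (X (p (src e))) (Y (p (src e))))
    - (\<Sum>e\<in>E. \<omega> e * \<phi> (d e) * H (X (p (src e)) + X (h e)) (Y (p (src e)) + Y (h e)))"
    unfolding sum_subtractf[symmetric] by (intro sum.cong) (auto simp: Ch algebra_simps)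
  then show ?thesis using start finish by simp
qed

sublocale segs: torus_segments E "\<lambda>e. X (h e)" "\<lambda>e. Y (h e)" "\<lambda>e. X (p (src e))" "\<lambda>e. Y (p (src e))" C
proof
  show "finite E" by (rule finE)
  fix H :: "real \<Rightarrow> real \<Rightarrow> real"
  assume H: "\<And>X Y. H (X + 1) Y = H X Y" "\<And>X Y. H X (Y + 1) = H X Y"
  show "(\<Sum>e\<in>E. C e * X (h e) * (H (X (p (src e)) + X (h e)) (Y (p (src e)) + Y (h e)) - H (X (p (src e))) (Y (p (src e))))) = 0 \<and>
    (\<Sum>e\<in>E. C e * Y (h e) * (H (X (p (src e)) + X (h e)) (Y (p (src e)) + Y (h e)) - H (X (p (src e))) (Y (p (src e))))) = 0"
    using sum_force_zero[of H X, OF H] sum_force_zero[of H Y, OF H] by simp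
qed

lemma cr_eq: "segs.cr e f = h e $ 1 * h f $ 2 - h e $ 2 * h f $ 1"
  by (simp add: segs.cr_def cross_XY)

text \<open>The two radii of a contact receive shares that add up to 1, so twice the left side is
  \<open>\<Sum> \<omega> e * g e\<close>. This carries the moment conditions from contacts to
  radii.\<close>

lemma half_moment:
  assumes g: "\<And>e. g (opp e) = g e" and 0: "(\<Sum>e\<in>E. \<omega> e * g e) = 0"
  shows "(\<Sum>e\<in>E. \<omega> e * r (src e) / (r (src e) + r (tgt e)) * g e) = 0"
proof -
  have "(\<Sum>e\<in>E. \<omega> e * r (src e) / (r (src e) + r (tgt e)) * g e)
     + (\<Sum>e\<in>E. \<omega> e * r (src e) / (r (src e) + r (tgt e)) * g e)
     = (\<Sum>e\<in>E. \<omega> e * r (src e) / (r (src e) + r (tgt e)) * g e)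
     + (\<Sum>e\<in>E. \<omega> (opp e) * r (src (opp e)) / (r (src (opp e)) + r (tgt (opp e))) * g (opp e))"
    using sum_opp[of "\<lambda>e. \<omega> e * r (src e) / (r (src e) + r (tgt e)) * g e"] by simp
  also have "\<dots> = (\<Sum>e\<in>E. \<omega> e * g e)"
    unfolding sum.distrib[symmetric]
  proof (intro sum.cong refl)
    fix e assume e: "e \<in> E"
    have "r (src e) + r (tgt e) \<noteq> 0" using pos[OF e] by simp
    then have "r (src e) / (r (src e) + r (tgt e)) + r (tgt e) / (r (src e) + r (tgt e)) = 1"
      by (simp flip: add_divide_distrib)
    then have "\<omega> e * g e * (r (src e) / (r (src e) + r (tgt e)) + r (tgt e) / (r (src e) + r (tgt e))) = \<omega> e * g e"
      by simp
    then show "\<omega> e * r (src e) / (r (src e) + r (tgt e)) * g e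
      + \<omega> (opp e) * r (src (opp e)) / (r (src (opp e)) + r (tgt (opp e))) * g (opp e) = \<omega> e * g e"
      by (simp add: sym[OF e] g algebra_simps)
  qed
  finally show ?thesis using 0 by simp
qed

text \<open>The Cauchy-Binet identity: the double sum is twice the determinant of the second moment
  of the radii \<open>h\<close> with weights \<open>C\<close>.\<close>

lemma moment: "(\<Sum>e\<in>E. \<Sum>f\<in>E. C e * C f * (segs.cr e f)\<^sup>2) = 0"
proof -
  have Ch: "C e * (h e $ m * h e $ k) = \<omega> e * r (src e) / (r (src e) + r (tgt e)) * (d e $ m * d e $ k)"
    if "e \<in> E" for e m k
    using pos[OF that] by (simp add: C_def h_def)
  have S: "(\<Sum>e\<in>E. C e * (h e $ m * h e $ k)) = 0" if "(\<Sum>e\<in>E. \<omega> e * (d e $ m * d e $ k)) = 0" for m k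
    using half_moment[of "\<lambda>e. d e $ m * d e $ k"] that by (simp add: Ch d_opp)
  have S': "(\<Sum>e\<in>E. C e * (h e $ 1 * h e $ 1)) = 0" "(\<Sum>e\<in>E. C e * (h e $ 1 * h e $ 2)) = 0"
    by (rule S, use moment11 moment12 in \<open>simp add: power2_eq_square\<close>)+
  have prod: "(\<Sum>e\<in>E. \<Sum>f\<in>E. k * (u e * v f)) = k * ((\<Sum>e\<in>E. u e) * (\<Sum>f\<in>E. v f))"
    for k and u v :: "nat \<times> nat \<times> (real^2) \<Rightarrow> real"
    by (subst sum_product) (simp only: sum_distrib_left)
  have "C e * C f * (segs.cr e f)\<^sup>2
    = 1 * ((C e * (h e $ 1 * h e $ 1)) * (C f * (h f $ 2 * h f $ 2)))
    - 2 * ((C e * (h e $ 1 * h e $ 2)) * (C f * (h f $ 1 * h f $ 2)))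
    + 1 * ((C e * (h e $ 2 * h e $ 2)) * (C f * (h f $ 1 * h f $ 1)))" for e f
    by (simp add: cr_eq power2_eq_square algebra_simps)
  then show ?thesis by (simp only: sum.distrib sum_subtractf prod S')
qed

text \<open>Radii of different disks meet only in a point of tangency, where they are collinear.\<close>

lemma radii_disjoint:
  assumes e: "e \<in> E" and f: "f \<in> E" and cr: "segs.cr e f \<noteq> 0" and st: "s \<in> {0..1}" "t \<in> {0..1}"
    and v: "p (src e) - p (src f) + s *\<^sub>R h e - t *\<^sub>R h f = v" "v \<in> \<Lambda>"
  shows "src e = src f \<and> v = 0"
proof (rule ccontr)
  assume "\<not> (src e = src f \<and> v = 0)"
  then have ge: "norm (p (src e) - p (src f) - v) \<ge> r (src e) + r (src f)"
    using packing_dist[of "src e" "src f" v] e f v(2) by (auto simp: E_iff)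
  have eq: "p (src e) - p (src f) - v = t *\<^sub>R h f - s *\<^sub>R h e" using v(1) by (simp add: algebra_simps)
  \<comment> \<open>Lagrange's identity makes Cauchy-Schwarz strict for radii that are not parallel,
    so their points stay closer than the sum of the two radii.\<close>
  define D where "D = h e $ 1 * h f $ 1 + h e $ 2 * h f $ 2"
  let ?ri = "r (src e)" and ?rj = "r (src f)"
  have rp: "?ri > 0" "?rj > 0" using pos[OF e] pos[OF f] by auto
  have "D\<^sup>2 + (segs.cr e f)\<^sup>2 = ((h e $ 1)\<^sup>2 + (h e $ 2)\<^sup>2) * ((h f $ 1)\<^sup>2 + (h f $ 2)\<^sup>2)"
    by (simp add: D_def cr_eq power2_eq_square algebra_simps)
  also have "\<dots> = (?ri * ?rj)\<^sup>2" by (simp add: norm2_h e f power_mult_distrib)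
  finally have "D\<^sup>2 < (?ri * ?rj)\<^sup>2"
    using cr by (metis less_add_same_cancel1 zero_less_power2)
  then have D: "\<bar>D\<bar> < ?ri * ?rj"
    using rp by (intro power2_less_imp_less[of "\<bar>D\<bar>"]) auto
  have "(norm (t *\<^sub>R h f - s *\<^sub>R h e))\<^sup>2
     = t\<^sup>2 * ((h f $ 1)\<^sup>2 + (h f $ 2)\<^sup>2) + s\<^sup>2 * ((h e $ 1)\<^sup>2 + (h e $ 2)\<^sup>2) - 2 * (s * t) * D"
    unfolding norm_power2_2 by (simp add: D_def power2_eq_square algebra_simps)
  also have "\<dots> = t\<^sup>2 * ?rj\<^sup>2 + s\<^sup>2 * ?ri\<^sup>2 - 2 * (s * t) * D" by (simp add: norm2_h e f)
  also have "\<dots> \<le> ?rj\<^sup>2 + ?ri\<^sup>2 + 2 * \<bar>D\<bar>"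
  proof -
    have "t\<^sup>2 \<le> 1" "s\<^sup>2 \<le> 1" "s * t \<le> 1" "0 \<le> s * t" using st by (auto simp: power_le_one mult_le_one)
    then have "t\<^sup>2 * ?rj\<^sup>2 \<le> 1 * ?rj\<^sup>2" "s\<^sup>2 * ?ri\<^sup>2 \<le> 1 * ?ri\<^sup>2" "(s * t) * \<bar>D\<bar> \<le> 1 * \<bar>D\<bar>"
      by (intro mult_right_mono; simp)+
    moreover have "- ((s * t) * D) \<le> (s * t) * \<bar>D\<bar>"
      using \<open>0 \<le> s * t\<close> mult_left_mono[of "- D" "\<bar>D\<bar>" "s * t"] by simp
    ultimately show ?thesis by simp
  qed
  also have "?rj\<^sup>2 + ?ri\<^sup>2 + 2 * \<bar>D\<bar> < (?ri + ?rj)\<^sup>2"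
    unfolding power2_sum using D by linarith
  finally have "norm (t *\<^sub>R h f - s *\<^sub>R h e) < ?ri + ?rj"
    by (rule power2_less_imp_less) (use rp in simp)
  then show False using ge eq by simp
qed

text \<open>The differences of points of two radii form a compact set, the forbidden lattice points
  a closed one, and disjointness gives a positive distance.\<close>

lemma separation_pair:
  assumes e: "e \<in> E" and f: "f \<in> E" and cr: "segs.cr e f \<noteq> 0"
  shows "\<exists>\<epsilon>>0. \<forall>s\<in>{0..1}. \<forall>t\<in>{0..1}. \<forall>k l::int.
    \<bar>X (p (src e)) - X (p (src f)) + s * X (h e) - t * X (h f) - of_int k\<bar> < \<epsilon> \<longrightarrow>
    \<bar>Y (p (src e)) - Y (p (src f)) + s * Y (h e) - t * Y (h f) - of_int l\<bar> < \<epsilon> \<longrightarrow> src e = src f \<and> k = 0 \<and> l = 0"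
proof -
  define W where "W = (\<lambda>(s, t). (X (p (src e)) - X (p (src f)) + s * X (h e) - t * X (h f),
     Y (p (src e)) - Y (p (src f)) + s * Y (h e) - t * Y (h f)))"
  \<comment> \<open>For radii of the same disk the origin is removed: there the difference may well
    vanish.\<close>
  define Z :: "(real \<times> real) set" where
    "Z = {(of_int k, of_int l) | k l :: int. \<not> (src e = src f \<and> k = 0 \<and> l = 0)}"
  have "compact (W ` ({0..1} \<times> {0..1}))"
    unfolding W_def case_prod_beta
    by (intro compact_continuous_image compact_Times compact_Icc continuous_intros)
  moreover have "closed Z"
  proof (rule discrete_imp_closed[of 1])
    have int: "i = i'" if "\<bar>of_int i - of_int i'\<bar> < (1::real)" for i i' :: int
      using that by linarith
    have "w = z" if wz: "w \<in> Z" "z \<in> Z" "dist w z < 1" for w z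
    proof -
      obtain k l k' l' :: int where "w = (of_int k, of_int l)" "z = (of_int k', of_int l')"
        using wz unfolding Z_def by blast
      moreover have "\<bar>fst w - fst z\<bar> < 1" "\<bar>snd w - snd z\<bar> < 1"
        using dist_fst_le[of w z] dist_snd_le[of w z] wz(3) by (auto simp: dist_real_def)
      ultimately show ?thesis using int by auto
    qed
    then show "\<forall>x\<in>Z. \<forall>y\<in>Z. dist y x < 1 \<longrightarrow> y = x" by blast
  qed simp
  moreover have "W ` ({0..1} \<times> {0..1}) \<inter> Z = {}"
  proof (rule ccontr)
    assume "W ` ({0..1} \<times> {0..1}) \<inter> Z \<noteq> {}"
    then obtain st where "st \<in> {0..1} \<times> {0..1}" "W st \<in> Z" by blast
    then obtain s t where s: "s \<in> {0..1}" "t \<in> {0..1}" "W (s, t) \<in> Z" by (cases st) blast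
    then obtain k l :: int where "W (s, t) = (of_int k, of_int l)" "\<not> (src e = src f \<and> k = 0 \<and> l = 0)"
      unfolding Z_def by blast
    note st = s(1,2) this
    define v where "v = p (src e) - p (src f) + s *\<^sub>R h e - t *\<^sub>R h f"
    have kl: "X v = of_int k" "Y v = of_int l" using st(3) by (simp_all add: v_def W_def XY_linear)
    then have "src e = src f \<and> v = 0"
      using radii_disjoint[OF e f cr st(1,2) v_def[symmetric]] lattice_XY by blast
    then show False using kl st(4) by (auto simp: X_def Y_def)
  qed
  ultimately obtain \<epsilon> where \<epsilon>: "\<epsilon> > 0" "\<And>w z. w \<in> W ` ({0..1} \<times> {0..1}) \<Longrightarrow> z \<in> Z \<Longrightarrow> \<epsilon> \<le> dist w z"
    using separate_compact_closed[of "W ` ({0..1} \<times> {0..1})" Z] by blast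
  have sep: "src e = src f \<and> k = 0 \<and> l = 0"
    if st: "s \<in> {0..1}" "t \<in> {0..1}"
      "\<bar>X (p (src e)) - X (p (src f)) + s * X (h e) - t * X (h f) - of_int k\<bar> < \<epsilon> / 2"
      "\<bar>Y (p (src e)) - Y (p (src f)) + s * Y (h e) - t * Y (h f) - of_int l\<bar> < \<epsilon> / 2" for s t :: real and k l :: int
  proof -
    have "dist (W (s, t)) (of_int k, of_int l)
      \<le> \<bar>X (p (src e)) - X (p (src f)) + s * X (h e) - t * X (h f) - of_int k\<bar>
      + \<bar>Y (p (src e)) - Y (p (src f)) + s * Y (h e) - t * Y (h f) - of_int l\<bar>"
      unfolding W_def dist_prod_def by (simp add: dist_real_def sqrt_sum_squares_le_sum_abs)
    then have "dist (W (s, t)) (of_int k, of_int l) < \<epsilon>" using st by linarith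
    then have "(of_int k, of_int l) \<notin> Z" using \<epsilon>(2)[of "W (s, t)" "(of_int k, of_int l)"] st by force
    then show ?thesis unfolding Z_def by blast
  qed
  have "\<epsilon> / 2 > 0" using \<epsilon>(1) by simp
  then show ?thesis using sep by blast
qed

lemma separation:
  "\<exists>\<epsilon>>0. \<forall>e\<in>E. \<forall>f\<in>E. segs.cr e f \<noteq> 0 \<longrightarrow> (\<forall>s\<in>{0..1}. \<forall>t\<in>{0..1}. \<forall>k l::int.
    \<bar>X (p (src e)) - X (p (src f)) + s * X (h e) - t * X (h f) - of_int k\<bar> < \<epsilon> \<longrightarrow>
    \<bar>Y (p (src e)) - Y (p (src f)) + s * Y (h e) - t * Y (h f) - of_int l\<bar> < \<epsilon> \<longrightarrow> src e = src f \<and> k = 0 \<and> l = 0)"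
proof -
  define Q where "Q \<epsilon> e f \<longleftrightarrow> (\<forall>s\<in>{0..1}. \<forall>t\<in>{0..1}. \<forall>k l::int.
    \<bar>X (p (src e)) - X (p (src f)) + s * X (h e) - t * X (h f) - of_int k\<bar> < \<epsilon> \<longrightarrow>
    \<bar>Y (p (src e)) - Y (p (src f)) + s * Y (h e) - t * Y (h f) - of_int l\<bar> < \<epsilon> \<longrightarrow> src e = src f \<and> k = 0 \<and> l = 0)"
    for \<epsilon> e f
  define P where "P = {(e, f) \<in> E \<times> E. segs.cr e f \<noteq> 0}"
  have finP: "finite P" unfolding P_def by (rule finite_subset[OF _ finite_cartesian_product[OF finE finE]]) auto
  have "\<forall>ef\<in>P. \<exists>\<epsilon>>0. Q \<epsilon> (fst ef) (snd ef)"
    using separation_pair unfolding P_def Q_def by auto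
  then obtain g where g: "\<And>ef. ef \<in> P \<Longrightarrow> g ef > 0 \<and> Q (g ef) (fst ef) (snd ef)" by metis
  obtain \<epsilon> where \<epsilon>: "\<epsilon> > 0" "\<And>s. s \<in> g ` P \<Longrightarrow> \<epsilon> < s"
    using finite_pos_lower_bound[of "g ` P"] finP g by blast
  have mono: "Q \<epsilon> e f" if "Q \<epsilon>' e f" "\<epsilon> < \<epsilon>'" for \<epsilon>' e f
    using that unfolding Q_def by (meson less_trans)
  have "Q \<epsilon> e f" if "e \<in> E" "f \<in> E" "segs.cr e f \<noteq> 0" for e f
  proof -
    have "(e, f) \<in> P" using that by (simp add: P_def)
    then have "\<epsilon> < g (e, f)" "Q (g (e, f)) e f" using g[of "(e, f)"] \<epsilon>(2) by simp_all
    then show ?thesis using mono by blast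
  qed
  then show ?thesis using \<epsilon>(1) unfolding Q_def by blast
qed

lemma generic_direction: "\<exists>\<tau>::real. \<forall>e\<in>E. 1 * Y (h e) - \<tau> * X (h e) \<noteq> 0"
proof -
  have "infinite (UNIV - (\<lambda>e. Y (h e) / X (h e)) ` E :: real set)"
    using finE by (intro Diff_infinite_finite infinite_UNIV_char_0) auto
  then obtain \<tau> where \<tau>: "\<tau> \<notin> (\<lambda>e. Y (h e) / X (h e)) ` E"
    by (metis Diff_iff finite.emptyI equals0I)
  have "1 * Y (h e) - \<tau> * X (h e) \<noteq> 0" if e: "e \<in> E" for e
  proof
    assume 0: "1 * Y (h e) - \<tau> * X (h e) = 0"
    then have "X (h e) = 0" using \<tau> e by (force simp: field_simps)
    then have "Y (h e) = 0" using 0 by simp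
    then have "h e $ 2 = 0" using a by (simp add: Y_def)
    then have "h e $ 1 = 0" using \<open>X (h e) = 0\<close> c by (simp add: X_def)
    then show False using norm2_h[OF e] \<open>h e $ 2 = 0\<close> pos[OF e] by simp
  qed
  then show ?thesis by blast
qed

theorem stress_zero: "e \<in> E \<Longrightarrow> \<omega> e = 0"
proof -
  obtain \<tau> where \<tau>: "\<And>e. e \<in> E \<Longrightarrow> 1 * Y (h e) - \<tau> * X (h e) \<noteq> 0"
    using generic_direction by blast
  \<comment> \<open>The direction \<open>(1, \<tau>)\<close> in Euclidean coordinates. Crossings are
    counted in lattice coordinates, but the form at a vertex requires vectors of equal
    length.\<close>
  define z1 z2 where "z1 = a + \<tau> * b" and "z2 = \<tau> * c"
  have zc: "1 * Y (h e) - \<tau> * X (h e) = z1 * h e $ 2 - z2 * h e $ 1" for e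
    by (simp add: X_def Y_def z1_def z2_def algebra_simps)
  define q where "q i = (\<Sum>e\<in>{e\<in>E. src e = i}. \<Sum>f\<in>{e\<in>E. src e = i}.
     if segs.cr e f \<noteq> 0 \<and> sgn (z1 * h e $ 2 - z2 * h e $ 1) = sgn (segs.cr e f) \<and>
       sgn (z1 * h f $ 2 - z2 * h f $ 1) = sgn (segs.cr e f)
     then C e * C f * \<bar>segs.cr e f\<bar> else 0)" for i
  obtain \<epsilon> where \<epsilon>: "\<epsilon> > 0" "\<And>e f s t k l. e \<in> E \<Longrightarrow> f \<in> E \<Longrightarrow> segs.cr e f \<noteq> 0 \<Longrightarrow> s \<in> {0..1} \<Longrightarrow> t \<in> {0..1} \<Longrightarrow>
    \<bar>X (p (src e)) - X (p (src f)) + s * X (h e) - t * X (h f) - of_int k\<bar> < \<epsilon> \<Longrightarrow>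
    \<bar>Y (p (src e)) - Y (p (src f)) + s * Y (h e) - t * Y (h f) - of_int l\<bar> < \<epsilon> \<Longrightarrow> src e = src f \<and> k = 0 \<and> l = 0"
    using separation by meson
  have "(\<Sum>e\<in>E. \<Sum>f\<in>E. if src e = src f \<and> segs.cr e f \<noteq> 0 \<and> sgn (1 * Y (h e) - \<tau> * X (h e)) = sgn (segs.cr e f) \<and>
      sgn (1 * Y (h f) - \<tau> * X (h f)) = sgn (segs.cr e f) then C e * C f * \<bar>segs.cr e f\<bar> else 0) = 0"
    by (rule segs.vertex_crossing_sums_cancel[OF moment _ \<epsilon> \<tau>]) auto
  also have "(\<Sum>e\<in>E. \<Sum>f\<in>E. if src e = src f \<and> segs.cr e f \<noteq> 0 \<and> sgn (1 * Y (h e) - \<tau> * X (h e)) = sgn (segs.cr e f) \<and>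
      sgn (1 * Y (h f) - \<tau> * X (h f)) = sgn (segs.cr e f) then C e * C f * \<bar>segs.cr e f\<bar> else 0)
    = (\<Sum>i\<in>{1..n}. q i)"
    unfolding q_def zc
    by (rule trans[OF sum_by_src], intro sum.cong refl sum.mono_neutral_cong_right)
      (use finE in auto)
  finally have sumq: "(\<Sum>i\<in>{1..n}. q i) = 0" .
  have local: "q i \<le> 0" "q i = 0 \<Longrightarrow> e \<in> E \<Longrightarrow> src e = i \<Longrightarrow> C e = 0" if i: "i \<in> {1..n}" for i e
  proof -
    let ?E = "{e\<in>E. src e = i}"
    interpret pv: planar_vectors ?E "\<lambda>e. h e $ 1" "\<lambda>e. h e $ 2"
      by unfold_locales (simp add: finE)
    have cr: "segs.cr e f = pv.cr e f" for e f by (simp add: pv.cr_def cr_eq)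
    have norm: "\<And>e. e \<in> ?E \<Longrightarrow> (h e $ 1)\<^sup>2 + (h e $ 2)\<^sup>2 = (r i)\<^sup>2" using norm2_h by auto
    have dist: "e = f" if "e \<in> ?E" "f \<in> ?E" "h e $ 1 = h f $ 1" "h e $ 2 = h f $ 2" for e f
      using that h_distinct[of e f] by (auto simp: vec_eq_iff forall_2)
    have nz: "\<And>e. e \<in> ?E \<Longrightarrow> z1 * h e $ 2 - z2 * h e $ 1 \<noteq> 0" using \<tau> by (simp flip: zc)
    have "(\<Sum>e\<in>?E. C e) = (\<Sum>e\<in>?E. \<omega> e * (r (src e) + r (tgt e))) / r i"
      unfolding sum_divide_distrib by (intro sum.cong) (auto simp: C_def)
    then have C0: "(\<Sum>e\<in>?E. C e) = 0" using radii[OF i] by simp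
    have eq: "(\<Sum>e\<in>?E. C e * h e $ m) = 0" for m
    proof -
      have "(\<Sum>e\<in>?E. C e * h e $ m) = (\<Sum>e\<in>?E. - (\<omega> e *\<^sub>R d e) $ m)"
        by (intro sum.cong) (auto simp: C_h)
      also have "\<dots> = - ((\<Sum>e\<in>?E. \<omega> e *\<^sub>R d e) $ m)"
        by (simp add: sum_component sum_negf)
      finally show ?thesis using vertex[OF i] by simp
    qed
    note loc = pv.vertex_crossing_sum_nonpos[OF norm dist nz C0 eq eq]
    show "q i \<le> 0" unfolding q_def cr by (rule loc(1))
    show "C e = 0" if "q i = 0" "e \<in> E" "src e = i"
      by (rule loc(2)) (use that(1)[unfolded q_def cr] that(2,3) in simp_all)
  qed
  assume e: "e \<in> E"
  have i: "src e \<in> {1..n}" using e by (simp add: E_iff)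
  have "(\<Sum>i\<in>{1..n}. - q i) = 0" using sumq by (simp add: sum_negf)
  then have "\<forall>i\<in>{1..n}. - q i = 0"
    using local(1) by (subst (asm) sum_nonneg_eq_0_iff) auto
  then have "q (src e) = 0" using i by simp
  then have "C e = 0" using local(2)[OF i] e by blast
  then show "\<omega> e = 0" using pos[OF e] by (auto simp: C_def)
qed

end

section \<open>Jamming and the lower bound on the number of contacts\<close>

context torus_packing
begin

lemma contact_edge_eq: "contact_edge e = {e, opp e}"
  by (cases e) (simp add: contact_edge_def opp_def)

lemma contact_edge_opp: "contact_edge (opp e) = contact_edge e"
  by (simp add: contact_edge_eq insert_commute)

lemma contact_edge_eq_iff: "contact_edge e = contact_edge f \<longleftrightarrow> f = e \<or> f = opp e"
proof
  assume "contact_edge e = contact_edge f"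
  then have "f \<in> {e, opp e}" unfolding contact_edge_eq by blast
  then show "f = e \<or> f = opp e" by simp
next
  assume "f = e \<or> f = opp e"
  then show "contact_edge e = contact_edge f" using contact_edge_opp[of e] by metis
qed

lemma contacts_eq: "contacts \<Lambda> n p r = contact_edge ` E"
  by (simp add: contacts_def E_def)

lemma fin_contacts: "finite (contacts \<Lambda> n p r)"
  using finE by (simp add: contacts_eq)

lemma lattice_bounded_finite: "finite {v \<in> \<Lambda>. norm v \<le> B}"
proof -
  define g where "g v = (\<lfloor>X v\<rfloor>, \<lfloor>Y v\<rfloor>)" for v
  define M where "M = (c + \<bar>b\<bar> + a) * \<bar>B\<bar>"
  have "inj_on g {v \<in> \<Lambda>. norm v \<le> B}"
  proof (rule inj_onI)
    fix v w assume vw: "v \<in> {v \<in> \<Lambda>. norm v \<le> B}" "w \<in> {v \<in> \<Lambda>. norm v \<le> B}" "g v = g w"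
    then have XY: "X v = X w" "Y v = Y w"
      using lattice_XY[of v] lattice_XY[of w] by (auto simp: g_def)
    then have "v $ 2 = w $ 2" using a by (simp add: Y_def)
    moreover from this have "v $ 1 = w $ 1" using XY c by (simp add: X_def)
    ultimately show "v = w" by (simp add: vec_eq_iff forall_2)
  qed
  moreover have "g ` {v \<in> \<Lambda>. norm v \<le> B} \<subseteq> {\<lfloor>- M\<rfloor>..\<lfloor>M\<rfloor>} \<times> {\<lfloor>- M\<rfloor>..\<lfloor>M\<rfloor>}"
  proof (rule image_subsetI)
    fix v assume "v \<in> {v \<in> \<Lambda>. norm v \<le> B}"
    then have v: "v \<in> \<Lambda>" "norm v \<le> B" by auto
    have comp: "\<bar>v $ m\<bar> \<le> \<bar>B\<bar>" for m using component_le_norm_cart[of v m] v by linarith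
    have "\<bar>X v\<bar> \<le> c * \<bar>v $ 1\<bar> + \<bar>b\<bar> * \<bar>v $ 2\<bar>"
      using abs_triangle_ineq4[of "c * v $ 1" "b * v $ 2"] c by (simp add: X_def abs_mult)
    also have "\<dots> \<le> c * \<bar>B\<bar> + \<bar>b\<bar> * \<bar>B\<bar>" using comp c by (intro add_mono mult_left_mono) auto
    also have "\<dots> \<le> M" using a by (simp add: M_def distrib_right)
    finally have 1: "\<bar>X v\<bar> \<le> M" .
    have "\<bar>Y v\<bar> \<le> a * \<bar>B\<bar>" using comp a by (simp add: Y_def abs_mult)
    also have "\<dots> \<le> M" using c by (simp add: M_def distrib_right)
    finally have "\<bar>Y v\<bar> \<le> M" .
    with 1 show "g v \<in> {\<lfloor>- M\<rfloor>..\<lfloor>M\<rfloor>} \<times> {\<lfloor>- M\<rfloor>..\<lfloor>M\<rfloor>}"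
      unfolding g_def by (auto intro!: floor_mono)
  qed
  ultimately show ?thesis by (rule inj_on_finite) auto
qed

text \<open>There are infinitely many pairs, but only finitely many have a gap of at most 1; these
  have a least gap.\<close>

lemma noncontact_gap:
  "\<exists>\<eta>>0. \<forall>i\<in>{1..n}. \<forall>j\<in>{1..n}. \<forall>v\<in>\<Lambda>. (i = j \<longrightarrow> v \<noteq> 0) \<longrightarrow> (i, j, v) \<notin> E \<longrightarrow>
     norm (p i - p j - v) \<ge> r i + r j + \<eta>"
proof -
  define g where "g = (\<lambda>(i, j, v). norm (p i - p j - v) - (r i + r j))"
  define T where "T = {(i, j, v). i \<in> {1..n} \<and> j \<in> {1..n} \<and> v \<in> \<Lambda> \<and> (i = j \<longrightarrow> v \<noteq> 0) \<and> (i, j, v) \<notin> E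
     \<and> g (i, j, v) \<le> 1}"
  have "T \<subseteq> (\<Union>i\<in>{1..n}. \<Union>j\<in>{1..n}. (\<lambda>v. (i, j, v)) ` {v \<in> \<Lambda>. norm v \<le> norm (p i - p j) + (r i + r j) + 1})"
  proof -
    have "norm v \<le> norm (p i - p j) + (r i + r j) + 1" if "norm (p i - p j - v) - (r i + r j) \<le> 1" for i j v
      using that norm_triangle_ineq4[of "p i - p j" "p i - p j - v"] by simp
    then show ?thesis by (fastforce simp: T_def g_def)
  qed
  then have "finite T" by (rule finite_subset) (use lattice_bounded_finite in auto)
  moreover have "g t > 0" if "t \<in> T" for t
  proof -
    obtain i j v where ijv: "t = (i, j, v)" by (cases t)
    then have 1: "i \<in> {1..n}" "j \<in> {1..n}" "v \<in> \<Lambda>" "i = j \<Longrightarrow> v \<noteq> 0" "(i, j, v) \<notin> E"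
      using that by (auto simp: T_def)
    then have "norm (p i - p j - v) \<noteq> r i + r j" by (auto simp: E_iff d_def)
    then show ?thesis using packing_dist[OF 1(1-4)] by (simp add: g_def ijv)
  qed
  ultimately have "\<exists>\<eta>>0. \<forall>s\<in>insert 1 (g ` T). \<eta> < s" by (intro finite_pos_lower_bound) auto
  then obtain \<eta> where \<eta>: "\<eta> > 0" "\<eta> < 1" "\<And>t. t \<in> T \<Longrightarrow> \<eta> < g t" by auto
  have "norm (p i - p j - v) \<ge> r i + r j + \<eta>"
    if "i \<in> {1..n}" "j \<in> {1..n}" "v \<in> \<Lambda>" "i = j \<longrightarrow> v \<noteq> 0" "(i, j, v) \<notin> E" for i j v
  proof (cases "(i, j, v) \<in> T")
    case True
    then show ?thesis using \<eta>(3)[OF True] by (simp add: g_def)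
  next
    case False
    then have "g (i, j, v) > 1" using that by (auto simp: T_def)
    then show ?thesis using \<eta> by (simp add: g_def)
  qed
  then show ?thesis using \<eta>(1) by blast
qed

text \<open>Moving along an infinitesimal motion that shortens no contact to first order shortens no
  contact at all, since \<open>\<bar>d + t d'\<bar>\<^sup>2 \<ge> \<bar>d\<bar>\<^sup>2 + 2 t (d \<bullet> d')\<close>.\<close>

lemma jammed_imp_strut_rigid:
  assumes jammed: "collectively_jammed \<Lambda> n p r"
    and q: "\<And>e. e \<in> E \<Longrightarrow> d e \<bullet> (q (src e) - q (tgt e)) \<ge> 0"
  shows "\<exists>w. \<forall>i\<in>{1..n}. q i = w"
proof -
  obtain \<eta> where \<eta>: "\<eta> > 0" "\<And>i j v. i \<in> {1..n} \<Longrightarrow> j \<in> {1..n} \<Longrightarrow> v \<in> \<Lambda> \<Longrightarrow> (i = j \<longrightarrow> v \<noteq> 0) \<Longrightarrow> (i, j, v) \<notin> E \<Longrightarrow>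
     norm (p i - p j - v) \<ge> r i + r j + \<eta>"
    using noncontact_gap by blast
  define M where "M = (\<Sum>i\<in>{1..n}. norm (q i))"
  have M: "norm (q i) \<le> M" if "i \<in> {1..n}" for i
    unfolding M_def using that by (intro member_le_sum) auto
  have M0: "M \<ge> 0" by (simp add: M_def sum_nonneg)
  \<comment> \<open>Two disks move relative to each other by at most
    \<open>\<epsilon> * (2 * M) \<le> \<eta>\<close>, too little to close a gap; the summand 1
    covers \<open>M = 0\<close>.\<close>
  define \<epsilon> where "\<epsilon> = \<eta> / (2 * M + 1)"
  have \<epsilon>: "\<epsilon> > 0" "\<epsilon> * (2 * M) \<le> \<eta>"
    using \<eta>(1) M0 by (auto simp: \<epsilon>_def field_simps)
  define Q where "Q t i = p i + (t * \<epsilon>) *\<^sub>R q i" for t i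
  have "is_packing \<Lambda> n (Q t) r" if t: "t \<in> {0..1}" for t
    unfolding is_packing_def
  proof (intro conjI ballI impI)
    fix i assume "i \<in> {1..n}" then show "r i > 0" by (rule r_pos)
  next
    fix i j v assume ij: "i \<in> {1..n}" "j \<in> {1..n}" "v \<in> \<Lambda>" "i = j \<longrightarrow> v \<noteq> 0"
    have Q: "Q t i - Q t j - v = (p i - p j - v) + (t * \<epsilon>) *\<^sub>R (q i - q j)"
      by (simp add: Q_def algebra_simps)
    show "norm (Q t i - Q t j - v) \<ge> r i + r j"
    proof (cases "(i, j, v) \<in> E")
      case True
      have "(p i - p j - v) \<bullet> (q i - q j) \<ge> 0" using q[OF True] by (simp add: d_def)
      then have "(t * \<epsilon>) * ((p i - p j - v) \<bullet> (q i - q j)) \<ge> 0" using t \<epsilon> by simp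
      moreover have "(t * \<epsilon>) * (t * \<epsilon>) * ((q i - q j) \<bullet> (q i - q j)) \<ge> 0" by simp
      moreover have "(x + s *\<^sub>R y) \<bullet> (x + s *\<^sub>R y) = x \<bullet> x + 2 * (s * (x \<bullet> y)) + s * s * (y \<bullet> y)" for x y :: "real^2" and s
        by (simp add: inner_add_left inner_add_right inner_commute[of y x] algebra_simps)
      from this[of "p i - p j - v" "t * \<epsilon>" "q i - q j"]
      have "(norm (Q t i - Q t j - v))\<^sup>2 = (norm (p i - p j - v))\<^sup>2
        + 2 * (t * \<epsilon> * ((p i - p j - v) \<bullet> (q i - q j))) + t * \<epsilon> * (t * \<epsilon>) * ((q i - q j) \<bullet> (q i - q j))"
        unfolding Q power2_norm_eq_inner .
      ultimately have "(norm (p i - p j - v))\<^sup>2 \<le> (norm (Q t i - Q t j - v))\<^sup>2" by linarith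
      then have "norm (p i - p j - v) \<le> norm (Q t i - Q t j - v)"
        by (rule power2_le_imp_le) simp
      then show ?thesis using True by (simp add: E_iff d_def)
    next
      case False
      have "norm ((t * \<epsilon>) *\<^sub>R (q i - q j)) = t * (\<epsilon> * norm (q i - q j))" using t \<epsilon> by simp
      also have "\<dots> \<le> 1 * (\<epsilon> * norm (q i - q j))" using t \<epsilon> by (intro mult_right_mono) auto
      also have "\<dots> \<le> \<epsilon> * (2 * M)"
        using norm_triangle_ineq4[of "q i" "q j"] M[OF ij(1)] M[OF ij(2)] \<epsilon> by simp
      also have "\<dots> \<le> \<eta>" by (rule \<epsilon>)
      finally have "norm ((t * \<epsilon>) *\<^sub>R (q i - q j)) \<le> \<eta>" .
      moreover have "norm (p i - p j - v) \<le> norm (Q t i - Q t j - v) + norm ((t * \<epsilon>) *\<^sub>R (q i - q j))"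
        unfolding Q using norm_triangle_ineq4[of "p i - p j - v + (t * \<epsilon>) *\<^sub>R (q i - q j)" "(t * \<epsilon>) *\<^sub>R (q i - q j)"] by simp
      ultimately show ?thesis using \<eta>(2)[OF ij False] by simp
    qed
  qed
  then have "is_motion \<Lambda> n p r Q"
    unfolding is_motion_def by (auto simp: Q_def intro!: continuous_intros)
  then obtain w where w: "\<And>i. i \<in> {1..n} \<Longrightarrow> Q 1 i = p i + w"
    using jammed unfolding collectively_jammed_def by (metis atLeastAtMost_iff order_refl zero_le_one)
  have "q i = (1 / \<epsilon>) *\<^sub>R w" if "i \<in> {1..n}" for i
  proof -
    have "\<epsilon> *\<^sub>R q i = w" using w[OF that] by (simp add: Q_def)
    then show ?thesis using \<epsilon>(1) by (simp flip: \<open>\<epsilon> *\<^sub>R q i = w\<close>)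
  qed
  then show ?thesis by blast
qed

text \<open>The first disk is pinned by two equations, which rules out translations; at most
  \<open>2 * n - 3\<close> contacts remain when one is dropped, so fewer than \<open>2 * n\<close>
  equations bind \<open>2 * n\<close> coordinates.\<close>

lemma card_contacts_ge:
  assumes jammed: "collectively_jammed \<Lambda> n p r" and n2: "n \<ge> 2"
  shows "card (contacts \<Lambda> n p r) \<ge> 2 * n - 1"
proof (rule ccontr)
  let ?C = "contacts \<Lambda> n p r"
  assume "\<not> card ?C \<ge> 2 * n - 1"
  then have le: "card ?C \<le> 2 * n - 2" by simp
  \<comment> \<open>The contact that may open. If there are none, \<open>C0\<close> is arbitrary and
    its removal changes nothing.\<close>
  define C0 where "C0 = (SOME C. C \<in> ?C)"
  have "card (?C - {C0}) + 2 < 2 * n"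
  proof (cases "?C = {}")
    case False
    then have "C0 \<in> ?C" unfolding C0_def by (simp add: some_in_eq)
    then have "card ?C = Suc (card (?C - {C0}))" using card_Suc_Diff1[OF fin_contacts] by metis
    then show ?thesis using le n2 by simp
  qed (use n2 in simp)
  moreover define J :: "((nat \<times> 2) + (nat \<times> nat \<times> (real^2)) set) set"
    where "J = Inl ` ({1} \<times> UNIV) \<union> Inr ` (?C - {C0})"
  have "card J \<le> card ({1::nat} \<times> (UNIV :: 2 set)) + card (?C - {C0})"
    unfolding J_def
    by (rule order_trans[OF card_Un_le add_mono[OF card_image_le card_image_le]]) (use fin_contacts in auto)
  moreover have "card ({1::nat} \<times> (UNIV :: 2 set)) = 2" by (simp add: card_cartesian_product)
  moreover have "card ({1..n} \<times> (UNIV :: 2 set)) = 2 * n" by (simp add: card_cartesian_product)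
  ultimately have card: "card J < card ({1..n} \<times> (UNIV :: 2 set))" by linarith
  have finJ: "finite J" unfolding J_def using fin_contacts by auto
  define rep where "rep C = (SOME e. e \<in> E \<and> contact_edge e = C)" for C
  have rep: "rep C \<in> E \<and> contact_edge (rep C) = C" if "C \<in> ?C" for C
    unfolding rep_def by (rule someI_ex) (use that in \<open>auto simp: contacts_eq\<close>)
  \<comment> \<open>Rows of the rigidity matrix, with one orientation chosen for each contact. The
    row of a loop is zero.\<close>
  define M where "M j km = (case j of Inl km' \<Rightarrow> of_bool (km = km')
    | Inr C \<Rightarrow> d (rep C) $ snd km * (of_bool (fst km = src (rep C)) - of_bool (fst km = tgt (rep C))))"
    for j and km :: "nat \<times> 2"
  obtain y where y: "\<exists>km\<in>{1..n} \<times> UNIV. y km \<noteq> 0"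
    "\<And>j. j \<in> J \<Longrightarrow> (\<Sum>km\<in>{1..n} \<times> UNIV. M j km * y km) = 0"
    using homogeneous_system[OF finJ finite_SigmaI[OF finite_atLeastAtMost finite_class.finite_UNIV] card, of M]
    by (elim exE conjE) blast
  define P where "P i = (\<chi> m. y (i, m))" for i
  have y1: "y (1, m) = 0" for m
  proof -
    have "(\<Sum>km\<in>{1..n} \<times> UNIV. M (Inl (1, m)) km * y km) = 0" by (rule y) (auto simp: J_def)
    moreover have "(\<Sum>km\<in>{1..n} \<times> UNIV. M (Inl (1, m)) km * y km) = (\<Sum>km\<in>{(1, m)}. y km)"
      by (rule sum.mono_neutral_cong_right) (use n2 in \<open>auto simp: M_def\<close>)
    ultimately show ?thesis by simp
  qed
  have C: "d (rep C) \<bullet> (P (src (rep C)) - P (tgt (rep C))) = 0" if "C \<in> ?C - {C0}" for C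
  proof -
    let ?e = "rep C"
    have st: "src ?e \<in> {1..n}" "tgt ?e \<in> {1..n}" using rep[of C] that by (auto simp: E_iff)
    have sel: "(\<Sum>k\<in>{1..n}. of_bool (k = i) * g k) = g i" if "i \<in> {1..n}" for i and g :: "nat \<Rightarrow> real"
    proof -
      have "(\<Sum>k\<in>{1..n}. of_bool (k = i) * g k) = (\<Sum>k\<in>{i}. g k)"
        by (rule sum.mono_neutral_cong_right) (use that in auto)
      then show ?thesis by simp
    qed
    have "0 = (\<Sum>km\<in>{1..n} \<times> UNIV. M (Inr C) km * y km)" using y(2)[of "Inr C"] that by (simp add: J_def)
    also have "\<dots> = (\<Sum>k\<in>{1..n}. \<Sum>m\<in>UNIV. M (Inr C) (k, m) * y (k, m))"
      by (simp add: sum.cartesian_product case_prod_unfold)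
    also have "\<dots> = (\<Sum>m\<in>UNIV. \<Sum>k\<in>{1..n}. M (Inr C) (k, m) * y (k, m))"
      by (rule sum.swap)
    also have "\<dots> = (\<Sum>m\<in>UNIV. d ?e $ m * (y (src ?e, m) - y (tgt ?e, m)))"
    proof (intro sum.cong refl)
      fix m
      have "(\<Sum>k\<in>{1..n}. M (Inr C) (k, m) * y (k, m))
        = (\<Sum>k\<in>{1..n}. of_bool (k = src ?e) * (d ?e $ m * y (k, m)) - of_bool (k = tgt ?e) * (d ?e $ m * y (k, m)))"
        by (intro sum.cong) (auto simp: M_def algebra_simps)
      then show "(\<Sum>k\<in>{1..n}. M (Inr C) (k, m) * y (k, m)) = d ?e $ m * (y (src ?e, m) - y (tgt ?e, m))"
        unfolding sum_subtractf sel[OF st(1)] sel[OF st(2)] by (simp add: algebra_simps)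
    qed
    also have "\<dots> = d ?e \<bullet> (P (src ?e) - P (tgt ?e))"
      by (simp add: inner_vec_def P_def)
    finally show ?thesis by simp
  qed
  define R where "R e = d e \<bullet> (P (src e) - P (tgt e))" for e
  have R_opp: "R (opp e) = R e" for e
    by (simp add: R_def d_opp inner_diff_right)
  have R0: "R e = 0" if "e \<in> E" "contact_edge e \<noteq> C0" for e
  proof -
    have "contact_edge e \<in> ?C" using that by (simp add: contacts_eq)
    then have "R (rep (contact_edge e)) = 0" and "contact_edge e = contact_edge (rep (contact_edge e))"
      using C[of "contact_edge e"] rep[of "contact_edge e"] that(2) by (simp_all add: R_def)
    then show ?thesis using R_opp[of e] contact_edge_eq_iff[of e "rep (contact_edge e)"] by metis
  qed
  \<comment> \<open>Both orientations of \<open>C0\<close> have the same first-order change of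
    length, so one sign opens it.\<close>
  define \<sigma> :: real where "\<sigma> = (if \<exists>e\<in>E. contact_edge e = C0 \<and> R e < 0 then -1 else 1)"
  have sgn: "\<sigma> * R e \<ge> 0" if e: "e \<in> E" for e
  proof (cases "contact_edge e = C0")
    case True
    have "R f = R e" if "f \<in> E" "contact_edge f = C0" for f
      using that True contact_edge_eq_iff[of e f] R_opp[of e] by auto
    then have same: "R f < 0 \<longleftrightarrow> R e < 0" if "f \<in> E" "contact_edge f = C0" for f using that by metis
    show ?thesis
    proof (cases "\<exists>f\<in>E. contact_edge f = C0 \<and> R f < 0")
      case True
      then have "R e < 0" using same by blast
      then show ?thesis using True by (simp add: \<sigma>_def)
    next
      case False
      then have "\<not> R e < 0" using e \<open>contact_edge e = C0\<close> by blast
      then show ?thesis using False by (simp add: \<sigma>_def)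
    qed
  qed (use R0 e in simp)
  have "\<exists>w. \<forall>i\<in>{1..n}. \<sigma> *\<^sub>R P i = w"
  proof (rule jammed_imp_strut_rigid[OF jammed])
    fix e assume "e \<in> E"
    moreover have "d e \<bullet> (\<sigma> *\<^sub>R P (src e) - \<sigma> *\<^sub>R P (tgt e)) = \<sigma> * R e"
      by (simp add: R_def inner_diff_right right_diff_distrib)
    ultimately show "d e \<bullet> (\<sigma> *\<^sub>R P (src e) - \<sigma> *\<^sub>R P (tgt e)) \<ge> 0"
      using sgn[of e] by simp
  qed
  then obtain w where w: "\<And>i. i \<in> {1..n} \<Longrightarrow> \<sigma> *\<^sub>R P i = w" by blast
  have "P 1 = 0" using y1 by (simp add: P_def vec_eq_iff)
  then have "w = 0" using w[of 1] n2 by simp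
  then have "P i = 0" if "i \<in> {1..n}" for i
    using w[OF that] by (auto simp: \<sigma>_def split: if_splits)
  then have "y (i, m) = 0" if "i \<in> {1..n}" for i m
    using that by (auto simp: P_def vec_eq_iff)
  then show False using y(1) by auto
qed

text \<open>Virtual work: a stress in equilibrium does no work on a displacement of the vertices,
  here one coordinate at a time.\<close>

lemma sum_force_difference:
  assumes sym: "\<And>e. e \<in> E \<Longrightarrow> \<omega> (opp e) = \<omega> e"
    and vertex: "\<And>k. k \<in> {1..n} \<Longrightarrow> (\<Sum>e\<in>{e\<in>E. src e = k}. \<omega> e *\<^sub>R d e) = 0"
  shows "(\<Sum>e\<in>E. \<omega> e * d e $ m * (g (src e) - g (tgt e))) = (0::real)"
proof -
  have 1: "(\<Sum>e\<in>E. \<omega> e * d e $ m * g (src e)) = 0"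
    unfolding sum_by_src
  proof (rule sum.neutral, rule ballI)
    fix k assume k: "k \<in> {1..n}"
    have "(\<Sum>e\<in>{e\<in>E. src e = k}. \<omega> e * d e $ m * g (src e)) = (\<Sum>e\<in>{e\<in>E. src e = k}. \<omega> e *\<^sub>R d e) $ m * g k"
      unfolding sum_component sum_distrib_right by (intro sum.cong) auto
    then show "(\<Sum>e\<in>{e\<in>E. src e = k}. \<omega> e * d e $ m * g (src e)) = 0" using vertex[OF k] by simp
  qed
  have "(\<Sum>e\<in>E. \<omega> e * d e $ m * g (tgt e)) = - (\<Sum>e\<in>E. \<omega> (opp e) * d (opp e) $ m * g (src (opp e)))"
    unfolding sum_negf[symmetric] by (intro sum.cong) (auto simp: sym d_opp)
  also have "\<dots> = 0" using sum_opp[of "\<lambda>e. \<omega> e * d e $ m * g (src e)"] 1 by simp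
  finally show ?thesis using 1 by (simp add: right_diff_distrib sum_subtractf)
qed

lemma sum_radii:
  assumes sym: "\<And>e. e \<in> E \<Longrightarrow> \<omega> (opp e) = \<omega> e"
  shows "(\<Sum>e\<in>E. \<omega> e * (r (src e) + r (tgt e)) * (g (src e) + g (tgt e)))
    = 2 * (\<Sum>e\<in>E. \<omega> e * (r (src e) + r (tgt e)) * (g (src e) :: real))"
proof -
  have "(\<Sum>e\<in>E. \<omega> e * (r (src e) + r (tgt e)) * g (tgt e))
    = (\<Sum>e\<in>E. \<omega> (opp e) * (r (src (opp e)) + r (tgt (opp e))) * g (src (opp e)))"
    by (intro sum.cong) (auto simp: sym add.commute)
  also have "\<dots> = (\<Sum>e\<in>E. \<omega> e * (r (src e) + r (tgt e)) * g (src e))"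
    by (rule sum_opp[of "\<lambda>e. \<omega> e * (r (src e) + r (tgt e)) * g (src e)"])
  finally show ?thesis by (simp add: distrib_left sum.distrib)
qed

end

section \<open>Stresses of zero energy at generic parameters\<close>

locale generic_torus_packing = torus_packing +
  assumes n1: "n \<ge> 1"
    and gen: "generic (map (\<lambda>i. r i / r 1) [2..<n+1] @ [a, b])"
begin

abbreviation params :: "real list" where
  "params \<equiv> map (\<lambda>i. r i / r 1) [2..<n+1] @ [a, b]"

lemma r1: "r 1 > 0"
  using r_pos n1 by simp

lemma params_nth:
  "params ! (n - 1) = a" "params ! n = b" "length params = n + 1"
  using n1 by (auto simp: nth_append nth_Cons' simp del: upt_Suc)

lemma params_nth_radius:
  assumes "2 \<le> i" "i \<le> n"
  shows "params ! (i - 2) = r i / r 1"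
proof -
  have "[2..<n+1] ! (i - 2) = i" using assms by (subst nth_upt) auto
  moreover have "i - 2 < n - 1" using assms by linarith
  ultimately show ?thesis by (simp add: nth_append del: upt_Suc)
qed

text \<open>Applying to the contact equations a derivation with arbitrary values at the generic
  parameters yields the linearized contact equations.\<close>

lemma linearized_contacts:
  fixes \<rho>' :: "nat \<Rightarrow> real" and a' b' :: real
  assumes \<rho>1: "\<rho>' 1 = 0"
  shows "\<exists>q1 q2 s. \<forall>e\<in>E.
     d e $ 1 * (q1 (src e) - q1 (tgt e) - (X (shift e) * a' + Y (shift e) * b')) +
     d e $ 2 * (q2 (src e) - q2 (tgt e) + Y (shift e) * (c\<^sup>2 * a'))
     = (r (src e) + r (tgt e)) * (\<rho>' (src e) * r 1 + r (src e) * s + (\<rho>' (tgt e) * r 1 + r (tgt e) * s))"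
proof -
  define w where "w k = (if k = n then b' else if k = n - 1 then a' else \<rho>' (k + 2))" for k
  define S where "S = {c} \<union> r ` {1..n} \<union> (\<lambda>i. p i $ 1) ` {1..n} \<union> (\<lambda>i. p i $ 2) ` {1..n}"
  have "finite S" by (simp add: S_def)
  then obtain K D where KD: "derivation_on K D" and SK: "S \<subseteq> K"
    and D: "\<And>k. k < n + 1 \<Longrightarrow> params ! k \<in> K \<and> D (params ! k) = w k"
    using generic_derivation_finite[OF gen, of S w] params_nth(3) by auto
  note diff = derivation_on_diff[OF KD] and mult = derivation_on_mult[OF KD] and add = derivation_on_add[OF KD]
    and sq = derivation_on_sq[OF KD]
  have "n - 1 < n + 1" "w (n - 1) = a'" using n1 by (auto simp: w_def)
  then have aK: "a \<in> K" "D a = a'"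
    using D[of "n - 1"] unfolding params_nth(1) by simp_all
  have bK: "b \<in> K" "D b = b'"
    using D[of n] unfolding params_nth(2) by (simp_all add: w_def)
  have cK: "c \<in> K" using SK by (simp add: S_def)
  have rK: "r i \<in> K" and pK: "p i $ 1 \<in> K" "p i $ 2 \<in> K" if "i \<in> {1..n}" for i
    using that SK by (auto simp: S_def)
  \<comment> \<open>The derivation sends \<open>a * c = 1\<close> to zero, which determines
    \<open>D c\<close>.\<close>
  have "a' * c + a * D c = 0"
    using mult[OF aK(1) cK] aK ac derivation_on_D_one[OF KD] by simp
  then have "c * (a' * c + a * D c) = 0" by simp
  then have "c\<^sup>2 * a' + (a * c) * D c = 0" by (simp add: algebra_simps power2_eq_square)
  then have Dc: "D c = - (c\<^sup>2 * a')" using ac by simp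
  \<comment> \<open>The logarithmic derivative of \<open>r 1\<close>, the unknown scaling rate: only
    ratios to \<open>r 1\<close> are prescribed.\<close>
  define s where "s = D (r 1) / r 1"
  have Dr: "D (r i) = \<rho>' i * r 1 + r i * s" if i: "i \<in> {1..n}" for i
  proof (cases "i = 1")
    case True
    then show ?thesis using \<rho>1 r1 by (simp add: s_def)
  next
    case False
    then have i2: "2 \<le> i" "i \<le> n" using i by auto
    have "i - 2 < n + 1" "i - 2 \<noteq> n" "i - 2 \<noteq> n - 1" "i - 2 + 2 = i" using i2 by auto
    then have "i - 2 < n + 1" "w (i - 2) = \<rho>' i" by (simp_all only: w_def if_False)
    then have "r i / r 1 \<in> K" "D (r i / r 1) = \<rho>' i"
      using D[of "i - 2"] unfolding params_nth_radius[OF i2] by simp_all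
    then have "D (r i / r 1 * r 1) = \<rho>' i * r 1 + r i / r 1 * D (r 1)"
      using mult[of "r i / r 1" "r 1"] rK[of 1] n1 by simp
    then show ?thesis using r1 by (simp add: s_def)
  qed
  have "d e $ 1 * (D (p (src e) $ 1) - D (p (tgt e) $ 1) - (X (shift e) * a' + Y (shift e) * b')) +
     d e $ 2 * (D (p (src e) $ 2) - D (p (tgt e) $ 2) + Y (shift e) * (c\<^sup>2 * a'))
     = (r (src e) + r (tgt e)) * (\<rho>' (src e) * r 1 + r (src e) * s + (\<rho>' (tgt e) * r 1 + r (tgt e) * s))"
    if e: "e \<in> E" for e
  proof -
    have st: "src e \<in> {1..n}" "tgt e \<in> {1..n}" and "shift e \<in> \<Lambda>" and nd: "norm (d e) = r (src e) + r (tgt e)"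
      using e by (auto simp: E_iff)
    then obtain k l :: int where kl: "X (shift e) = of_int k" "Y (shift e) = of_int l"
      using lattice_XY by blast
    have sh: "shift e $ 1 = of_int k * a + of_int l * b" "shift e $ 2 = of_int l * c"
      using inverse_XY[of "shift e"] by (simp_all add: kl mult.commute)
    \<comment> \<open>The lattice coordinates of a shift are integers with zero derivative, so the
      shift varies only with the lattice.\<close>
    have int: "of_int k \<in> K \<and> D (of_int k) = 0" for k by (rule derivation_on_of_int[OF KD])
    have ka: "of_int k * a \<in> K \<and> D (of_int k * a) = of_int k * a'" for k
      using mult[of "of_int k" a] int[of k] aK by simp
    have lb: "of_int k * b \<in> K \<and> D (of_int k * b) = of_int k * b'" for k
      using mult[of "of_int k" b] int[of k] bK by simp
    have lc: "shift e $ 2 \<in> K \<and> D (shift e $ 2) = - (of_int l * (c\<^sup>2 * a'))"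
      using mult[of "of_int l" c] int[of l] cK unfolding sh Dc by simp
    have s1: "shift e $ 1 \<in> K \<and> D (shift e $ 1) = of_int k * a' + of_int l * b'"
      unfolding sh using add[of "of_int k * a" "of_int l * b"] ka[of k] lb[of l] by simp
    have pp: "p (src e) $ m - p (tgt e) $ m \<in> K \<and> D (p (src e) $ m - p (tgt e) $ m) = D (p (src e) $ m) - D (p (tgt e) $ m)"
      if "m = 1 \<or> m = 2" for m :: 2
      using that diff pK st by auto
    have d1: "d e $ 1 \<in> K \<and> D (d e $ 1) = D (p (src e) $ 1) - D (p (tgt e) $ 1) - (of_int k * a' + of_int l * b')"
      unfolding d_def vector_minus_component using diff pp s1 by simp
    have d2: "d e $ 2 \<in> K \<and> D (d e $ 2) = D (p (src e) $ 2) - D (p (tgt e) $ 2) + of_int l * (c\<^sup>2 * a')"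
      unfolding d_def vector_minus_component using diff pp lc by simp
    have rr: "r (src e) + r (tgt e) \<in> K \<and> D (r (src e) + r (tgt e))
        = \<rho>' (src e) * r 1 + r (src e) * s + (\<rho>' (tgt e) * r 1 + r (tgt e) * s)"
      using add rK st Dr by simp
    have "(d e $ 1)\<^sup>2 + (d e $ 2)\<^sup>2 = (r (src e) + r (tgt e))\<^sup>2"
      using nd by (simp flip: norm_power2_2)
    then have "D ((d e $ 1)\<^sup>2 + (d e $ 2)\<^sup>2) = D ((r (src e) + r (tgt e))\<^sup>2)" by simp
    moreover have "D ((d e $ 1)\<^sup>2 + (d e $ 2)\<^sup>2) = 2 * (d e $ 1 * D (d e $ 1)) + 2 * (d e $ 2 * D (d e $ 2))"
      using add[of "(d e $ 1)\<^sup>2" "(d e $ 2)\<^sup>2"] sq[of "d e $ 1"] sq[of "d e $ 2"] d1 d2 by simp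
    ultimately have "d e $ 1 * D (d e $ 1) + d e $ 2 * D (d e $ 2) = (r (src e) + r (tgt e)) * D (r (src e) + r (tgt e))"
      using sq[of "r (src e) + r (tgt e)"] rr by simp
    then show ?thesis using d1 d2 rr by (simp add: kl)
  qed
  then show ?thesis
    by (intro exI[of _ "\<lambda>i. D (p i $ 1)"] exI[of _ "\<lambda>i. D (p i $ 2)"] exI[of _ s] ballI)
qed

text \<open>Paired with \<open>\<omega>\<close>, the linearized contact equations lose the motion of
  the centres by virtual work and the scaling rate by zero energy. What is left, \<open>lin\<close>,
  is linear in the free variations, so the coefficients can be compared.\<close>

lemma stress_zero_of_energy_zero:
  assumes sym: "\<And>e. e \<in> E \<Longrightarrow> \<omega> (opp e) = \<omega> e"
    and vertex: "\<And>k. k \<in> {1..n} \<Longrightarrow> (\<Sum>e\<in>{e\<in>E. src e = k}. \<omega> e *\<^sub>R d e) = 0"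
    and energy: "(\<Sum>e\<in>E. \<omega> e * (r (src e) + r (tgt e))\<^sup>2) = 0"
    and e: "e \<in> E"
  shows "\<omega> e = 0"
proof -
  have force0: "(\<Sum>e\<in>E. \<omega> e * d e $ m * (g (src e) - g (tgt e))) = 0" for m and g :: "nat \<Rightarrow> real"
    by (rule sum_force_difference) (use sym vertex in auto)
  define L1k where "L1k = (\<Sum>e\<in>E. \<omega> e * d e $ 1 * X (shift e))"
  define L1l where "L1l = (\<Sum>e\<in>E. \<omega> e * d e $ 1 * Y (shift e))"
  define L2l where "L2l = (\<Sum>e\<in>E. \<omega> e * d e $ 2 * Y (shift e))"
  have en: "(\<Sum>e\<in>E. \<omega> e * (r (src e) + r (tgt e)) * r (src e)) = 0"
    using sum_radii[where \<omega> = \<omega> and g = r, OF sym] energy by (simp add: power2_eq_square mult.assoc)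
  have lin: "- (L1k * a' + L1l * b') + L2l * (c\<^sup>2 * a')
      = 2 * r 1 * (\<Sum>e\<in>E. \<omega> e * (r (src e) + r (tgt e)) * \<rho>' (src e))"
    if \<rho>1: "\<rho>' 1 = 0" for \<rho>' a' b'
  proof -
    obtain q1 q2 s where q: "\<And>e. e \<in> E \<Longrightarrow>
     d e $ 1 * (q1 (src e) - q1 (tgt e) - (X (shift e) * a' + Y (shift e) * b')) +
     d e $ 2 * (q2 (src e) - q2 (tgt e) + Y (shift e) * (c\<^sup>2 * a'))
     = (r (src e) + r (tgt e)) * (\<rho>' (src e) * r 1 + r (src e) * s + (\<rho>' (tgt e) * r 1 + r (tgt e) * s))"
      using linearized_contacts[of \<rho>' a' b', OF \<rho>1] by blast
    define g where "g i = \<rho>' i * r 1 + r i * s" for i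
    have "(\<Sum>e\<in>E. \<omega> e * (r (src e) + r (tgt e)) * (g (src e) + g (tgt e)))
      = (\<Sum>e\<in>E. \<omega> e * d e $ 1 * (q1 (src e) - q1 (tgt e)) + \<omega> e * d e $ 2 * (q2 (src e) - q2 (tgt e))
         - \<omega> e * d e $ 1 * X (shift e) * a' - \<omega> e * d e $ 1 * Y (shift e) * b' + \<omega> e * d e $ 2 * Y (shift e) * (c\<^sup>2 * a'))"
    proof (intro sum.cong refl)
      fix e assume "e \<in> E"
      from arg_cong[OF q[OF this], of "\<lambda>x. \<omega> e * x"]
      show "\<omega> e * (r (src e) + r (tgt e)) * (g (src e) + g (tgt e))
        = \<omega> e * d e $ 1 * (q1 (src e) - q1 (tgt e)) + \<omega> e * d e $ 2 * (q2 (src e) - q2 (tgt e))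
         - \<omega> e * d e $ 1 * X (shift e) * a' - \<omega> e * d e $ 1 * Y (shift e) * b' + \<omega> e * d e $ 2 * Y (shift e) * (c\<^sup>2 * a')"
        by (simp add: g_def algebra_simps)
    qed
    also have "\<dots> = - (L1k * a' + L1l * b') + L2l * (c\<^sup>2 * a')"
      by (simp add: sum.distrib sum_subtractf force0[of 1 q1] force0[of 2 q2] L1k_def L1l_def L2l_def flip: sum_distrib_right)
    finally have "2 * (\<Sum>e\<in>E. \<omega> e * (r (src e) + r (tgt e)) * g (src e)) = - (L1k * a' + L1l * b') + L2l * (c\<^sup>2 * a')"
      by (simp add: sum_radii[where \<omega> = \<omega> and g = g, OF sym])
    moreover have "(\<Sum>e\<in>E. \<omega> e * (r (src e) + r (tgt e)) * g (src e))
      = r 1 * (\<Sum>e\<in>E. \<omega> e * (r (src e) + r (tgt e)) * \<rho>' (src e)) + s * (\<Sum>e\<in>E. \<omega> e * (r (src e) + r (tgt e)) * r (src e))"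
      unfolding sum_distrib_left sum.distrib[symmetric] by (intro sum.cong) (auto simp: g_def algebra_simps)
    ultimately show ?thesis using en by simp
  qed
  have L1l: "L1l = 0" using lin[of "\<lambda>_. 0" 0 1] by simp
  have L1k: "L1k = c\<^sup>2 * L2l" using lin[of "\<lambda>_. 0" 1 0] by (simp add: mult.commute)
  define V where "V k = (\<Sum>e\<in>{e\<in>E. src e = k}. \<omega> e * (r (src e) + r (tgt e)))" for k
  have V: "(\<Sum>e\<in>E. \<omega> e * (r (src e) + r (tgt e)) * g (src e)) = (\<Sum>k\<in>{1..n}. V k * g k)" for g
    unfolding V_def sum_distrib_right by (subst sum_by_src, intro sum.cong refl) auto
  have Vk: "V k = 0" if k: "k \<in> {1..n}" "k \<noteq> 1" for k
  proof -
    have "(\<Sum>j\<in>{1..n}. V j * of_bool (j = k)) = 0"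
      using lin[of "\<lambda>j. of_bool (j = k)" 0 0] V[of "\<lambda>j. of_bool (j = k)"] k r1 by simp
    moreover have "(\<Sum>j\<in>{1..n}. V j * of_bool (j = k)) = (\<Sum>j\<in>{k}. V j)"
      by (rule sum.mono_neutral_cong_right) (use k in auto)
    ultimately show ?thesis by simp
  qed
  \<comment> \<open>The first ratio is constantly 1 and cannot be varied, so the first vertex is
    obtained from the energy instead.\<close>
  have "(\<Sum>k\<in>{1..n}. V k * r k) = (\<Sum>k\<in>{1}. V k * r k)"
    by (rule sum.mono_neutral_cong_right) (use Vk n1 in auto)
  then have V1: "V 1 = 0" using en r1 unfolding V[of r] by simp
  have radii: "V k = 0" if "k \<in> {1..n}" for k using Vk[OF that] V1 by (cases "k = 1") auto
  \<comment> \<open>Virtual work with the centres themselves as displacement leaves only the lattice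
    shifts.\<close>
  have S: "(\<Sum>e\<in>E. \<omega> e * d e $ m * d e $ k) = - (\<Sum>e\<in>E. \<omega> e * d e $ m * shift e $ k)" for m k
  proof -
    have "(\<Sum>e\<in>E. \<omega> e * d e $ m * d e $ k)
      = (\<Sum>e\<in>E. \<omega> e * d e $ m * (p (src e) $ k - p (tgt e) $ k)) - (\<Sum>e\<in>E. \<omega> e * d e $ m * shift e $ k)"
      unfolding sum_subtractf[symmetric] by (intro sum.cong) (auto simp: d_def algebra_simps)
    then show ?thesis using force0[of m "\<lambda>i. p i $ k"] by simp
  qed
  have "(\<Sum>e\<in>E. \<omega> e * d e $ 1 * shift e $ 1) = a * L1k + b * L1l"
    unfolding L1k_def L1l_def sum_distrib_left sum.distrib[symmetric] inverse_XY[of "shift _"] by (intro sum.cong) (simp_all add: algebra_simps)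
  then have S11: "(\<Sum>e\<in>E. \<omega> e * d e $ 1 * d e $ 1) = - (a * L1k)" unfolding S using L1l by simp
  have "(\<Sum>e\<in>E. \<omega> e * d e $ 1 * shift e $ 2) = c * L1l"
    unfolding L1l_def sum_distrib_left inverse_XY[of "shift _"] by (intro sum.cong) simp_all
  then have S12: "(\<Sum>e\<in>E. \<omega> e * d e $ 1 * d e $ 2) = 0" unfolding S using L1l by simp
  have "(\<Sum>e\<in>E. \<omega> e * d e $ 2 * shift e $ 2) = c * L2l"
    unfolding L2l_def sum_distrib_left inverse_XY[of "shift _"] by (intro sum.cong) simp_all
  then have S22: "(\<Sum>e\<in>E. \<omega> e * d e $ 2 * d e $ 2) = - (c * L2l)" unfolding S by simp
  have "a * L1k = (a * c) * (c * L2l)" unfolding L1k by (simp add: power2_eq_square)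
  then have S11': "(\<Sum>e\<in>E. \<omega> e * d e $ 1 * d e $ 1) = - (c * L2l)" using S11 ac by simp
  \<comment> \<open>The variation of \<open>a\<close> has made the two diagonal entries equal; their
    sum is the energy, hence both vanish.\<close>
  have "(\<Sum>e\<in>E. \<omega> e * d e $ 1 * d e $ 1) + (\<Sum>e\<in>E. \<omega> e * d e $ 2 * d e $ 2) = (\<Sum>e\<in>E. \<omega> e * (r (src e) + r (tgt e))\<^sup>2)"
    unfolding sum.distrib[symmetric]
  proof (intro sum.cong refl)
    fix e assume "e \<in> E"
    then have "(r (src e) + r (tgt e))\<^sup>2 = (d e $ 1)\<^sup>2 + (d e $ 2)\<^sup>2" by (simp add: E_iff flip: norm_power2_2)
    then show "\<omega> e * d e $ 1 * d e $ 1 + \<omega> e * d e $ 2 * d e $ 2 = \<omega> e * (r (src e) + r (tgt e))\<^sup>2"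
      by (simp add: power2_eq_square algebra_simps)
  qed
  then have "c * L2l = 0" using S11' S22 energy by linarith
  then have moment: "(\<Sum>e\<in>E. \<omega> e * d e $ 1 * d e $ 1) = 0" using S11' by simp
  interpret torus_stress n p r a b c \<omega>
  proof
    show "(\<Sum>e\<in>E. \<omega> e * (d e $ 1)\<^sup>2) = 0" "(\<Sum>e\<in>E. \<omega> e * (d e $ 1 * d e $ 2)) = 0"
      using moment S12 by (simp_all add: power2_eq_square mult.assoc)
    show "\<omega> (opp e) = \<omega> e" if "e \<in> E" for e using that by (rule sym)
    show "(\<Sum>e\<in>{e\<in>E. src e = k}. \<omega> e *\<^sub>R d e) = 0" if "k \<in> {1..n}" for k using that by (rule vertex)
    show "(\<Sum>e\<in>{e\<in>E. src e = k}. \<omega> e * (r (src e) + r (tgt e))) = 0" if "k \<in> {1..n}" for k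
      using radii[OF that] by (simp only: V_def)
  qed
  show ?thesis by (rule stress_zero[OF e])
qed

end

subsection \<open>Counting contacts\<close>

lemma lookup_scaleR: "Poly_Mapping.lookup (t *\<^sub>R \<omega>) C = t *\<^sub>R Poly_Mapping.lookup \<omega> C"
  for \<omega> :: "'k \<Rightarrow>\<^sub>0 'v::real_vector"
proof -
  have "finite {i. t *\<^sub>R Poly_Mapping.lookup \<omega> i \<noteq> 0}"
    by (rule finite_subset[OF _ finite_lookup[of \<omega>]]) auto
  then show ?thesis by (simp add: scaleR_poly_mapping_def lookup_Abs_poly_mapping)
qed

context generic_torus_packing
begin

abbreviation contacts' where "contacts' \<equiv> contacts \<Lambda> n p r"

text \<open>The unknowns live on contacts, the equations on oriented edges; summing over a fibre of
  \<open>contact_edge\<close> gives the coefficient of an unknown.\<close>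

lemma sum_by_contact:
  assumes "E' \<subseteq> E"
  shows "(\<Sum>C\<in>contacts'. (\<Sum>e\<in>{e\<in>E'. contact_edge e = C}. g e) * x C) = (\<Sum>e\<in>E'. x (contact_edge e) * (g e :: real))"
proof -
  have "(\<Sum>C\<in>contacts'. (\<Sum>e\<in>{e\<in>E'. contact_edge e = C}. g e) * x C)
    = (\<Sum>C\<in>contacts'. \<Sum>e\<in>{e\<in>E'. contact_edge e = C}. x (contact_edge e) * g e)"
    unfolding sum_distrib_right by (intro sum.cong) auto
  also have "\<dots> = (\<Sum>e\<in>E'. x (contact_edge e) * g e)"
    using assms finite_subset[OF assms finE] by (intro sum.group fin_contacts) (auto simp: contacts_eq)
  finally show ?thesis .
qed

text \<open>The forces of a stress add up to zero over all vertices, so that equilibrium at the first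
  vertex need not be demanded.\<close>

lemma equilibrium_from_second_vertex:
  assumes sym: "\<And>e. e \<in> E \<Longrightarrow> \<omega> (opp e) = \<omega> e"
    and eq: "\<And>k m. k \<in> {2..n} \<Longrightarrow> (\<Sum>e\<in>{e\<in>E. src e = k}. \<omega> e * d e $ m) = 0"
    and k: "k \<in> {1..n}"
  shows "(\<Sum>e\<in>{e\<in>E. src e = k}. \<omega> e *\<^sub>R d e) = 0"
proof -
  have "(\<Sum>e\<in>{e\<in>E. src e = k}. \<omega> e * d e $ m) = 0" for m
  proof (cases "k = 1")
    case True
    have "0 = (\<Sum>e\<in>E. \<omega> e * d e $ m)"
      by (rule sum_antisymmetric[symmetric]) (simp add: sym d_opp)
    also have "\<dots> = (\<Sum>k\<in>{1..n}. \<Sum>e\<in>{e\<in>E. src e = k}. \<omega> e * d e $ m)" by (rule sum_by_src)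
    also have "\<dots> = (\<Sum>k\<in>{1}. \<Sum>e\<in>{e\<in>E. src e = k}. \<omega> e * d e $ m)"
    proof (rule sum.mono_neutral_right)
      show "\<forall>k\<in>{1..n} - {1}. (\<Sum>e\<in>{e\<in>E. src e = k}. \<omega> e * d e $ m) = 0"
      proof
        fix k assume "k \<in> {1..n} - {1}"
        then have "k \<in> {2..n}" by auto
        then show "(\<Sum>e\<in>{e\<in>E. src e = k}. \<omega> e * d e $ m) = 0" by (rule eq)
      qed
    qed (use n1 in auto)
    finally show ?thesis using True by simp
  next
    case False
    then show ?thesis using k by (intro eq) auto
  qed
  then show ?thesis by (simp add: vec_eq_iff sum_component)
qed

text \<open>With the energy equation this refutes \<open>2 * n\<close> contacts; without it, it
  supplies the stress that spans the space.\<close>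

lemma nontrivial_stress:
  assumes card: "2 * n - 2 + (if energy then 1 else 0) < card contacts'"
  shows "\<exists>x. (\<exists>C\<in>contacts'. x C \<noteq> 0) \<and>
    (\<forall>k\<in>{1..n}. (\<Sum>e\<in>{e\<in>E. src e = k}. x (contact_edge e) *\<^sub>R d e) = 0) \<and>
    (energy \<longrightarrow> (\<Sum>e\<in>E. x (contact_edge e) * (r (src e) + r (tgt e))\<^sup>2) = 0)"
proof -
  define J :: "((nat \<times> 2) + unit) set" where
    "J = Inl ` ({2..n} \<times> UNIV) \<union> (if energy then {Inr ()} else {})"
  have finJ: "finite J" by (simp add: J_def)
  have "card J \<le> card ({2..n} \<times> (UNIV :: 2 set)) + (if energy then 1 else 0)"
    unfolding J_def by (rule order_trans[OF card_Un_le add_mono[OF card_image_le]]) auto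
  also have "card ({2..n} \<times> (UNIV :: 2 set)) = 2 * n - 2" using n1 by (simp add: card_cartesian_product)
  finally have cardJ: "card J < card contacts'" using card by linarith
  define M where "M j C = (case j of Inl km \<Rightarrow> \<Sum>e\<in>{e\<in>{e\<in>E. src e = fst km}. contact_edge e = C}. d e $ snd km
    | Inr _ \<Rightarrow> \<Sum>e\<in>{e\<in>E. contact_edge e = C}. (r (src e) + r (tgt e))\<^sup>2)" for j :: "(nat \<times> 2) + unit" and C
  obtain x where x: "\<exists>C\<in>contacts'. x C \<noteq> 0" "\<And>j. j \<in> J \<Longrightarrow> (\<Sum>C\<in>contacts'. M j C * x C) = 0"
    using homogeneous_system[OF finJ fin_contacts cardJ, of M] by (elim exE conjE) blast
  have "(\<Sum>e\<in>{e\<in>E. src e = k}. x (contact_edge e) *\<^sub>R d e) = 0" if "k \<in> {1..n}" for k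
  proof (rule equilibrium_from_second_vertex[OF _ _ that])
    fix k and m :: 2 assume "k \<in> {2..n}"
    then have "(\<Sum>C\<in>contacts'. M (Inl (k, m)) C * x C) = 0" by (intro x) (auto simp: J_def)
    then show "(\<Sum>e\<in>{e\<in>E. src e = k}. x (contact_edge e) * d e $ m) = 0"
      using sum_by_contact[of "{e\<in>E. src e = k}" "\<lambda>e. d e $ m" x] by (simp add: M_def)
  qed (simp add: contact_edge_opp)
  moreover have "(\<Sum>e\<in>E. x (contact_edge e) * (r (src e) + r (tgt e))\<^sup>2) = 0" if energy
  proof -
    have "(\<Sum>C\<in>contacts'. M (Inr ()) C * x C) = 0" using that by (intro x) (auto simp: J_def)
    then show ?thesis
      using sum_by_contact[of E "\<lambda>e. (r (src e) + r (tgt e))\<^sup>2" x] by (simp add: M_def)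
  qed
  ultimately show ?thesis using x(1) by blast
qed

lemma contact_stress_zero:
  assumes "\<And>k. k \<in> {1..n} \<Longrightarrow> (\<Sum>e\<in>{e\<in>E. src e = k}. x (contact_edge e) *\<^sub>R d e) = 0"
    and "(\<Sum>e\<in>E. x (contact_edge e) * (r (src e) + r (tgt e))\<^sup>2) = 0" and "C \<in> contacts'"
  shows "x C = 0"
proof -
  obtain e where "e \<in> E" "C = contact_edge e" using assms(3) by (auto simp: contacts_eq)
  then show ?thesis
    using stress_zero_of_energy_zero[of "\<lambda>e. x (contact_edge e)" e] assms(1,2)
    by (simp add: contact_edge_opp)
qed

lemma card_contacts_le: "card contacts' \<le> 2 * n - 1"
proof (rule ccontr)
  assume "\<not> card contacts' \<le> 2 * n - 1"
  then have "2 * n - 2 + (if True then 1 else 0) < card contacts'" using n1 by simp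
  from nontrivial_stress[OF this] contact_stress_zero show False by blast
qed

lemma equilibrium_stresses_iff:
  "\<omega> \<in> equilibrium_stresses \<Lambda> n p r \<longleftrightarrow> Poly_Mapping.keys \<omega> \<subseteq> contacts' \<and>
    (\<forall>k\<in>{1..n}. (\<Sum>e\<in>{e\<in>E. src e = k}. Poly_Mapping.lookup \<omega> (contact_edge e) *\<^sub>R d e) = 0)"
  unfolding equilibrium_stresses_def E_def d_def by (simp add: case_prod_unfold)

lemma isostatic_if_card:
  assumes card: "card contacts' = 2 * n - 1"
  shows "isostatic \<Lambda> n p r"
proof -
  let ?S = "equilibrium_stresses \<Lambda> n p r"
  have "2 * n - 2 + (if False then 1 else 0) < card contacts'" using n1 card by simp
  from nontrivial_stress[OF this] obtain x where x: "\<exists>C\<in>contacts'. x C \<noteq> 0"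
    "\<And>k. k \<in> {1..n} \<Longrightarrow> (\<Sum>e\<in>{e\<in>E. src e = k}. x (contact_edge e) *\<^sub>R d e) = 0" by blast
  define \<omega>0 where "\<omega>0 = (\<Sum>C\<in>contacts'. Poly_Mapping.single C (x C))"
  have lookup: "Poly_Mapping.lookup \<omega>0 C = (if C \<in> contacts' then x C else 0)" for C
    unfolding \<omega>0_def lookup_sum lookup_single when_def using fin_contacts by simp
  have lookup_edge: "Poly_Mapping.lookup \<omega>0 (contact_edge e) = x (contact_edge e)" if "e \<in> E" for e
    using that by (simp add: lookup contacts_eq)
  have "(\<Sum>e\<in>{e\<in>E. src e = k}. Poly_Mapping.lookup \<omega>0 (contact_edge e) *\<^sub>R d e)
    = (\<Sum>e\<in>{e\<in>E. src e = k}. x (contact_edge e) *\<^sub>R d e)" for k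
    by (intro sum.cong) (auto simp: lookup_edge)
  then have \<omega>0: "\<omega>0 \<in> ?S"
    unfolding equilibrium_stresses_iff using x(2) by (auto simp: in_keys_iff lookup split: if_splits)
  have nz: "\<omega>0 \<noteq> 0"
  proof
    assume "\<omega>0 = 0"
    then have "x C = 0" if "C \<in> contacts'" for C using lookup[of C] that by simp
    then show False using x(1) by blast
  qed
  define A where "A \<omega> = (\<Sum>e\<in>E. Poly_Mapping.lookup \<omega> (contact_edge e) * (r (src e) + r (tgt e))\<^sup>2)" for \<omega>
  have zero: "\<omega> = 0" if \<omega>: "\<omega> \<in> ?S" "A \<omega> = 0" for \<omega>
  proof (rule poly_mapping_eqI)
    fix C
    show "Poly_Mapping.lookup \<omega> C = Poly_Mapping.lookup 0 C"
    proof (cases "C \<in> contacts'")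
      case True
      then show ?thesis
        using contact_stress_zero[of "Poly_Mapping.lookup \<omega>" C] \<omega> unfolding equilibrium_stresses_iff A_def by simp
    next
      case False
      then show ?thesis using \<omega>(1) unfolding equilibrium_stresses_iff by (auto simp: in_keys_iff)
    qed
  qed
  then have A0: "A \<omega>0 \<noteq> 0" using \<omega>0 nz by blast
  have "\<omega> = (A \<omega> / A \<omega>0) *\<^sub>R \<omega>0" if \<omega>: "\<omega> \<in> ?S" for \<omega>
  proof -
    \<comment> \<open>Chosen so that \<open>\<omega> - t *\<^sub>R \<omega>0\<close> has zero
      energy.\<close>
    define t where "t = A \<omega> / A \<omega>0"
    have l: "Poly_Mapping.lookup (\<omega> - t *\<^sub>R \<omega>0) C = Poly_Mapping.lookup \<omega> C - t * Poly_Mapping.lookup \<omega>0 C" for C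
      by (simp add: lookup_minus lookup_scaleR)
    have "\<omega> - t *\<^sub>R \<omega>0 \<in> ?S"
      unfolding equilibrium_stresses_iff
    proof (intro conjI ballI)
      have "Poly_Mapping.lookup \<omega> C = 0" "Poly_Mapping.lookup \<omega>0 C = 0" if "C \<notin> contacts'" for C
        using that \<omega> \<omega>0 unfolding equilibrium_stresses_iff by (auto simp: in_keys_iff)
      then show "Poly_Mapping.keys (\<omega> - t *\<^sub>R \<omega>0) \<subseteq> contacts'"
        by (auto simp: in_keys_iff l) (metis diff_zero mult_zero_right)
      fix k assume k: "k \<in> {1..n}"
      have "(\<Sum>e\<in>{e\<in>E. src e = k}. Poly_Mapping.lookup (\<omega> - t *\<^sub>R \<omega>0) (contact_edge e) *\<^sub>R d e)
        = (\<Sum>e\<in>{e\<in>E. src e = k}. Poly_Mapping.lookup \<omega> (contact_edge e) *\<^sub>R d e)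
        - t *\<^sub>R (\<Sum>e\<in>{e\<in>E. src e = k}. Poly_Mapping.lookup \<omega>0 (contact_edge e) *\<^sub>R d e)"
        unfolding l by (simp add: scaleR_diff_left sum_subtractf scaleR_sum_right)
      then show "(\<Sum>e\<in>{e\<in>E. src e = k}. Poly_Mapping.lookup (\<omega> - t *\<^sub>R \<omega>0) (contact_edge e) *\<^sub>R d e) = 0"
        using \<omega> \<omega>0 k unfolding equilibrium_stresses_iff by simp
    qed
    moreover have "A (\<omega> - t *\<^sub>R \<omega>0) = A \<omega> - t * A \<omega>0"
      unfolding A_def l by (simp add: left_diff_distrib sum_subtractf sum_distrib_left mult.assoc)
    then have "A (\<omega> - t *\<^sub>R \<omega>0) = 0" using A0 by (simp add: t_def)
    ultimately have "\<omega> - t *\<^sub>R \<omega>0 = 0" by (rule zero)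
    then show ?thesis by (simp add: t_def)
  qed
  then have "?S \<subseteq> span {\<omega>0}"
    unfolding span_singleton by blast
  moreover have "independent {\<omega>0}" using nz by simp
  ultimately have "dim ?S = 1" using \<omega>0 by (intro dim_unique[of "{\<omega>0}"]) auto
  then show ?thesis by (simp add: isostatic_def)
qed

end

theorem theorem8p1:
  fixes n :: nat and p :: "nat \<Rightarrow> real^2" and r :: "nat \<Rightarrow> real" and a b c :: real
  assumes "n \<ge> 1"
    and "a > 0" and "b > 0" and "c > 0" and "a * c = 1"
    and "is_packing (planar_lattice a b c) n p r"
    and "collectively_jammed (planar_lattice a b c) n p r"
    and "n = 1 \<Longrightarrow> contacts (planar_lattice a b c) n p r \<noteq> {}"
    and "generic (map (\<lambda>i. r i / r 1) [2..<n+1] @ [a, b])"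
  shows "card (contacts (planar_lattice a b c) n p r) = 2 * n - 1
       \<and> isostatic (planar_lattice a b c) n p r"
proof -
  interpret generic_torus_packing n p r a b c
    by unfold_locales (rule assms)+
  have "card contacts' \<ge> 2 * n - 1"
  proof (cases "n = 1")
    \<comment> \<open>A single disk can only be translated, so jamming yields nothing here and the
      contact comes from the hypothesis for \<open>n = 1\<close>.\<close>
    case True
    then show ?thesis using assms(8) fin_contacts by (simp add: Suc_le_eq card_gt_0_iff)
  next
    case False
    then show ?thesis using n1 by (intro card_contacts_ge assms(7)) simp
  qed
  then have "card contacts' = 2 * n - 1" using card_contacts_le by simp
  then show ?thesis using isostatic_if_card by blast
qed

end
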